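(* Let $A$ be a commutative special algebra with radical $J$, let $E$ be a vector space complement of $J^2$ in $J$, and let $0\ne a\in E$. The following conditions are equivalent: (i) The element $\langle a\rangle$ does not belong to a bar. (ii) The atom $C(a)$ is extensionless. (iii) The trace of $C(a)$ in ${}_AA$ is an atom (in particular, $C(a)$ is torsionless). (iv) The atom $C(a)$ is Gorenstein-projective. (v) The atom $C(a)$ is reflexive. If these conditions are satisfied, then $C(a)$ is $\Omega$-periodic with period at most $2$.
   Context: $k$ is an algebraically closed field; algebras are finite-dimensional $k$-algebras and modules are finitely generated. A local algebra $A$ with radical $J$ is short of Hilbert type $(3,2)$ if $J^3=0$, $\dim_k J/J^2=3$, $\dim_k J^2=2$. Such an algebra is special if $J^2=\operatorname{soc}({}_AA)=\operatorname{soc}(A_A)$ and there is no uniform left ideal of length $3$ (uniform: simple socle). For $a\in J\setminus J^2$ put $U(a)=Aa+J^2$ and $C(a)=A/U(a)$. An atom is a local module of length $3$ and Loewy length $2$. For $A$ commutative special, a bar is a $4$-dimensional ideal of $A$ contained in $J$ which is not faithful as an $A/J^2$-module (an ideal $N\subseteq J$ is an $A/J^2$-module, since $J^3=0$); $\langle a\rangle$ belongs to a bar $N$ if $a\in N$. The trace of $M$ in $N$ is the sum of the images of all homomorphisms $M\to N$. A module $M$ is extensionless if $\operatorname{Ext}^1_A(M,A)=0$; torsionless if it embeds into a projective module; reflexive if the canonical map $M\to M^{**}$ is bijective, where $M^*=\operatorname{Hom}_A(M,A)$; Gorenstein-projective if there is an exact complex $\cdots\to P_1\xrightarrow{f_1}P_0\xrightarrow{f_0}P_{-1}\to\cdots$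 of projective modules which remains exact after applying $\operatorname{Hom}_A(-,A)$ and such that $M$ is the image of $f_0$. $\Omega M$ is the kernel of a projective cover of $M$; $M$ is $\Omega$-periodic with period at most $2$ if $\Omega^t M\simeq M$ for some $t\in\{1,2\}$. *)

theory Defs
  imports "HOL-Algebra.Algebra"
begin

section \<open>Modules over a commutative ring\<close>

text \<open>
  A commutative \<open>k\<close>-algebra is given by the locale \<^locale>\<open>algebra\<close>; a module over a ring is a record of
  type \<^type>\<open>module_scheme\<close> satisfying the locale \<^locale>\<open>module\<close>. The fields \<open>mult\<close> and \<open>one\<close> of such a
  record carry no information about the module. A submodule \<open>N\<close> of \<open>M\<close> is viewed as a module via
  \<open>M\<lparr>carrier := N\<rparr>\<close>. Since all algebras are commutative, left and right modules are identified.
\<close>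

definition regular_module :: "('a, 'm) ring_scheme \<Rightarrow> ('a, 'a) module" where
  "regular_module R =
     \<lparr>carrier = carrier R, monoid.mult = monoid.mult R, one = \<one>\<^bsub>R\<^esub>, ring.zero = \<zero>\<^bsub>R\<^esub>, add = add R,
      smult = monoid.mult R\<rparr>"

definition quot_module :: "('a, 'b, 'm) module_scheme \<Rightarrow> 'b set \<Rightarrow> ('a, 'b set) module" where
  "quot_module M N =
     \<lparr>carrier = a_rcosets\<^bsub>M\<^esub> N, monoid.mult = undefined, one = undefined, ring.zero = N,
      add = set_add M,
      smult = (\<lambda>r Z. \<Union>x\<in>Z. N +>\<^bsub>M\<^esub> (r \<odot>\<^bsub>M\<^esub> x))\<rparr>"

definition submodule_gen ::
    "('a, 'm) ring_scheme \<Rightarrow> ('a, 'b, 'n) module_scheme \<Rightarrow> 'b set \<Rightarrow> 'b set" where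
  "submodule_gen R M S = \<Inter>{N. submodule N R M \<and> S \<subseteq> N}"

definition fin_gen :: "('a, 'm) ring_scheme \<Rightarrow> ('a, 'b, 'n) module_scheme \<Rightarrow> bool" where
  "fin_gen R M \<longleftrightarrow> (\<exists>S. finite S \<and> S \<subseteq> carrier M \<and> submodule_gen R M S = carrier M)"

definition maximal_submodule ::
    "'b set \<Rightarrow> ('a, 'm) ring_scheme \<Rightarrow> ('a, 'b, 'n) module_scheme \<Rightarrow> bool" where
  "maximal_submodule N R M \<longleftrightarrow>
     submodule N R M \<and> N \<noteq> carrier M \<and>
     (\<forall>L. submodule L R M \<and> N \<subseteq> L \<longrightarrow> L = N \<or> L = carrier M)"

definition simple_module :: "('a, 'm) ring_scheme \<Rightarrow> ('a, 'b, 'n) module_scheme \<Rightarrow> bool" where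
  "simple_module R M \<longleftrightarrow>
     module R M \<and> carrier M \<noteq> {\<zero>\<^bsub>M\<^esub>} \<and>
     (\<forall>L. submodule L R M \<longrightarrow> L = {\<zero>\<^bsub>M\<^esub>} \<or> L = carrier M)"

definition socle :: "('a, 'm) ring_scheme \<Rightarrow> ('a, 'b, 'n) module_scheme \<Rightarrow> 'b set" where
  "socle R M =
     submodule_gen R M (\<Union>{N. submodule N R M \<and> simple_module R (M\<lparr>carrier := N\<rparr>)})"

definition uniform_module :: "('a, 'm) ring_scheme \<Rightarrow> ('a, 'b, 'n) module_scheme \<Rightarrow> bool" where
  "uniform_module R M \<longleftrightarrow> simple_module R (M\<lparr>carrier := socle R M\<rparr>)"

text \<open>\<open>M\<close> has a composition series with \<open>n\<close> factors.\<close>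

definition has_length ::
    "('a, 'm) ring_scheme \<Rightarrow> ('a, 'b, 'n) module_scheme \<Rightarrow> nat \<Rightarrow> bool" where
  "has_length R M n \<longleftrightarrow>
     (\<exists>F :: nat \<Rightarrow> 'b set. F 0 = {\<zero>\<^bsub>M\<^esub>} \<and> F n = carrier M \<and>
        (\<forall>i\<le>n. submodule (F i) R M) \<and>
        (\<forall>i<n. maximal_submodule (F i) R (M\<lparr>carrier := F (Suc i)\<rparr>)))"

definition local_module :: "('a, 'm) ring_scheme \<Rightarrow> ('a, 'b, 'n) module_scheme \<Rightarrow> bool" where
  "local_module R M \<longleftrightarrow> (\<exists>!N. maximal_submodule N R M)"

definition faithful_module :: "('a, 'm) ring_scheme \<Rightarrow> ('a, 'b, 'n) module_scheme \<Rightarrow> bool" where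
  "faithful_module R M \<longleftrightarrow>
     (\<forall>r\<in>carrier R. (\<forall>m\<in>carrier M. r \<odot>\<^bsub>M\<^esub> m = \<zero>\<^bsub>M\<^esub>) \<longrightarrow> r = \<zero>\<^bsub>R\<^esub>)"

text \<open>
  An \<open>R\<close>-module annihilated by an ideal \<open>I\<close>, viewed as a module over \<open>R Quot I\<close>: all elements of a
  coset act in the same way.
\<close>

definition factor_action :: "('a, 'b, 'n) module_scheme \<Rightarrow> ('a set, 'b) module" where
  "factor_action M =
     \<lparr>carrier = carrier M, monoid.mult = monoid.mult M, one = \<one>\<^bsub>M\<^esub>, ring.zero = \<zero>\<^bsub>M\<^esub>, add = add M,
      smult = (\<lambda>Z m. the_elem ((\<lambda>r. r \<odot>\<^bsub>M\<^esub> m) ` Z))\<rparr>"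


section \<open>Homomorphisms and duality\<close>

text \<open>
  Homomorphisms are extensional functions, so that equality of functions is equality of
  homomorphisms.
\<close>

definition mod_hom ::
    "('a, 'm) ring_scheme \<Rightarrow> ('a, 'b, 'n) module_scheme \<Rightarrow> ('a, 'c, 'o) module_scheme \<Rightarrow>
     ('b \<Rightarrow> 'c) set" where
  "mod_hom R M N =
     {f \<in> carrier M \<rightarrow>\<^sub>E carrier N.
        (\<forall>x\<in>carrier M. \<forall>y\<in>carrier M. f (x \<oplus>\<^bsub>M\<^esub> y) = f x \<oplus>\<^bsub>N\<^esub> f y) \<and>
        (\<forall>r\<in>carrier R. \<forall>x\<in>carrier M. f (r \<odot>\<^bsub>M\<^esub> x) = r \<odot>\<^bsub>N\<^esub> f x)}"

definition mod_iso ::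
    "('a, 'm) ring_scheme \<Rightarrow> ('a, 'b, 'n) module_scheme \<Rightarrow> ('a, 'c, 'o) module_scheme \<Rightarrow> bool" where
  "mod_iso R M N \<longleftrightarrow> (\<exists>f\<in>mod_hom R M N. bij_betw f (carrier M) (carrier N))"

definition mod_ker ::
    "('a, 'b, 'n) module_scheme \<Rightarrow> ('a, 'c, 'o) module_scheme \<Rightarrow> ('b \<Rightarrow> 'c) \<Rightarrow> 'b set" where
  "mod_ker M N f = {x \<in> carrier M. f x = \<zero>\<^bsub>N\<^esub>}"

definition Hom_module ::
    "('a, 'm) ring_scheme \<Rightarrow> ('a, 'b, 'n) module_scheme \<Rightarrow> ('a, 'c, 'o) module_scheme \<Rightarrow>
     ('a, 'b \<Rightarrow> 'c) module" where
  "Hom_module R M N =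
     \<lparr>carrier = mod_hom R M N, monoid.mult = undefined, one = undefined,
      ring.zero = (\<lambda>x\<in>carrier M. \<zero>\<^bsub>N\<^esub>),
      add = (\<lambda>f g. \<lambda>x\<in>carrier M. f x \<oplus>\<^bsub>N\<^esub> g x),
      smult = (\<lambda>r f. \<lambda>x\<in>carrier M. r \<odot>\<^bsub>N\<^esub> f x)\<rparr>"

abbreviation dual_module ::
    "('a, 'm) ring_scheme \<Rightarrow> ('a, 'b, 'n) module_scheme \<Rightarrow> ('a, 'b \<Rightarrow> 'a) module" where
  "dual_module R M \<equiv> Hom_module R M (regular_module R)"

text \<open>The map \<open>Hom(N, L) \<rightarrow> Hom(M, L)\<close> induced by \<open>d : M \<rightarrow> N\<close>.\<close>

definition pullback ::
    "('a, 'b, 'n) module_scheme \<Rightarrow> ('b \<Rightarrow> 'c) \<Rightarrow> ('c \<Rightarrow> 'd) \<Rightarrow> 'b \<Rightarrow> 'd" where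
  "pullback M d \<phi> = compose (carrier M) \<phi> d"

definition reflexive_module :: "('a, 'm) ring_scheme \<Rightarrow> ('a, 'b, 'n) module_scheme \<Rightarrow> bool" where
  "reflexive_module R M \<longleftrightarrow>
     bij_betw (\<lambda>x. \<lambda>\<phi>\<in>carrier (dual_module R M). \<phi> x)
       (carrier M) (carrier (dual_module R (dual_module R M)))"

definition trace_submodule ::
    "('a, 'm) ring_scheme \<Rightarrow> ('a, 'b, 'n) module_scheme \<Rightarrow> ('a, 'c, 'o) module_scheme \<Rightarrow> 'c set" where
  "trace_submodule R M N = submodule_gen R N (\<Union>f\<in>mod_hom R M N. f ` carrier M)"


section \<open>Projective modules, Ext, syzygies\<close>

text \<open>
  Quantification over all finitely generated \<open>R\<close>-modules inside a definition needs a fixed carrier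
  type. Every finitely generated \<open>R\<close>-module is isomorphic to one with carrier in the type
  \<open>(nat \<Rightarrow> 'a) set\<close>: a quotient of \<open>R\<^sup>n\<close>, whose elements are cosets of sequences vanishing
  from \<open>n\<close> on.
\<close>

type_synonym 'a fg_module = "('a, (nat \<Rightarrow> 'a) set) module"

definition fg_projective :: "('a, 'm) ring_scheme \<Rightarrow> ('a, 'b, 'n) module_scheme \<Rightarrow> bool" where
  "fg_projective R P \<longleftrightarrow>
     module R P \<and> fin_gen R P \<and>
     (\<forall>(Z :: 'a fg_module) (Y :: 'a fg_module). \<forall>g\<in>mod_hom R Z Y. \<forall>h\<in>mod_hom R P Y.
        module R Z \<and> fin_gen R Z \<and> module R Y \<and> fin_gen R Y \<and> g ` carrier Z = carrier Y \<longrightarrow>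
        (\<exists>l\<in>mod_hom R P Z. compose (carrier P) g l = h))"

definition torsionless :: "('a, 'm) ring_scheme \<Rightarrow> ('a, 'b, 'n) module_scheme \<Rightarrow> bool" where
  "torsionless R M \<longleftrightarrow>
     (\<exists>P :: 'a fg_module. fg_projective R P \<and> (\<exists>f\<in>mod_hom R M P. inj_on f (carrier M)))"

text \<open>An exact sequence \<open>P2 \<rightarrow> P1 \<rightarrow> P0 \<rightarrow> M \<rightarrow> 0\<close>, the start of a projective resolution of \<open>M\<close>.\<close>

definition proj_resolution ::
    "('a, 'm) ring_scheme \<Rightarrow> 'a fg_module \<Rightarrow> ((nat \<Rightarrow> 'a) set \<Rightarrow> (nat \<Rightarrow> 'a) set) \<Rightarrow>
     'a fg_module \<Rightarrow> ((nat \<Rightarrow> 'a) set \<Rightarrow> (nat \<Rightarrow> 'a) set) \<Rightarrow>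
     'a fg_module \<Rightarrow> ((nat \<Rightarrow> 'a) set \<Rightarrow> 'b) \<Rightarrow> ('a, 'b, 'n) module_scheme \<Rightarrow> bool" where
  "proj_resolution R P2 d2 P1 d1 P0 e M \<longleftrightarrow>
     fg_projective R P2 \<and> fg_projective R P1 \<and> fg_projective R P0 \<and>
     d2 \<in> mod_hom R P2 P1 \<and> d1 \<in> mod_hom R P1 P0 \<and> e \<in> mod_hom R P0 M \<and>
     d2 ` carrier P2 = mod_ker P1 P0 d1 \<and>
     d1 ` carrier P1 = mod_ker P0 M e \<and>
     e ` carrier P0 = carrier M"

text \<open>
  \<open>Ext\<^sup>1(M, N)\<close>, computed from the start of a projective resolution of \<open>M\<close> as the cohomology of
  \<open>Hom(P0, N) \<rightarrow> Hom(P1, N) \<rightarrow> Hom(P2, N)\<close> at the middle term.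
\<close>

definition Ext1 ::
    "('a, 'm) ring_scheme \<Rightarrow> 'a fg_module \<Rightarrow> ((nat \<Rightarrow> 'a) set \<Rightarrow> (nat \<Rightarrow> 'a) set) \<Rightarrow>
     'a fg_module \<Rightarrow> ((nat \<Rightarrow> 'a) set \<Rightarrow> (nat \<Rightarrow> 'a) set) \<Rightarrow> 'a fg_module \<Rightarrow>
     ('a, 'c, 'o) module_scheme \<Rightarrow> ((nat \<Rightarrow> 'a) set \<Rightarrow> 'c) set monoid" where
  "Ext1 R P2 d2 P1 d1 P0 N =
     (add_monoid (Hom_module R P1 N))
       \<lparr>carrier := mod_ker (Hom_module R P1 N) (Hom_module R P2 N) (pullback P2 d2)\<rparr>
     Mod (pullback P1 d1 ` carrier (Hom_module R P0 N))"

definition extensionless :: "('a, 'm) ring_scheme \<Rightarrow> ('a, 'b, 'n) module_scheme \<Rightarrow> bool" where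
  "extensionless R M \<longleftrightarrow>
     (\<forall>P2 d2 P1 d1 P0 e. proj_resolution R P2 d2 P1 d1 P0 e M \<longrightarrow>
        trivial_group (Ext1 R P2 d2 P1 d1 P0 (regular_module R)))"

definition gorenstein_projective ::
    "('a, 'm) ring_scheme \<Rightarrow> ('a, 'b, 'n) module_scheme \<Rightarrow> bool" where
  "gorenstein_projective R M \<longleftrightarrow>
     (\<exists>(P :: int \<Rightarrow> 'a fg_module) f.
        (\<forall>i. fg_projective R (P i)) \<and>
        (\<forall>i. f i \<in> mod_hom R (P i) (P (i - 1))) \<and>
        (\<forall>i. f (i + 1) ` carrier (P (i + 1)) = mod_ker (P i) (P (i - 1)) (f i)) \<and>
        (\<forall>i. pullback (P i) (f i) ` carrier (dual_module R (P (i - 1))) =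
              mod_ker (dual_module R (P i)) (dual_module R (P (i + 1)))
                (pullback (P (i + 1)) (f (i + 1)))) \<and>
        mod_iso R M ((P (- 1))\<lparr>carrier := f 0 ` carrier (P 0)\<rparr>))"

text \<open>A projective cover: a surjection from a projective module with superfluous kernel.\<close>

definition projective_cover ::
    "('a, 'm) ring_scheme \<Rightarrow> 'a fg_module \<Rightarrow> ((nat \<Rightarrow> 'a) set \<Rightarrow> 'b) \<Rightarrow>
     ('a, 'b, 'n) module_scheme \<Rightarrow> bool" where
  "projective_cover R P p M \<longleftrightarrow>
     fg_projective R P \<and> p \<in> mod_hom R P M \<and> p ` carrier P = carrier M \<and>
     (\<forall>L. submodule L R P \<and> L <+>\<^bsub>P\<^esub> mod_ker P M p = carrier P \<longrightarrow> L = carrier P)"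

text \<open>\<open>\<Omega> M \<simeq> N\<close>\<close>

definition is_syzygy ::
    "('a, 'm) ring_scheme \<Rightarrow> ('a, 'b, 'n) module_scheme \<Rightarrow> ('a, 'c, 'o) module_scheme \<Rightarrow> bool" where
  "is_syzygy R M N \<longleftrightarrow>
     (\<exists>P p. projective_cover R P p M \<and> mod_iso R (P\<lparr>carrier := mod_ker P M p\<rparr>) N)"

definition Omega_periodic_le2 ::
    "('a, 'm) ring_scheme \<Rightarrow> ('a, 'b, 'n) module_scheme \<Rightarrow> bool" where
  "Omega_periodic_le2 R M \<longleftrightarrow>
     is_syzygy R M M \<or>
     (\<exists>N :: 'a fg_module. module R N \<and> is_syzygy R M N \<and> is_syzygy R N M)"


section \<open>Short and special local algebras\<close>

definition local_ring :: "('a, 'm) ring_scheme \<Rightarrow> bool" where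
  "local_ring R \<longleftrightarrow> (\<exists>!I. maximalideal I R)"

definition radical :: "('a, 'm) ring_scheme \<Rightarrow> 'a set" where
  "radical R = carrier R \<inter> \<Inter>{I. maximalideal I R}"

primrec ideal_pow :: "('a, 'm) ring_scheme \<Rightarrow> 'a set \<Rightarrow> nat \<Rightarrow> 'a set" where
  "ideal_pow R I 0 = carrier R"
| "ideal_pow R I (Suc n) = ideal_prod R (ideal_pow R I n) I"

abbreviation rad_pow :: "('a, 'm) ring_scheme \<Rightarrow> nat \<Rightarrow> 'a set" where
  "rad_pow R n \<equiv> ideal_pow R (radical R) n"

text \<open>The smallest \<open>n\<close> with \<open>J\<^sup>n M = 0\<close>, where \<open>J\<close> is the radical of \<open>R\<close>.\<close>

definition has_loewy_length ::
    "('a, 'm) ring_scheme \<Rightarrow> ('a, 'b, 'n) module_scheme \<Rightarrow> nat \<Rightarrow> bool" where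
  "has_loewy_length R M n \<longleftrightarrow>
     (\<forall>r\<in>rad_pow R n. \<forall>x\<in>carrier M. r \<odot>\<^bsub>M\<^esub> x = \<zero>\<^bsub>M\<^esub>) \<and>
     (\<forall>m<n. \<not> (\<forall>r\<in>rad_pow R m. \<forall>x\<in>carrier M. r \<odot>\<^bsub>M\<^esub> x = \<zero>\<^bsub>M\<^esub>))"

definition atom_module :: "('a, 'm) ring_scheme \<Rightarrow> ('a, 'b, 'n) module_scheme \<Rightarrow> bool" where
  "atom_module R M \<longleftrightarrow>
     module R M \<and> local_module R M \<and> has_length R M 3 \<and> has_loewy_length R M 2"

text \<open>
  The copy of the ground field inside a \<open>k\<close>-algebra; \<open>k\<close>-dimensions are dimensions over this subfield
  in the sense of \<^theory>\<open>HOL-Algebra.Embedded_Algebras\<close>.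
\<close>

definition scalars :: "('k, 'l) ring_scheme \<Rightarrow> ('k, 'a, 'm) module_scheme \<Rightarrow> 'a set" where
  "scalars K A = (\<lambda>c. c \<odot>\<^bsub>A\<^esub> \<one>\<^bsub>A\<^esub>) ` carrier K"

text \<open>
  Finite-dimensional commutative local algebra, short of Hilbert type \<open>(3, 2)\<close>. The dimension of
  \<open>J/J\<^sup>2\<close> is taken inside the \<open>k\<close>-algebra \<open>A/J\<^sup>2\<close>.
\<close>

definition short_local_3_2 ::
    "('k, 'l) ring_scheme \<Rightarrow> ('k, 'a, 'm) module_scheme \<Rightarrow> bool" where
  "short_local_3_2 K A \<longleftrightarrow>
     algebra K A \<and> ring.finite_dimension A (scalars K A) (carrier A) \<and> local_ring A \<and>
     rad_pow A 3 = {\<zero>\<^bsub>A\<^esub>} \<and>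
     ring.dimension (A Quot rad_pow A 2) 3
       ((+>\<^bsub>A\<^esub>) (rad_pow A 2) ` scalars K A) ((+>\<^bsub>A\<^esub>) (rad_pow A 2) ` radical A) \<and>
     ring.dimension A 2 (scalars K A) (rad_pow A 2)"

text \<open>As \<open>A\<close> is commutative, the left and the right socle coincide, and left ideals are ideals.\<close>

definition special_algebra ::
    "('k, 'l) ring_scheme \<Rightarrow> ('k, 'a, 'm) module_scheme \<Rightarrow> bool" where
  "special_algebra K A \<longleftrightarrow>
     short_local_3_2 K A \<and>
     rad_pow A 2 = socle A (regular_module A) \<and>
     \<not> (\<exists>I. ideal I A \<and> uniform_module A ((regular_module A)\<lparr>carrier := I\<rparr>) \<and>
            has_length A ((regular_module A)\<lparr>carrier := I\<rparr>) 3)"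

definition U_ideal :: "('a, 'm) ring_scheme \<Rightarrow> 'a \<Rightarrow> 'a set" where
  "U_ideal A a = (PIdl\<^bsub>A\<^esub> a) <+>\<^bsub>A\<^esub> rad_pow A 2"

definition C_module :: "('a, 'm) ring_scheme \<Rightarrow> 'a \<Rightarrow> ('a, 'a set) module" where
  "C_module A a = quot_module (regular_module A) (U_ideal A a)"

definition bar :: "('k, 'l) ring_scheme \<Rightarrow> ('k, 'a, 'm) module_scheme \<Rightarrow> 'a set \<Rightarrow> bool" where
  "bar K A N \<longleftrightarrow>
     ideal N A \<and> N \<subseteq> radical A \<and> ring.dimension A 4 (scalars K A) N \<and>
     \<not> faithful_module (A Quot rad_pow A 2)
         (factor_action ((regular_module A)\<lparr>carrier := N\<rparr>))"

definition complement_in_radical ::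
    "('k, 'l) ring_scheme \<Rightarrow> ('k, 'a, 'm) module_scheme \<Rightarrow> 'a set \<Rightarrow> bool" where
  "complement_in_radical K A E \<longleftrightarrow>
     submodule E K A \<and> E \<inter> rad_pow A 2 = {\<zero>\<^bsub>A\<^esub>} \<and> E <+>\<^bsub>A\<^esub> rad_pow A 2 = radical A"

end

theory Submission imports Defs begin

text \<open>
  Write \<open>Q = J\<^sup>2\<close>, so that \<open>U(x) = kx + Q\<close> for \<open>x \<in> J\<close>. Since \<open>J/Q\<close> has dimension 3 and \<open>Q\<close> has dimension 2,
  multiplication by \<open>a \<in> J - Q\<close> kills some \<open>b \<in> J - Q\<close>. The element \<open>a\<close> lies in a bar iff some such \<open>b\<close>
  is also killed by an element of \<open>J\<close> outside \<open>U(a)\<close>. If \<open>aJ \<noteq> Q\<close>, then \<open>ann(a)/Q\<close> is spanned by two elements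
  \<open>b\<close>, \<open>c\<close>; the three products \<open>b\<^sup>2\<close>, \<open>bc\<close>, \<open>c\<^sup>2\<close> are linearly dependent in \<open>Q\<close>, and factoring the resulting
  quadratic form over the algebraically closed field yields a bar through \<open>a\<close>. Hence if \<open>a\<close> lies in no
  bar, there is \<open>b\<close> with \<open>ann(a) = Ab = U(b)\<close> and \<open>ann(b) = Aa = U(a)\<close>, and multiplication by \<open>a\<close> and \<open>b\<close>
  alternately is a totally acyclic complex, which makes \<open>C(a) \<simeq> Ab\<close> Gorenstein-projective, reflexive and
  periodic. Conversely, \<open>Ext\<^sup>1(C(a), A) = 0\<close> means that every homomorphism \<open>U(a) \<rightarrow> A\<close> is the
  multiplication by an element of \<open>A\<close>; a bar provides a homomorphism which is not, it produces two maximal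
  submodules of the trace \<open>ann(a)\<close>, and it makes \<open>C(a) \<rightarrow> C(a)\<^sup>*\<^sup>*\<close> fail to be injective (if \<open>aJ = Q\<close>)
  or surjective (if \<open>aJ \<noteq> Q\<close>).
\<close>

section \<open>Modules\<close>

text \<open>Most of the module theory reduces to elements. Homomorphisms from C(a) = A/U(a) to A are
  the elements killed by U(a), and these form ann(a), because ann(a) lies in J and JQ = 0. So the
  dual of C(a) is ann(a), its trace in A is ann(a) as well, and evaluation at the class of r becomes
  multiplication by r on ann(a). Algebraic closedness enters through roots of monic quadratics, at
  two places: in the factorization that yields a bar and, earlier, in the proof of A = k + J, which
  makes Aa + Q equal to ka + Q and turns suitable k-linear maps into A-linear ones. Two obstacles
  come from the form of the definitions. Ext is computed from an arbitrary projective resolution,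
  whose term P0 may differ from the regular module, so comparison maps in both directions are
  needed; they compose to multiplication by an element of 1 + U(a), which is a unit. And
  projectivity is tested against modules whose carriers have one fixed type, so the regular module
  and C(a) are first copied into that type along injections.\<close>

lemma regular_module_simps [simp]:
  "carrier (regular_module R) = carrier R" "\<zero>\<^bsub>regular_module R\<^esub> = \<zero>\<^bsub>R\<^esub>"
  "add (regular_module R) = add R" "smult (regular_module R) = monoid.mult R"
  by (simp_all add: regular_module_def)

lemma (in cring) module_regular: "module R (regular_module R)"
proof (rule moduleI)
  show "abelian_group (regular_module R)"
  proof (rule abelian_groupI)
    fix x assume "x \<in> carrier (regular_module R)"
    thus "\<exists>y\<in>carrier (regular_module R). y \<oplus>\<^bsub>regular_module R\<^esub> x = \<zero>\<^bsub>regular_module R\<^esub>"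
      by (auto intro!: bexI[of _ "\<ominus> x"] l_neg)
  qed (simp_all add: a_ac)
qed (simp_all add: is_cring l_distr r_distr m_assoc)

lemma (in module) submodule_carrier_update:
  assumes "submodule N R M"
  shows "submodule L R (M\<lparr>carrier := N\<rparr>) \<longleftrightarrow> submodule L R M \<and> L \<subseteq> N"
proof -
  interpret N: module R "M\<lparr>carrier := N\<rparr>"
    by (rule submodule.submodule_is_module[OF assms module_axioms])
  \<comment> \<open>Negatives are descriptions over the carrier, so restricting the carrier could
    change them; uniqueness of inverses shows that it does not.\<close>
  have neg: "\<ominus>\<^bsub>M\<lparr>carrier := N\<rparr>\<^esub> x = \<ominus>\<^bsub>M\<^esub> x" if "x \<in> N" for x
  proof -
    have "\<ominus>\<^bsub>M\<^esub> x \<in> N" "x \<in> carrier M" "\<ominus>\<^bsub>M\<^esub> x \<in> carrier M"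
      using submoduleE(1,3)[OF assms] that by auto
    thus ?thesis using that M.l_neg[of x] N.minus_equality[of "\<ominus>\<^bsub>M\<^esub> x" x] by simp
  qed
  show ?thesis
  proof
    assume L: "submodule L R (M\<lparr>carrier := N\<rparr>)"
    have LN: "L \<subseteq> N" using N.submoduleE(1)[OF L] by simp
    moreover have "submodule L R M"
    proof (rule submoduleI)
      show "L \<subseteq> carrier M" using LN submoduleE(1)[OF assms] by auto
      show "\<zero>\<^bsub>M\<^esub> \<in> L" using subgroup.one_closed[OF submodule.axioms(1)[OF L]] by simp
      show "\<ominus>\<^bsub>M\<^esub> x \<in> L" if "x \<in> L" for x
        using N.submoduleE(3)[OF L that] neg[of x] LN that by auto
    qed (use N.submoduleE(4,5)[OF L] in auto)
    ultimately show "submodule L R M \<and> L \<subseteq> N" by simp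
  next
    assume L: "submodule L R M \<and> L \<subseteq> N"
    show "submodule L R (M\<lparr>carrier := N\<rparr>)"
    proof (rule N.submoduleI)
      show "\<zero>\<^bsub>M\<lparr>carrier := N\<rparr>\<^esub> \<in> L"
        using L subgroup.one_closed[of L "add_monoid M"] submodule.axioms(1)[of L R M] by simp
      show "\<ominus>\<^bsub>M\<lparr>carrier := N\<rparr>\<^esub> x \<in> L" if "x \<in> L" for x
        using L submoduleE(3)[of L] neg[of x] that by auto
    qed (use L submoduleE(4,5)[of L] in auto)
  qed
qed

text \<open>Bridge between two languages: dimensions are counted for ideals, while generated,
  maximal and trace submodules are formed inside the regular module.\<close>

lemma (in cring) regular_submodule_iff: "submodule I R (regular_module R) \<longleftrightarrow> ideal I R"
proof -
  interpret reg: module R "regular_module R" by (rule module_regular)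
  have neg: "\<ominus>\<^bsub>regular_module R\<^esub> x = \<ominus> x" if "x \<in> carrier R" for x
    using that by (intro reg.minus_equality) (auto simp: l_neg)
  show ?thesis
  proof
    assume I: "submodule I R (regular_module R)"
    have sub: "I \<subseteq> carrier R" using reg.submoduleE(1)[OF I] by simp
    show "ideal I R"
    proof (rule idealI)
      show "ring R" by (rule ring_axioms)
      show "subgroup I (add_monoid R)"
      proof (rule add.subgroupI)
        show "I \<subseteq> carrier R" "I \<noteq> {}" using sub reg.submoduleE(2)[OF I] by auto
        show "\<ominus> x \<in> I" if "x \<in> I" for x
          using reg.submoduleE(3)[OF I that] neg[of x] sub that by auto
        show "x \<oplus> y \<in> I" if "x \<in> I" "y \<in> I" for x y
          using reg.submoduleE(5)[OF I that] by simp
      qed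
      fix x y assume "x \<in> I" "y \<in> carrier R"
      thus "y \<otimes> x \<in> I" "x \<otimes> y \<in> I"
        using reg.submoduleE(4)[OF I, of y x] sub m_comm[of x y] by auto
    qed
  next
    assume I: "ideal I R"
    show "submodule I R (regular_module R)"
      using ideal.I_l_closed[OF I] additive_subgroup.a_subgroup[OF ideal.axioms(1)[OF I]]
      by (auto intro!: submodule.intro simp: submodule_axioms_def subgroup_def m_inv_def)
  qed
qed

section \<open>Generated submodules and homomorphisms\<close>

lemma (in module) submodule_gen_least:
  "submodule N R M \<Longrightarrow> G \<subseteq> N \<Longrightarrow> submodule_gen R M G \<subseteq> N"
  by (auto simp: submodule_gen_def)

lemma submodule_gen_incl: "G \<subseteq> submodule_gen R M G"
  by (auto simp: submodule_gen_def)

lemma (in module) submodule_gen_submodule: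
  assumes "G \<subseteq> carrier M" shows "submodule (submodule_gen R M G) R M"
proof (rule submoduleI)
  show "submodule_gen R M G \<subseteq> carrier M"
    using submodule_gen_least[OF carrier_is_submodule assms] .
  show "\<zero>\<^bsub>M\<^esub> \<in> submodule_gen R M G"
    using subgroup.one_closed[OF submodule.axioms(1), of _ R M] by (auto simp: submodule_gen_def)
qed (auto simp: submodule_gen_def intro: submoduleE)

lemma mod_homI:
  assumes "\<And>x. x \<in> carrier M \<Longrightarrow> f x \<in> carrier N"
    and "\<And>x y. x \<in> carrier M \<Longrightarrow> y \<in> carrier M \<Longrightarrow> f (x \<oplus>\<^bsub>M\<^esub> y) = f x \<oplus>\<^bsub>N\<^esub> f y"
    and "\<And>r x. r \<in> carrier R \<Longrightarrow> x \<in> carrier M \<Longrightarrow> f (r \<odot>\<^bsub>M\<^esub> x) = r \<odot>\<^bsub>N\<^esub> f x"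
    and "module R M"
  shows "(\<lambda>x\<in>carrier M. f x) \<in> mod_hom R M N"
proof -
  interpret module R M by fact
  show ?thesis using assms(1-3) by (simp add: mod_hom_def)
qed

lemma mod_hom_closed [intro]: "f \<in> mod_hom R M N \<Longrightarrow> x \<in> carrier M \<Longrightarrow> f x \<in> carrier N"
  by (auto simp: mod_hom_def)

lemma mod_hom_add:
  "f \<in> mod_hom R M N \<Longrightarrow> x \<in> carrier M \<Longrightarrow> y \<in> carrier M \<Longrightarrow> f (x \<oplus>\<^bsub>M\<^esub> y) = f x \<oplus>\<^bsub>N\<^esub> f y"
  by (simp add: mod_hom_def)

lemma mod_hom_smult:
  "f \<in> mod_hom R M N \<Longrightarrow> r \<in> carrier R \<Longrightarrow> x \<in> carrier M \<Longrightarrow> f (r \<odot>\<^bsub>M\<^esub> x) = r \<odot>\<^bsub>N\<^esub> f x"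
  by (simp add: mod_hom_def)

lemma mod_hom_zero:
  assumes "f \<in> mod_hom R M N" "module R M" "module R N" shows "f \<zero>\<^bsub>M\<^esub> = \<zero>\<^bsub>N\<^esub>"
proof -
  interpret M: module R M by fact
  interpret N: module R N by fact
  have "f (\<zero>\<^bsub>R\<^esub> \<odot>\<^bsub>M\<^esub> \<zero>\<^bsub>M\<^esub>) = \<zero>\<^bsub>R\<^esub> \<odot>\<^bsub>N\<^esub> f \<zero>\<^bsub>M\<^esub>"
    using assms(1) by (intro mod_hom_smult) auto
  moreover have "f \<zero>\<^bsub>M\<^esub> \<in> carrier N" using assms(1) by auto
  ultimately show ?thesis by simp
qed

lemma mod_hom_minus:
  assumes "f \<in> mod_hom R M N" "module R M" "module R N" "x \<in> carrier M" "y \<in> carrier M"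
  shows "f (x \<ominus>\<^bsub>M\<^esub> y) = f x \<ominus>\<^bsub>N\<^esub> f y"
proof -
  interpret M: module R M by fact
  interpret N: module R N by fact
  have "f (x \<ominus>\<^bsub>M\<^esub> y) \<oplus>\<^bsub>N\<^esub> f y = f (x \<ominus>\<^bsub>M\<^esub> y \<oplus>\<^bsub>M\<^esub> y)"
    using assms by (intro mod_hom_add[symmetric]) auto
  also have "x \<ominus>\<^bsub>M\<^esub> y \<oplus>\<^bsub>M\<^esub> y = x" using assms(4,5) by (simp add: M.minus_eq M.a_assoc M.l_neg)
  finally have "f x = f (x \<ominus>\<^bsub>M\<^esub> y) \<oplus>\<^bsub>N\<^esub> f y" ..
  moreover have "f x \<in> carrier N" "f y \<in> carrier N" "f (x \<ominus>\<^bsub>M\<^esub> y) \<in> carrier N" using assms by auto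
  ultimately show ?thesis by (simp add: N.minus_eq N.a_assoc N.r_neg)
qed

lemma mod_hom_ext:
  assumes "f \<in> mod_hom R M N" "g \<in> mod_hom R M N'" "\<And>x. x \<in> carrier M \<Longrightarrow> f x = g x" shows "f = g"
proof (rule extensionalityI[of _ "carrier M"])
  show "f \<in> extensional (carrier M)" "g \<in> extensional (carrier M)"
    using assms(1,2) by (simp_all add: mod_hom_def PiE_def)
qed (rule assms(3))

lemma mod_hom_compose:
  assumes "f \<in> mod_hom R M N" "g \<in> mod_hom R N L" "module R M"
  shows "compose (carrier M) g f \<in> mod_hom R M L"
  unfolding compose_def
  by (rule mod_homI)
     (use assms in \<open>auto simp: mod_hom_add mod_hom_smult mod_hom_closed\<close>)

lemma submodule_zero: "module R M \<Longrightarrow> submodule N R M \<Longrightarrow> \<zero>\<^bsub>M\<^esub> \<in> N"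
  using subgroup.one_closed[OF submodule.axioms(1), of N R M] by simp

lemma submodule_minus:
  assumes "module R M" "submodule N R M" "x \<in> N" "y \<in> N" shows "x \<ominus>\<^bsub>M\<^esub> y \<in> N"
  unfolding a_minus_def using assms module.submoduleE by metis

lemma mod_ker_submodule:
  assumes "f \<in> mod_hom R M N" "module R M" "module R N" shows "submodule (mod_ker M N f) R M"
proof -
  interpret M: module R M by fact
  interpret N: module R N by fact
  note f = assms(1)
  have neg: "f (\<ominus>\<^bsub>M\<^esub> x) = \<zero>\<^bsub>N\<^esub>" if "x \<in> carrier M" "f x = \<zero>\<^bsub>N\<^esub>" for x
  proof -
    have "f (\<zero>\<^bsub>M\<^esub> \<ominus>\<^bsub>M\<^esub> x) = f \<zero>\<^bsub>M\<^esub> \<ominus>\<^bsub>N\<^esub> f x" using assms that by (intro mod_hom_minus) auto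
    thus ?thesis using that mod_hom_zero[OF assms] by (simp add: M.minus_eq N.minus_eq)
  qed
  show ?thesis
    by (rule M.submoduleI)
       (auto simp: mod_ker_def mod_hom_zero[OF assms] mod_hom_add[OF f] mod_hom_smult[OF f] neg)
qed

lemma mod_hom_image_submodule:
  assumes "f \<in> mod_hom R M N" "module R M" "module R N" "submodule L R M"
  shows "submodule (f ` L) R N"
proof -
  interpret M: module R M by fact
  interpret N: module R N by fact
  note f = assms(1)
  have L: "x \<in> carrier M" if "x \<in> L" for x using M.submoduleE(1)[OF assms(4)] that by blast
  show ?thesis
  proof (rule N.submoduleI)
    show "f ` L \<subseteq> carrier N" using f L by auto
    show "\<zero>\<^bsub>N\<^esub> \<in> f ` L"
      using mod_hom_zero[OF assms(1-3)] submodule_zero[OF assms(2,4)] by force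
    fix u assume "u \<in> f ` L"
    then obtain x where x: "x \<in> L" "u = f x" by blast
    have "f (\<zero>\<^bsub>M\<^esub> \<ominus>\<^bsub>M\<^esub> x) = f \<zero>\<^bsub>M\<^esub> \<ominus>\<^bsub>N\<^esub> f x"
      using assms L[OF x(1)] by (intro mod_hom_minus) auto
    hence "\<ominus>\<^bsub>N\<^esub> u = f (\<ominus>\<^bsub>M\<^esub> x)"
      using mod_hom_zero[OF assms(1-3)] x L[OF x(1)] f by (simp add: M.minus_eq N.minus_eq mod_hom_closed)
    thus "\<ominus>\<^bsub>N\<^esub> u \<in> f ` L" using M.submoduleE(3)[OF assms(4) x(1)] by simp
    fix v assume "v \<in> f ` L"
    then obtain y where y: "y \<in> L" "v = f y" by blast
    have "u \<oplus>\<^bsub>N\<^esub> v = f (x \<oplus>\<^bsub>M\<^esub> y)" using f L x y by (simp add: mod_hom_add)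
    thus "u \<oplus>\<^bsub>N\<^esub> v \<in> f ` L" using M.submoduleE(5)[OF assms(4) x(1) y(1)] by simp
  next
    fix r u assume r: "r \<in> carrier R" "u \<in> f ` L"
    then obtain x where x: "x \<in> L" "u = f x" by blast
    have "r \<odot>\<^bsub>N\<^esub> u = f (r \<odot>\<^bsub>M\<^esub> x)" using f L x r by (simp add: mod_hom_smult)
    thus "r \<odot>\<^bsub>N\<^esub> u \<in> f ` L" using M.submoduleE(4)[OF assms(4) r(1) x(1)] by simp
  qed
qed

lemma mod_hom_vimage_submodule:
  assumes "f \<in> mod_hom R M N" "module R M" "module R N" "submodule L R N"
  shows "submodule {x \<in> carrier M. f x \<in> L} R M"
proof -
  interpret M: module R M by fact
  interpret N: module R N by fact
  note f = assms(1) and L = N.submoduleE[OF assms(4)]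
  have neg: "f (\<ominus>\<^bsub>M\<^esub> x) \<in> L" if "x \<in> carrier M" "f x \<in> L" for x
  proof -
    have "f (\<zero>\<^bsub>M\<^esub> \<ominus>\<^bsub>M\<^esub> x) = f \<zero>\<^bsub>M\<^esub> \<ominus>\<^bsub>N\<^esub> f x" using assms that by (intro mod_hom_minus) auto
    hence "f (\<ominus>\<^bsub>M\<^esub> x) = \<ominus>\<^bsub>N\<^esub> f x"
      using that mod_hom_zero[OF assms(1-3)] mod_hom_closed[OF f that(1)] by (simp add: M.minus_eq N.minus_eq)
    thus ?thesis using L(3)[OF that(2)] by simp
  qed
  show ?thesis
    by (rule M.submoduleI)
       (auto simp: mod_hom_zero[OF assms(1-3)] mod_hom_add[OF f] mod_hom_smult[OF f] neg L(4,5)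
         submodule_zero[OF assms(3,4)])
qed

lemma submodule_Int:
  assumes "module R M" "submodule L R M" "submodule N R M" shows "submodule (L \<inter> N) R M"
proof -
  interpret module R M by fact
  show ?thesis
    by (rule submoduleI)
       (use submoduleE[OF assms(2)] submoduleE[OF assms(3)] submodule_zero[OF assms(1)] assms in auto)
qed

text \<open>The preimage of a submodule containing the images of the generators contains the
  generators, hence is all of \<open>M\<close>.\<close>

lemma fin_gen_image:
  assumes "f \<in> mod_hom R M N" "module R M" "module R N" "f ` carrier M = carrier N" "fin_gen R M"
  shows "fin_gen R N"
proof -
  interpret M: module R M by fact
  interpret N: module R N by fact
  obtain G where G: "finite G" "G \<subseteq> carrier M" "submodule_gen R M G = carrier M"
    using assms(5) unfolding fin_gen_def by blast
  have sub: "f ` G \<subseteq> carrier N" using G(2) assms(4) by blast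
  have "carrier N \<subseteq> L" if L: "submodule L R N" "f ` G \<subseteq> L" for L
  proof -
    have "G \<subseteq> {x \<in> carrier M. f x \<in> L}" using G(2) L(2) by blast
    hence "carrier M \<subseteq> {x \<in> carrier M. f x \<in> L}"
      using M.submodule_gen_least[OF mod_hom_vimage_submodule[OF assms(1-3) L(1)]] G(3) by blast
    hence "f ` carrier M \<subseteq> L" by auto
    thus ?thesis by (simp only: assms(4))
  qed
  hence "carrier N \<subseteq> submodule_gen R N (f ` G)" unfolding submodule_gen_def by (intro Inter_greatest) simp
  hence "submodule_gen R N (f ` G) = carrier N"
    using N.submodule_gen_least[OF N.carrier_is_submodule sub] by simp
  thus ?thesis using G(1) sub unfolding fin_gen_def by blast
qed

section \<open>Linear combinations and free modules of finite rank\<close>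

primrec lincomb :: "('a, 'b, 'n) module_scheme \<Rightarrow> (nat \<Rightarrow> 'b) \<Rightarrow> (nat \<Rightarrow> 'a) \<Rightarrow> nat \<Rightarrow> 'b" where
  "lincomb M x v 0 = \<zero>\<^bsub>M\<^esub>"
| "lincomb M x v (Suc n) = lincomb M x v n \<oplus>\<^bsub>M\<^esub> v n \<odot>\<^bsub>M\<^esub> x n"

lemma (in module) lincomb_closed:
  "(\<And>i. i < n \<Longrightarrow> v i \<in> carrier R) \<Longrightarrow> submodule N R M \<Longrightarrow> (\<And>i. i < n \<Longrightarrow> x i \<in> N) \<Longrightarrow> lincomb M x v n \<in> N"
  by (induction n) (auto intro: submoduleE submodule_zero[OF module_axioms])

lemma (in module) lincomb_carrier [simp]:
  "(\<And>i. i < n \<Longrightarrow> v i \<in> carrier R) \<Longrightarrow> (\<And>i. i < n \<Longrightarrow> x i \<in> carrier M) \<Longrightarrow> lincomb M x v n \<in> carrier M"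
  by (rule lincomb_closed[OF _ carrier_is_submodule])

lemma lincomb_cong:
  "(\<And>i. i < n \<Longrightarrow> v i = w i) \<Longrightarrow> (\<And>i. i < n \<Longrightarrow> x i = y i) \<Longrightarrow> lincomb M x v n = lincomb M y w n"
  by (induction n) auto

lemma (in module) lincomb_add:
  assumes "\<And>i. v i \<in> carrier R" "\<And>i. w i \<in> carrier R" "\<And>i. i < n \<Longrightarrow> x i \<in> carrier M"
  shows "lincomb M x (\<lambda>i. v i \<oplus> w i) n = lincomb M x v n \<oplus>\<^bsub>M\<^esub> lincomb M x w n"
  using assms by (induction n) (auto simp: smult_l_distr M.a_ac)

lemma (in module) lincomb_smult:
  assumes "\<And>i. v i \<in> carrier R" "r \<in> carrier R" "\<And>i. i < n \<Longrightarrow> x i \<in> carrier M"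
  shows "lincomb M x (\<lambda>i. r \<otimes> v i) n = r \<odot>\<^bsub>M\<^esub> lincomb M x v n"
  using assms by (induction n) (auto simp: smult_r_distr smult_assoc1)

lemma (in module) lincomb_unit:
  assumes "\<And>i. i < n \<Longrightarrow> x i \<in> carrier M"
  shows "lincomb M x (\<lambda>j. if j = i then \<one> else \<zero>) n = (if i < n then x i else \<zero>\<^bsub>M\<^esub>)"
  using assms by (induction n) (auto simp: less_Suc_eq)

lemma mod_hom_lincomb:
  assumes f: "f \<in> mod_hom R M N" and M: "module R M" and N: "module R N"
    and v: "\<And>i. i < n \<Longrightarrow> v i \<in> carrier R" and x: "\<And>i. i < n \<Longrightarrow> x i \<in> carrier M"
  shows "f (lincomb M x v n) = lincomb N (\<lambda>i. f (x i)) v n"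
proof -
  interpret M: module R M by fact
  show ?thesis using v x
    by (induction n) (auto simp: mod_hom_zero[OF f M N] mod_hom_add[OF f] mod_hom_smult[OF f])
qed

text \<open>The carrier consists of singletons in order to fit the type of \<^typ>\<open>'a fg_module\<close>.\<close>

definition vectors :: "('a, 'm) ring_scheme \<Rightarrow> nat \<Rightarrow> (nat \<Rightarrow> 'a) set" where
  "vectors R n = {v. (\<forall>i. v i \<in> carrier R) \<and> (\<forall>i\<ge>n. v i = \<zero>\<^bsub>R\<^esub>)}"

definition free_module :: "('a, 'm) ring_scheme \<Rightarrow> nat \<Rightarrow> 'a fg_module" where
  "free_module R n =
     \<lparr>carrier = (\<lambda>v. {v}) ` vectors R n, monoid.mult = undefined, one = undefined,
      ring.zero = {\<lambda>i. \<zero>\<^bsub>R\<^esub>},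
      add = (\<lambda>Y Z. {\<lambda>i. the_elem Y i \<oplus>\<^bsub>R\<^esub> the_elem Z i}),
      smult = (\<lambda>r Y. {\<lambda>i. r \<otimes>\<^bsub>R\<^esub> the_elem Y i})\<rparr>"

lemma free_module_simps [simp]:
  "carrier (free_module R n) = (\<lambda>v. {v}) ` vectors R n"
  "\<zero>\<^bsub>free_module R n\<^esub> = {\<lambda>i. \<zero>\<^bsub>R\<^esub>}"
  "Y \<oplus>\<^bsub>free_module R n\<^esub> Z = {\<lambda>i. the_elem Y i \<oplus>\<^bsub>R\<^esub> the_elem Z i}"
  "r \<odot>\<^bsub>free_module R n\<^esub> Y = {\<lambda>i. r \<otimes>\<^bsub>R\<^esub> the_elem Y i}"
  by (simp_all add: free_module_def)

definition unit_vector :: "('a, 'm) ring_scheme \<Rightarrow> nat \<Rightarrow> nat \<Rightarrow> 'a" where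
  "unit_vector R i = (\<lambda>j. if j = i then \<one>\<^bsub>R\<^esub> else \<zero>\<^bsub>R\<^esub>)"

definition free_hom :: "('a, 'm) ring_scheme \<Rightarrow> ('a, 'b, 'n) module_scheme \<Rightarrow> nat \<Rightarrow> (nat \<Rightarrow> 'b) \<Rightarrow>
    (nat \<Rightarrow> 'a) set \<Rightarrow> 'b" where
  "free_hom R M n x = (\<lambda>Y\<in>carrier (free_module R n). lincomb M x (the_elem Y) n)"

context cring
begin

lemma vectors_zero: "(\<lambda>i. \<zero>) \<in> vectors R n"
  and vectors_add: "v \<in> vectors R n \<Longrightarrow> w \<in> vectors R n \<Longrightarrow> (\<lambda>i. v i \<oplus> w i) \<in> vectors R n"
  and vectors_smult: "r \<in> carrier R \<Longrightarrow> v \<in> vectors R n \<Longrightarrow> (\<lambda>i. r \<otimes> v i) \<in> vectors R n"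
  by (auto simp: vectors_def)

lemma vectors_closed: "v \<in> vectors R n \<Longrightarrow> v i \<in> carrier R"
  by (simp add: vectors_def)

lemma unit_vector_vectors: "i < n \<Longrightarrow> unit_vector R i \<in> vectors R n"
  by (simp add: vectors_def unit_vector_def)

lemma free_module_module: "module R (free_module R n)"
proof (rule moduleI)
  show "abelian_group (free_module R n)"
  proof (rule abelian_groupI)
    fix Y assume "Y \<in> carrier (free_module R n)"
    then obtain v where v: "v \<in> vectors R n" "Y = {v}" by auto
    have "(\<lambda>i. \<ominus> v i) \<in> vectors R n" using v by (auto simp: vectors_def)
    thus "\<exists>Z\<in>carrier (free_module R n). Z \<oplus>\<^bsub>free_module R n\<^esub> Y = \<zero>\<^bsub>free_module R n\<^esub>"
      using v by (intro bexI[of _ "{\<lambda>i. \<ominus> v i}"]) (auto simp: l_neg vectors_closed)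
  qed (auto simp: vectors_zero vectors_add vectors_closed a_ac)
qed (auto simp: is_cring vectors_smult vectors_closed l_distr r_distr m_assoc)

lemma free_hom_mod_hom:
  assumes "module R M" "\<And>i. i < n \<Longrightarrow> x i \<in> carrier M"
  shows "free_hom R M n x \<in> mod_hom R (free_module R n) M"
proof -
  interpret M: module R M by fact
  show ?thesis unfolding free_hom_def
    by (rule mod_homI[OF _ _ _ free_module_module])
       (use assms(2) in \<open>auto simp: vectors_closed vectors_add vectors_smult M.lincomb_add M.lincomb_smult\<close>)
qed

lemma free_hom_apply:
  "v \<in> vectors R n \<Longrightarrow> free_hom R M n x {v} = lincomb M x v n"
  by (simp add: free_hom_def)

lemma free_hom_unit:
  assumes "module R M" "\<And>i. i < n \<Longrightarrow> x i \<in> carrier M" "i < n"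
  shows "free_hom R M n x {unit_vector R i} = x i"
proof -
  interpret M: module R M by fact
  show ?thesis
    using free_hom_apply[OF unit_vector_vectors[OF assms(3)], of M x] M.lincomb_unit[of n x i] assms(2,3)
    by (simp add: unit_vector_def)
qed

lemma mod_hom_free_eq:
  assumes f: "f \<in> mod_hom R (free_module R n) M" and M: "module R M" and v: "v \<in> vectors R n"
  shows "f {v} = lincomb M (\<lambda>i. f {unit_vector R i}) v n"
proof -
  interpret M: module R M by fact
  have trunc: "(\<lambda>i. if i < k then v i else \<zero>) \<in> vectors R n" for k
    using v by (auto simp: vectors_def)
  \<comment> \<open>Induction on truncations of \<open>v\<close>: the first \<open>k\<close>
    coordinates are kept and the others set to zero, so the argument of \<open>f\<close> stays in
    the same free module. The bound \<open>k \<le> n\<close> keeps the unit vector added in each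
    step inside it.\<close>
  have "f {\<lambda>i. if i < k then v i else \<zero>} = lincomb M (\<lambda>i. f {unit_vector R i}) v k" if "k \<le> n" for k
    using that
  proof (induction k)
    case 0
    show ?case using mod_hom_zero[OF f free_module_module M] by simp
  next
    case (Suc k)
    have vk: "v k \<in> carrier R" by (rule vectors_closed[OF v])
    have u: "unit_vector R k \<in> vectors R n" using Suc by (simp add: unit_vector_vectors)
    have eq: "(\<lambda>i. if i < Suc k then v i else \<zero>) =
        (\<lambda>i. (if i < k then v i else \<zero>) \<oplus> v k \<otimes> unit_vector R k i)"
      using v by (auto simp: unit_vector_def vectors_def less_Suc_eq fun_eq_iff)
    have "f {\<lambda>i. if i < Suc k then v i else \<zero>} =
        f ({\<lambda>i. if i < k then v i else \<zero>} \<oplus>\<^bsub>free_module R n\<^esub> (v k \<odot>\<^bsub>free_module R n\<^esub> {unit_vector R k}))"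
      unfolding eq by simp
    also have "\<dots> = f {\<lambda>i. if i < k then v i else \<zero>} \<oplus>\<^bsub>M\<^esub> f (v k \<odot>\<^bsub>free_module R n\<^esub> {unit_vector R k})"
      using trunc vectors_smult[OF vk u] by (intro mod_hom_add[OF f]) auto
    also have "f (v k \<odot>\<^bsub>free_module R n\<^esub> {unit_vector R k}) = v k \<odot>\<^bsub>M\<^esub> f {unit_vector R k}"
      using u by (intro mod_hom_smult[OF f vk]) auto
    finally show ?case using Suc by simp
  qed
  from this[of n] have "f {\<lambda>i. if i < n then v i else \<zero>} = lincomb M (\<lambda>i. f {unit_vector R i}) v n" by simp
  moreover have "(\<lambda>i. if i < n then v i else \<zero>) = v" using v by (auto simp: vectors_def fun_eq_iff)
  ultimately show ?thesis by simp
qed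

lemma fin_gen_free_module: "fin_gen R (free_module R n)"
  unfolding fin_gen_def
proof (intro exI conjI)
  interpret F: module R "free_module R n" by (rule free_module_module)
  let ?G = "(\<lambda>i. {unit_vector R i}) ` {..<n}"
  show "finite ?G" by simp
  show G: "?G \<subseteq> carrier (free_module R n)" by (auto simp: unit_vector_vectors)
  have "carrier (free_module R n) \<subseteq> N" if N: "submodule N R (free_module R n)" "?G \<subseteq> N" for N
  proof
    fix Y assume "Y \<in> carrier (free_module R n)"
    then obtain v where v: "v \<in> vectors R n" "Y = {v}" by auto
    \<comment> \<open>Every vector is a combination of unit vectors: this is
      \<open>mod_hom_free_eq\<close> for the identity map.\<close>
    have "(\<lambda>Y\<in>carrier (free_module R n). Y) \<in> mod_hom R (free_module R n) (free_module R n)"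
      by (rule mod_homI[OF _ _ _ free_module_module]) auto
    from mod_hom_free_eq[OF this free_module_module v(1)]
    have "{v} = lincomb (free_module R n) (\<lambda>i. restrict (\<lambda>Y. Y) (carrier (free_module R n)) {unit_vector R i}) v n"
      using v(1) by simp
    also have "\<dots> \<in> N"
      by (rule F.lincomb_closed[OF vectors_closed[OF v(1)] N(1)])
         (use N(2) unit_vector_vectors in \<open>auto simp: image_subset_iff\<close>)
    finally show "Y \<in> N" using v(2) by simp
  qed
  hence "carrier (free_module R n) \<subseteq> submodule_gen R (free_module R n) ?G"
    unfolding submodule_gen_def by (intro Inter_greatest) blast
  thus "submodule_gen R (free_module R n) ?G = carrier (free_module R n)"
    using F.submodule_gen_least[OF F.carrier_is_submodule G] by (rule subset_antisym[rotated])
qed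

text \<open>A lift of \<open>h\<close> is fixed by choosing, for each unit vector, a preimage under
  \<open>g\<close> of its image; the values elsewhere agree by
  \<open>mod_hom_free_eq\<close>.\<close>

lemma fg_projective_free_module: "fg_projective R (free_module R n)"
  unfolding fg_projective_def
proof (intro conjI free_module_module fin_gen_free_module allI ballI impI)
  fix Z Y :: "'a fg_module" and g h
  assume g: "g \<in> mod_hom R Z Y" and h: "h \<in> mod_hom R (free_module R n) Y"
    and *: "module R Z \<and> fin_gen R Z \<and> module R Y \<and> fin_gen R Y \<and> g ` carrier Z = carrier Y"
  have "\<exists>z. z \<in> carrier Z \<and> g z = h {unit_vector R i}" if "i < n" for i
  proof -
    have "h {unit_vector R i} \<in> carrier Y"
      using unit_vector_vectors[OF that] by (intro mod_hom_closed[OF h]) simp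
    hence "h {unit_vector R i} \<in> g ` carrier Z" using * by simp
    thus ?thesis by (metis imageE)
  qed
  then obtain z where z: "\<And>i. i < n \<Longrightarrow> z i \<in> carrier Z \<and> g (z i) = h {unit_vector R i}" by metis
  let ?l = "free_hom R Z n z"
  have l: "?l \<in> mod_hom R (free_module R n) Z" using * z by (intro free_hom_mod_hom) auto
  have "compose (carrier (free_module R n)) g ?l = h"
  proof (rule mod_hom_ext[OF mod_hom_compose[OF l g free_module_module] h])
    fix V assume "V \<in> carrier (free_module R n)"
    then obtain v where v: "v \<in> vectors R n" "V = {v}" by auto
    have "g (?l {v}) = lincomb Y (\<lambda>i. g (z i)) v n"
      unfolding free_hom_apply[OF v(1)] using * z v by (intro mod_hom_lincomb[OF g]) (auto simp: vectors_closed)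
    also have "\<dots> = lincomb Y (\<lambda>i. h {unit_vector R i}) v n" using z by (intro lincomb_cong) auto
    also have "\<dots> = h {v}" using mod_hom_free_eq[OF h _ v(1)] * by simp
    finally show "compose (carrier (free_module R n)) g ?l V = h V" using v by (simp add: compose_def)
  qed
  thus "\<exists>l\<in>mod_hom R (free_module R n) Z. compose (carrier (free_module R n)) g l = h" using l by blast
qed

text \<open>The unit vectors are sent to an enumeration of \<open>G\<close>. Together with finite
  generation of kernels, this supplies the terms of a free resolution.\<close>

lemma free_cover:
  assumes M: "module R M" and G: "finite G" "G \<subseteq> carrier M"
  obtains n f where "f \<in> mod_hom R (free_module R n) M" "f ` carrier (free_module R n) = submodule_gen R M G"
proof -
  interpret M: module R M by fact
  obtain xs where xs: "set xs = G" using finite_list[OF G(1)] by blast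
  let ?n = "length xs" let ?f = "free_hom R M ?n ((!) xs)"
  have f: "?f \<in> mod_hom R (free_module R ?n) M"
    using G(2) xs by (intro free_hom_mod_hom[OF M]) auto
  have "G \<subseteq> ?f ` carrier (free_module R ?n)"
  proof
    fix g assume "g \<in> G"
    then obtain i where i: "i < ?n" "g = xs ! i" using xs by (auto simp: in_set_conv_nth)
    have "?f {unit_vector R i} = xs ! i"
      using G(2) xs i(1) by (intro free_hom_unit[OF M]) auto
    moreover have "{unit_vector R i} \<in> carrier (free_module R ?n)" using unit_vector_vectors[OF i(1)] by simp
    ultimately show "g \<in> ?f ` carrier (free_module R ?n)" using i(2) by force
  qed
  hence "submodule_gen R M G \<subseteq> ?f ` carrier (free_module R ?n)"
    by (intro M.submodule_gen_least mod_hom_image_submodule[OF f free_module_module M]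
        module.carrier_is_submodule[OF free_module_module])
  moreover have "?f ` carrier (free_module R ?n) \<subseteq> submodule_gen R M G"
  proof
    fix u assume "u \<in> ?f ` carrier (free_module R ?n)"
    then obtain v where v: "v \<in> vectors R ?n" "u = ?f {v}" by auto
    show "u \<in> submodule_gen R M G" unfolding v(2) free_hom_apply[OF v(1)]
      by (rule M.lincomb_closed[OF _ M.submodule_gen_submodule[OF G(2)]])
         (use vectors_closed[OF v(1)] submodule_gen_incl[of G R M] xs in auto)
  qed
  ultimately show ?thesis using that[OF f] by blast
qed

end

section \<open>Submodules of free modules over a Noetherian ring\<close>

context cring
begin

text \<open>Induction on the rank. The last coordinates of the elements of \<open>N\<close> form an
  ideal, finitely generated by \<open>noeth\<close>; the elements with last coordinate zero lie in
  the free module of smaller rank.\<close>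

lemma submodule_free_module_fin_gen:
  assumes noeth: "\<And>I. ideal I R \<Longrightarrow> \<exists>G. finite G \<and> G \<subseteq> I \<and> submodule_gen R (regular_module R) G = I"
  shows "submodule N R (free_module R n) \<Longrightarrow>
    \<exists>G. finite G \<and> G \<subseteq> N \<and> submodule_gen R (free_module R n) G = N"
proof (induction n arbitrary: N)
  case 0
  interpret F: module R "free_module R 0" by (rule free_module_module)
  have "carrier (free_module R 0) = {\<zero>\<^bsub>free_module R 0\<^esub>}" by (auto simp: vectors_def)
  hence "N \<subseteq> {\<zero>\<^bsub>free_module R 0\<^esub>}" using F.submoduleE(1)[OF 0] by simp
  moreover have "\<zero>\<^bsub>free_module R 0\<^esub> \<in> submodule_gen R (free_module R 0) {}"
    by (rule submodule_zero[OF free_module_module F.submodule_gen_submodule]) simp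
  ultimately have "N \<subseteq> submodule_gen R (free_module R 0) {}" by blast
  thus ?case using F.submodule_gen_least[OF 0, of "{}"] by (intro exI[of _ "{}"]) auto
next
  case (Suc n)
  let ?F = "free_module R (Suc n)" and ?E = "free_module R n"
  interpret F: module R ?F by (rule free_module_module)
  interpret E: module R ?E by (rule free_module_module)
  interpret reg: module R "regular_module R" by (rule module_regular)
  have NF: "N \<subseteq> carrier ?F" using F.submoduleE(1)[OF Suc.prems] .
  have EF: "carrier ?E \<subseteq> carrier ?F" by (auto simp: vectors_def)
  \<comment> \<open>The operations do not mention the rank, and sequences that vanish from
    \<open>n\<close> on also vanish from \<open>Suc n\<close> on, so the smaller free module
    literally is a submodule of the larger one.\<close>
  have upd: "?E = ?F\<lparr>carrier := carrier ?E\<rparr>" by (simp add: free_module_def)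
  have subE: "submodule (carrier ?E) R ?F"
    using F.module_incl_imp_submodule[OF EF] free_module_module[of n] upd by simp
  have sub_iff: "submodule L R ?E \<longleftrightarrow> submodule L R ?F \<and> L \<subseteq> carrier ?E" for L
    using F.submodule_carrier_update[OF subE, of L] unfolding upd[symmetric] .
  have "submodule (N \<inter> carrier ?E) R ?E"
    unfolding sub_iff using submodule_Int[OF free_module_module Suc.prems subE] by blast
  from Suc.IH[OF this] obtain G1
    where G1: "finite G1" "G1 \<subseteq> N \<inter> carrier ?E" "submodule_gen R ?E G1 = N \<inter> carrier ?E"
    by (elim exE conjE)
  let ?p = "\<lambda>Y\<in>carrier ?F. the_elem Y n"
  have p: "?p \<in> mod_hom R ?F (regular_module R)"
    by (rule mod_homI[OF _ _ _ free_module_module]) (auto simp: vectors_closed)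
  have "ideal (?p ` N) R"
    using mod_hom_image_submodule[OF p free_module_module module_regular Suc.prems]
    by (simp only: regular_submodule_iff)
  from noeth[OF this] obtain G
    where G: "finite G" "G \<subseteq> ?p ` N" "submodule_gen R (regular_module R) G = ?p ` N"
    by (elim exE conjE)
  obtain G2 where G2: "G2 \<subseteq> N" "finite G2" "G = ?p ` G2" using finite_subset_image[OF G(1,2)] by blast
  \<comment> \<open>\<open>G1\<close> generates the part with last coordinate zero;
    \<open>G2\<close> consists of lifts of generators of the ideal of last coordinates. An element
    of \<open>N\<close> differs from one of \<open>?H\<close> by an element of that part.\<close>
  let ?H = "submodule_gen R ?F (G1 \<union> G2)"
  have GN: "G1 \<union> G2 \<subseteq> N" using G1 G2 by blast
  have H: "submodule ?H R ?F" using GN NF by (intro F.submodule_gen_submodule) blast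
  have HN: "?H \<subseteq> N" by (rule F.submodule_gen_least[OF Suc.prems GN])
  have GH: "G1 \<union> G2 \<subseteq> ?H" by (rule submodule_gen_incl)
  have "N \<subseteq> ?H"
  proof
    fix Y assume Y: "Y \<in> N"
    have "G \<subseteq> ?p ` ?H" using GH unfolding G2(3) by (intro image_mono) blast
    hence "submodule_gen R (regular_module R) G \<subseteq> ?p ` ?H"
      by (rule reg.submodule_gen_least[OF mod_hom_image_submodule[OF p free_module_module module_regular H]])
    hence "?p Y \<in> ?p ` ?H" unfolding G(3) by (rule subsetD) (rule imageI[OF Y])
    then obtain h where h: "?p Y = ?p h" "h \<in> ?H" by (rule imageE)
    have hN: "h \<in> N" using h(2) HN by (rule subsetD[rotated])
    have cY: "Y \<in> carrier ?F" "h \<in> carrier ?F" using subsetD[OF NF Y] subsetD[OF NF hN] .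
    have d: "Y \<ominus>\<^bsub>?F\<^esub> h \<in> carrier ?F" by (rule F.M.minus_closed[OF cY])
    have "?p (Y \<ominus>\<^bsub>?F\<^esub> h) = ?p Y \<ominus>\<^bsub>regular_module R\<^esub> ?p h"
      by (rule mod_hom_minus[OF p free_module_module module_regular cY])
    also have "\<dots> = \<zero>" unfolding h(1) using mod_hom_closed[OF p cY(2)]
      by (metis reg.M.minus_eq reg.M.r_neg regular_module_simps(2))
    finally have z: "?p (Y \<ominus>\<^bsub>?F\<^esub> h) = \<zero>" .
    obtain v where v: "v \<in> vectors R (Suc n)" "Y \<ominus>\<^bsub>?F\<^esub> h = {v}" using d by auto
    have "v n = \<zero>" using z d unfolding v(2) by simp
    hence "v \<in> vectors R n" using v(1) by (auto simp: vectors_def le_Suc_eq Suc_le_eq) (metis le_neq_implies_less)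
    hence mem: "Y \<ominus>\<^bsub>?F\<^esub> h \<in> N \<inter> carrier ?E"
      using submodule_minus[OF free_module_module Suc.prems Y hN] v(2) by auto
    have sub: "N \<inter> carrier ?E \<subseteq> ?H"
    proof -
      have "submodule (?H \<inter> carrier ?E) R ?E"
        unfolding sub_iff using submodule_Int[OF free_module_module H subE] by blast
      hence "submodule_gen R ?E G1 \<subseteq> ?H \<inter> carrier ?E"
        using GH G1(2) by (intro E.submodule_gen_least) auto
      thus ?thesis unfolding G1(3) by (simp only: Int_subset_iff)
    qed
    have "(Y \<ominus>\<^bsub>?F\<^esub> h) \<oplus>\<^bsub>?F\<^esub> h \<in> ?H" by (rule F.submoduleE(5)[OF H subsetD[OF sub mem] h(2)])
    moreover have "(Y \<ominus>\<^bsub>?F\<^esub> h) \<oplus>\<^bsub>?F\<^esub> h = Y"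
      unfolding F.M.minus_eq F.M.a_assoc[OF cY(1) F.M.a_inv_closed[OF cY(2)] cY(2)] F.M.l_neg[OF cY(2)]
      by (rule F.M.r_zero[OF cY(1)])
    ultimately show "Y \<in> ?H" by (simp only:)
  qed
  hence "?H = N" by (rule subset_antisym[OF HN])
  thus ?case using G1(1) G2(2) GN by (intro exI[of _ "G1 \<union> G2"] conjI finite_UnI)
qed

end

text \<open>Transport of structure along an injection. It moves modules of any carrier type into the
  one type over which \<open>fg_projective\<close> quantifies.\<close>

definition copy_module :: "('b \<Rightarrow> 'c) \<Rightarrow> ('a, 'b, 'n) module_scheme \<Rightarrow> ('a, 'c) module" where
  "copy_module i M =
     \<lparr>carrier = i ` carrier M, monoid.mult = undefined, one = undefined, ring.zero = i \<zero>\<^bsub>M\<^esub>,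
      add = (\<lambda>Y Z. i (inv_into (carrier M) i Y \<oplus>\<^bsub>M\<^esub> inv_into (carrier M) i Z)),
      smult = (\<lambda>r Y. i (r \<odot>\<^bsub>M\<^esub> inv_into (carrier M) i Y))\<rparr>"

lemma copy_module:
  assumes M: "module R M" and i: "inj_on i (carrier M)"
  shows "module R (copy_module i M)"
    and "(\<lambda>x\<in>carrier M. i x) \<in> mod_hom R M (copy_module i M)"
    and "(\<lambda>y\<in>i ` carrier M. inv_into (carrier M) i y) \<in> mod_hom R (copy_module i M) M"
proof -
  interpret M: module R M by fact
  have [simp]: "inv_into (carrier M) i (i x) = x" if "x \<in> carrier M" for x
    using inv_into_f_f[OF i that] .
  show mod: "module R (copy_module i M)"
  proof (rule moduleI)
    show "abelian_group (copy_module i M)"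
    proof (rule abelian_groupI)
      fix y assume "y \<in> carrier (copy_module i M)"
      then obtain x where "x \<in> carrier M" "y = i x" by (auto simp: copy_module_def)
      thus "\<exists>z\<in>carrier (copy_module i M). z \<oplus>\<^bsub>copy_module i M\<^esub> y = \<zero>\<^bsub>copy_module i M\<^esub>"
        by (intro bexI[of _ "i (\<ominus>\<^bsub>M\<^esub> x)"]) (auto simp: copy_module_def M.l_neg)
    qed (auto simp: copy_module_def M.a_ac)
  qed (auto simp: copy_module_def M.is_cring M.smult_l_distr M.smult_r_distr M.smult_assoc1)
  show "(\<lambda>x\<in>carrier M. i x) \<in> mod_hom R M (copy_module i M)"
    by (rule mod_homI[OF _ _ _ M]) (auto simp: copy_module_def)
  show "(\<lambda>y\<in>i ` carrier M. inv_into (carrier M) i y) \<in> mod_hom R (copy_module i M) M"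
  proof -
    have "(\<lambda>y\<in>carrier (copy_module i M). inv_into (carrier M) i y) \<in> mod_hom R (copy_module i M) M"
      by (rule mod_homI[OF _ _ _ mod]) (auto simp: copy_module_def)
    thus ?thesis by (simp add: copy_module_def)
  qed
qed

text \<open>\<open>fg_projective\<close> promises lifts for surjections between finitely generated
  modules in one fixed type. Copies of \<open>Z\<close> and \<open>Y\<close> under \<open>i\<close>
  and \<open>j\<close> live there, the second finitely generated as an image of the first; the lift
  found for the copies is carried back along the inverse of \<open>i\<close>.\<close>

lemma projective_lift:
  fixes R :: "('a, 'm) ring_scheme" and Z :: "('a, 'b, 'n) module_scheme" and Y :: "('a, 'c, 'o) module_scheme"
    and i :: "'b \<Rightarrow> (nat \<Rightarrow> 'a) set" and j :: "'c \<Rightarrow> (nat \<Rightarrow> 'a) set"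
  assumes P: "fg_projective R P" and g: "g \<in> mod_hom R Z Y" "g ` carrier Z = carrier Y"
    and h: "h \<in> mod_hom R P Y" and Z: "module R Z" "fin_gen R Z" and Y: "module R Y"
    and i: "inj_on i (carrier Z)" and j: "inj_on j (carrier Y)"
  obtains l where "l \<in> mod_hom R P Z" "\<And>p. p \<in> carrier P \<Longrightarrow> g (l p) = h p"
proof -
  let ?Z = "copy_module i Z" and ?Y = "copy_module j Y"
  let ?i = "\<lambda>x\<in>carrier Z. i x" and ?i' = "\<lambda>y\<in>i ` carrier Z. inv_into (carrier Z) i y"
  let ?j = "\<lambda>x\<in>carrier Y. j x"
  note cZ = copy_module[OF Z(1) i] and cY = copy_module[OF Y j]
  have carr: "carrier ?Z = i ` carrier Z" "carrier ?Y = j ` carrier Y" by (simp_all add: copy_module_def)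
  have P': "module R P" using P by (simp add: fg_projective_def)
  define g' where "g' = compose (carrier ?Z) ?j (compose (carrier ?Z) g ?i')"
  have g': "g' \<in> mod_hom R ?Z ?Y"
    unfolding g'_def using mod_hom_compose[OF mod_hom_compose[OF cZ(3) g(1) cZ(1)] cY(2) cZ(1)] .
  have h': "compose (carrier P) ?j h \<in> mod_hom R P ?Y" by (rule mod_hom_compose[OF h cY(2) P'])
  have gi: "g' (i z) = j (g z)" if "z \<in> carrier Z" for z
    using that inv_into_f_f[OF i that] mod_hom_closed[OF g(1) that] by (simp add: g'_def compose_def carr)
  have "g' ` i ` carrier Z = (\<lambda>z. j (g z)) ` carrier Z"
    unfolding image_image by (rule image_cong[OF refl gi])
  also have "\<dots> = j ` carrier Y" unfolding g(2)[symmetric] image_image ..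
  finally have sg: "g' ` carrier ?Z = carrier ?Y" by (simp only: carr)
  have fZ: "fin_gen R ?Z" by (rule fin_gen_image[OF cZ(2) Z(1) cZ(1) _ Z(2)]) (simp add: carr)
  have fY: "fin_gen R ?Y" by (rule fin_gen_image[OF g' cZ(1) cY(1) sg fZ])
  have "\<exists>l\<in>mod_hom R P ?Z. compose (carrier P) g' l = compose (carrier P) ?j h"
    using P[unfolded fg_projective_def, THEN conjunct2, THEN conjunct2, rule_format, OF g' h']
      cZ(1) cY(1) fZ fY sg by simp
  then obtain l where l: "l \<in> mod_hom R P ?Z" "compose (carrier P) g' l = compose (carrier P) ?j h"
    by (rule bexE)
  have "compose (carrier P) ?i' l \<in> mod_hom R P Z" by (rule mod_hom_compose[OF l(1) cZ(3) P'])
  moreover have "g (compose (carrier P) ?i' l p) = h p" if p: "p \<in> carrier P" for p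
  proof -
    obtain z where z: "z \<in> carrier Z" "l p = i z" using mod_hom_closed[OF l(1) p] unfolding carr by blast
    have "g' (l p) = ?j (h p)" using fun_cong[OF l(2), of p] p by (simp add: compose_def)
    hence "j (g z) = j (h p)" using gi[OF z(1)] z(2) mod_hom_closed[OF h p] by simp
    hence "g z = h p" using inj_onD[OF j] mod_hom_closed[OF g(1) z(1)] mod_hom_closed[OF h p] by blast
    thus ?thesis using p z inv_into_f_f[OF i z(1)] by (simp add: compose_def)
  qed
  ultimately show ?thesis using that by blast
qed

section \<open>The quotient of a ring by an ideal as a module\<close>

definition coset_hom :: "('a, 'm) ring_scheme \<Rightarrow> 'a set \<Rightarrow> 'a \<Rightarrow> 'a set" where
  "coset_hom R I = (\<lambda>x\<in>carrier R. I +>\<^bsub>R\<^esub> x)"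

lemma (in ideal) quot_module:
  assumes "cring R"
  defines "C \<equiv> quot_module (regular_module R) I"
  shows "module R C" and "coset_hom R I \<in> mod_hom R (regular_module R) C"
    and "coset_hom R I ` carrier R = carrier C"
    and "\<And>x. x \<in> carrier R \<Longrightarrow> coset_hom R I x = \<zero>\<^bsub>C\<^esub> \<longleftrightarrow> x \<in> I"
proof -
  interpret cring R by fact
  have rcos: "I +>\<^bsub>regular_module R\<^esub> x = I +> x" for x
    by (simp add: a_r_coset_def r_coset_def)
  have carr: "carrier C = a_rcosets I"
    by (simp add: C_def quot_module_def A_RCOSETS_def RCOSETS_def r_coset_def)
  have carrE: "\<exists>x\<in>carrier R. Y = I +> x" if "Y \<in> carrier C" for Y
    using that unfolding carr A_RCOSETS_def' by blast
  have carrI: "I +> x \<in> carrier C" if "x \<in> carrier R" for x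
    using that unfolding carr A_RCOSETS_def' by blast
  have add: "add C = set_add R"
    by (simp add: C_def quot_module_def set_add_def set_mult_def fun_eq_iff)
  have zero: "\<zero>\<^bsub>C\<^esub> = I" by (simp add: C_def quot_module_def)
  have smult: "r \<odot>\<^bsub>C\<^esub> (I +> x) = I +> (r \<otimes> x)" if "r \<in> carrier R" "x \<in> carrier R" for r x
  proof -
    \<comment> \<open>The action on a coset is a union over its members; all members give the same
      coset, so the union collapses.\<close>
    have "I +> (r \<otimes> y) = I +> (r \<otimes> x)" if y: "y \<in> I +> x" for y
    proof -
      obtain u where u: "u \<in> I" "y = u \<oplus> x" using y unfolding a_r_coset_def' by blast
      have "r \<otimes> y = r \<otimes> u \<oplus> r \<otimes> x" using u \<open>r \<in> _\<close> \<open>x \<in> _\<close> by (simp add: r_distr Icarr)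
      moreover have "r \<otimes> u \<in> I" using I_l_closed[OF u(1) \<open>r \<in> _\<close>] .
      ultimately have "r \<otimes> y \<in> I +> (r \<otimes> x)" unfolding a_r_coset_def' by blast
      thus ?thesis using a_repr_independence'[of "r \<otimes> y" "r \<otimes> x"] \<open>r \<in> _\<close> \<open>x \<in> _\<close> by simp
    qed
    moreover have "x \<in> I +> x" using a_rcos_self[OF \<open>x \<in> _\<close>] .
    ultimately have "(\<Union>y\<in>I +> x. I +> (r \<otimes> y)) = I +> (r \<otimes> x)" by blast
    thus ?thesis by (simp add: C_def quot_module_def rcos)
  qed
  have sum: "(I +> x) \<oplus>\<^bsub>C\<^esub> (I +> y) = I +> (x \<oplus> y)" if "x \<in> carrier R" "y \<in> carrier R" for x y
    using a_rcos_sum[OF that] by (simp add: add)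
  show C: "module R C"
  proof (rule moduleI)
    have I0: "\<zero>\<^bsub>C\<^esub> = I +> \<zero>" by (simp add: zero a_coset_add_zero[OF a_subset])
    show "abelian_group C"
    proof (rule abelian_groupI)
      fix Y assume "Y \<in> carrier C"
      then obtain x where x: "x \<in> carrier R" "Y = I +> x" using carrE by blast
      have "(I +> \<ominus> x) \<oplus>\<^bsub>C\<^esub> Y = \<zero>\<^bsub>C\<^esub>" using x by (simp add: sum l_neg I0)
      thus "\<exists>Z\<in>carrier C. Z \<oplus>\<^bsub>C\<^esub> Y = \<zero>\<^bsub>C\<^esub>" using carrI[of "\<ominus> x"] x by blast
    qed (auto dest!: carrE simp: I0 sum carrI a_ac)
  qed (auto dest!: carrE simp: is_cring smult sum carrI l_distr r_distr m_assoc)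
  show "coset_hom R I \<in> mod_hom R (regular_module R) C"
    using mod_homI[OF _ _ _ module_regular, of "\<lambda>x. I +> x" C]
    by (simp add: coset_hom_def carrI sum smult)
  show "coset_hom R I ` carrier R = carrier C"
    using carrE carrI by (auto simp: coset_hom_def)
  show "coset_hom R I x = \<zero>\<^bsub>C\<^esub> \<longleftrightarrow> x \<in> I" if "x \<in> carrier R" for x
    using that a_coset_join1[of I x] a_coset_join2[of x I] a_subgroup by (auto simp: coset_hom_def zero)
qed

section \<open>Groups of homomorphisms and the first extension group\<close>

lemma Hom_module_abelian_group:
  assumes M: "module R M" and N: "module R N" shows "abelian_group (Hom_module R M N)"
proof -
  interpret M: module R M by fact
  interpret N: module R N by fact
  have cl: "f x \<in> carrier N" if "f \<in> mod_hom R M N" "x \<in> carrier M" for f x using that by auto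
  have z: "(\<lambda>x\<in>carrier M. \<zero>\<^bsub>N\<^esub>) \<in> mod_hom R M N" by (rule mod_homI[OF _ _ _ M]) auto
  have a: "(\<lambda>x\<in>carrier M. f x \<oplus>\<^bsub>N\<^esub> g x) \<in> mod_hom R M N" if "f \<in> mod_hom R M N" "g \<in> mod_hom R M N" for f g
    by (rule mod_homI[OF _ _ _ M]) (use that in \<open>auto simp: cl mod_hom_add mod_hom_smult N.smult_r_distr N.a_ac\<close>)
  have n: "(\<lambda>x\<in>carrier M. \<ominus>\<^bsub>N\<^esub> f x) \<in> mod_hom R M N" if "f \<in> mod_hom R M N" for f
    by (rule mod_homI[OF _ _ _ M])
       (use that in \<open>auto simp: cl mod_hom_add mod_hom_smult N.smult_r_minus N.minus_add\<close>)
  show ?thesis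
  proof (rule abelian_groupI)
    fix f assume f: "f \<in> carrier (Hom_module R M N)"
    have "(\<lambda>x\<in>carrier M. \<ominus>\<^bsub>N\<^esub> f x) \<oplus>\<^bsub>Hom_module R M N\<^esub> f = \<zero>\<^bsub>Hom_module R M N\<^esub>"
      using f by (auto simp: Hom_module_def cl N.l_neg)
    moreover have "(\<lambda>x\<in>carrier M. \<ominus>\<^bsub>N\<^esub> f x) \<in> carrier (Hom_module R M N)"
      using n f by (simp add: Hom_module_def)
    ultimately show "\<exists>g\<in>carrier (Hom_module R M N). g \<oplus>\<^bsub>Hom_module R M N\<^esub> f = \<zero>\<^bsub>Hom_module R M N\<^esub>"
      by blast
    show "\<zero>\<^bsub>Hom_module R M N\<^esub> \<oplus>\<^bsub>Hom_module R M N\<^esub> f = f"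
      using f z a[OF z] by (auto simp: Hom_module_def cl intro!: mod_hom_ext[of _ R M N _ N])
  qed (auto simp: Hom_module_def z a cl N.a_ac cong: restrict_cong)
qed

text \<open>Vanishing of the cohomology of \<open>Hom(P0, N) \<rightarrow> Hom(P1, N) \<rightarrow> Hom(P2, N)\<close> at the middle term.\<close>

definition cocycles_bound ::
    "('a, 'm) ring_scheme \<Rightarrow> ('a, 'b, 'n) module_scheme \<Rightarrow> ('b \<Rightarrow> 'c) \<Rightarrow> ('a, 'c, 'o) module_scheme \<Rightarrow>
     ('c \<Rightarrow> 'd) \<Rightarrow> ('a, 'd, 'p) module_scheme \<Rightarrow> ('a, 'e, 'q) module_scheme \<Rightarrow> bool" where
  "cocycles_bound R P2 d2 P1 d1 P0 N \<longleftrightarrow>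
     (\<forall>\<xi>\<in>mod_hom R P1 N. (\<forall>p\<in>carrier P2. \<xi> (d2 p) = \<zero>\<^bsub>N\<^esub>) \<longrightarrow>
        (\<exists>\<psi>\<in>mod_hom R P0 N. \<forall>p\<in>carrier P1. \<xi> p = \<psi> (d1 p)))"

text \<open>Translates exactness of a dualized complex into a statement on elements. It serves the
  cochain groups of \<open>Ext1\<close> as well as totally acyclic complexes.\<close>

lemma cocycles_bound_iff:
  assumes P1: "module R P1" and d1: "d1 \<in> mod_hom R P1 P0"
  shows "cocycles_bound R P2 d2 P1 d1 P0 N \<longleftrightarrow>
    mod_ker (Hom_module R P1 N) (Hom_module R P2 N) (pullback P2 d2) \<subseteq>
      pullback P1 d1 ` carrier (Hom_module R P0 N)"
proof -
  have z: "\<xi> \<in> mod_ker (Hom_module R P1 N) (Hom_module R P2 N) (pullback P2 d2) \<longleftrightarrow>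
      \<xi> \<in> mod_hom R P1 N \<and> (\<forall>p\<in>carrier P2. \<xi> (d2 p) = \<zero>\<^bsub>N\<^esub>)" for \<xi>
    by (auto simp: mod_ker_def Hom_module_def pullback_def compose_def restrict_def fun_eq_iff)
  have b: "\<xi> \<in> pullback P1 d1 ` carrier (Hom_module R P0 N) \<longleftrightarrow>
      (\<exists>\<psi>\<in>mod_hom R P0 N. \<forall>p\<in>carrier P1. \<xi> p = \<psi> (d1 p))" if \<xi>: "\<xi> \<in> mod_hom R P1 N" for \<xi>
  proof
    assume "\<xi> \<in> pullback P1 d1 ` carrier (Hom_module R P0 N)"
    then obtain \<psi> where "\<psi> \<in> mod_hom R P0 N" "\<xi> = compose (carrier P1) \<psi> d1"
      by (auto simp: Hom_module_def pullback_def)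
    thus "\<exists>\<psi>\<in>mod_hom R P0 N. \<forall>p\<in>carrier P1. \<xi> p = \<psi> (d1 p)" by (auto simp: compose_def)
  next
    assume "\<exists>\<psi>\<in>mod_hom R P0 N. \<forall>p\<in>carrier P1. \<xi> p = \<psi> (d1 p)"
    then obtain \<psi> where \<psi>: "\<psi> \<in> mod_hom R P0 N" "\<And>p. p \<in> carrier P1 \<Longrightarrow> \<xi> p = \<psi> (d1 p)" by blast
    have "\<xi> = pullback P1 d1 \<psi>" unfolding pullback_def
      by (rule mod_hom_ext[OF \<xi> mod_hom_compose[OF d1 \<psi>(1) P1]]) (simp add: compose_def \<psi>(2))
    thus "\<xi> \<in> pullback P1 d1 ` carrier (Hom_module R P0 N)" using \<psi>(1) by (auto simp: Hom_module_def)
  qed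
  show ?thesis unfolding cocycles_bound_def subset_iff z using b by blast
qed

text \<open>A quotient group is trivial iff the subgroup divided out is everything, so the cocycles
  \<open>Z\<close> must lie in the coboundaries \<open>B\<close>. Most of the work is to see that
  \<open>Mod\<close> forms a quotient of groups at all: \<open>Z\<close> is a subgroup of the
  homomorphism group, and \<open>B\<close> is a subgroup of \<open>Z\<close> because
  \<open>d1\<close> after \<open>d2\<close> vanishes.\<close>

lemma trivial_Ext1_iff:
  assumes P2: "module R P2" and P1: "module R P1" and P0: "module R P0" and N: "module R N"
    and d2: "d2 \<in> mod_hom R P2 P1" and d1: "d1 \<in> mod_hom R P1 P0"
    and dd: "\<And>p. p \<in> carrier P2 \<Longrightarrow> d1 (d2 p) = \<zero>\<^bsub>P0\<^esub>"
  shows "trivial_group (Ext1 R P2 d2 P1 d1 P0 N) \<longleftrightarrow> cocycles_bound R P2 d2 P1 d1 P0 N"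
proof -
  interpret N: module R N by fact
  interpret H: abelian_group "Hom_module R P1 N" by (rule Hom_module_abelian_group[OF P1 N])
  let ?H = "Hom_module R P1 N"
  define Z where "Z = mod_ker ?H (Hom_module R P2 N) (pullback P2 d2)"
  define B where "B = pullback P1 d1 ` carrier (Hom_module R P0 N)"
  define G where "G = (add_monoid ?H)\<lparr>carrier := Z\<rparr>"
  have zmem: "\<xi> \<in> Z \<longleftrightarrow> \<xi> \<in> mod_hom R P1 N \<and> (\<forall>p\<in>carrier P2. \<xi> (d2 p) = \<zero>\<^bsub>N\<^esub>)" for \<xi>
    by (auto simp: Z_def mod_ker_def Hom_module_def pullback_def compose_def restrict_def fun_eq_iff)
  have add: "(\<xi> \<oplus>\<^bsub>?H\<^esub> \<eta>) p = \<xi> p \<oplus>\<^bsub>N\<^esub> \<eta> p" if "p \<in> carrier P1" for \<xi> \<eta> p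
    using that by (simp add: Hom_module_def)
  have carrH: "carrier ?H = mod_hom R P1 N" by (simp add: Hom_module_def)
  have zeroH: "\<zero>\<^bsub>?H\<^esub> p = \<zero>\<^bsub>N\<^esub>" if "p \<in> carrier P1" for p using that by (simp add: Hom_module_def)
  have neg: "(\<ominus>\<^bsub>?H\<^esub> \<xi>) p = \<ominus>\<^bsub>N\<^esub> \<xi> p" if "\<xi> \<in> mod_hom R P1 N" "p \<in> carrier P1" for \<xi> p
  proof -
    have "(\<ominus>\<^bsub>?H\<^esub> \<xi>) p \<oplus>\<^bsub>N\<^esub> \<xi> p = \<zero>\<^bsub>N\<^esub>"
      using add[OF that(2), of "\<ominus>\<^bsub>?H\<^esub> \<xi>" \<xi>] zeroH[OF that(2)] H.l_neg[of \<xi>] that(1) by (simp add: carrH)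
    moreover have "\<ominus>\<^bsub>?H\<^esub> \<xi> \<in> mod_hom R P1 N" using H.a_inv_closed[of \<xi>] that(1) by (simp add: carrH)
    ultimately show ?thesis using that by (intro N.minus_equality[symmetric]) auto
  qed
  have d2c: "d2 p \<in> carrier P1" if "p \<in> carrier P2" for p using d2 that by auto
  have Zsub: "subgroup Z (add_monoid ?H)"
  proof (rule H.add.subgroupI)
    show "Z \<subseteq> carrier ?H" by (auto simp: zmem carrH)
    show "Z \<noteq> {}" using zeroH d2c H.zero_closed zmem carrH by blast
    show "\<ominus>\<^bsub>?H\<^esub> \<xi> \<in> Z" if "\<xi> \<in> Z" for \<xi>
      using that neg d2c H.a_inv_closed[of \<xi>] by (simp add: zmem carrH)
    show "\<xi> \<oplus>\<^bsub>?H\<^esub> \<eta> \<in> Z" if "\<xi> \<in> Z" "\<eta> \<in> Z" for \<xi> \<eta>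
      using that add d2c H.a_closed[of \<xi> \<eta>] by (simp add: zmem carrH)
  qed
  interpret G: comm_group G
    unfolding G_def
  proof (rule group.group_comm_groupI[OF H.add.subgroup_imp_group[OF Zsub]])
    fix \<xi> \<eta> assume "\<xi> \<in> carrier ((add_monoid ?H)\<lparr>carrier := Z\<rparr>)" "\<eta> \<in> carrier ((add_monoid ?H)\<lparr>carrier := Z\<rparr>)"
    hence "\<xi> \<in> carrier ?H" "\<eta> \<in> carrier ?H" by (simp_all add: zmem carrH)
    thus "\<xi> \<otimes>\<^bsub>(add_monoid ?H)\<lparr>carrier := Z\<rparr>\<^esub> \<eta> = \<eta> \<otimes>\<^bsub>(add_monoid ?H)\<lparr>carrier := Z\<rparr>\<^esub> \<xi>"
      by (simp add: H.a_comm)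
  qed
  have BZ: "B \<subseteq> Z"
  proof
    fix \<xi> assume "\<xi> \<in> B"
    then obtain \<psi> where \<psi>: "\<psi> \<in> mod_hom R P0 N" "\<xi> = compose (carrier P1) \<psi> d1"
      by (auto simp: B_def Hom_module_def pullback_def)
    have "\<xi> (d2 p) = \<zero>\<^bsub>N\<^esub>" if "p \<in> carrier P2" for p
      using dd[OF that] d2c[OF that] mod_hom_zero[OF \<psi>(1) P0 N] by (simp add: \<psi>(2) compose_def)
    thus "\<xi> \<in> Z" using mod_hom_compose[OF d1 \<psi>(1) P1] \<psi>(2) by (simp add: zmem)
  qed
  interpret H0: abelian_group "Hom_module R P0 N" by (rule Hom_module_abelian_group[OF P0 N])
  have pb_add: "pullback P1 d1 (\<psi> \<oplus>\<^bsub>Hom_module R P0 N\<^esub> \<phi>) = pullback P1 d1 \<psi> \<oplus>\<^bsub>?H\<^esub> pullback P1 d1 \<phi>" for \<psi> \<phi>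
    using mod_hom_closed[OF d1] by (auto simp: Hom_module_def pullback_def compose_def fun_eq_iff)
  have Bsub: "subgroup B G"
  proof (rule G.subgroupI)
    show "B \<subseteq> carrier G" using BZ by (simp add: G_def)
    show "B \<noteq> {}" using H0.zero_closed by (auto simp: B_def)
    have mult: "\<xi> \<otimes>\<^bsub>G\<^esub> \<eta> = \<xi> \<oplus>\<^bsub>?H\<^esub> \<eta>" for \<xi> \<eta> by (simp add: G_def)
    show "\<xi> \<otimes>\<^bsub>G\<^esub> \<eta> \<in> B" if mem: "\<xi> \<in> B" "\<eta> \<in> B" for \<xi> \<eta>
    proof -
      obtain \<psi> \<phi> where "\<psi> \<in> carrier (Hom_module R P0 N)" "\<phi> \<in> carrier (Hom_module R P0 N)"
        "\<xi> = pullback P1 d1 \<psi>" "\<eta> = pullback P1 d1 \<phi>" using mem unfolding B_def by blast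
      thus ?thesis unfolding mult B_def using H0.a_closed[of \<psi> \<phi>] pb_add[of \<psi> \<phi>] by (metis imageI)
    qed
    show "inv\<^bsub>G\<^esub> \<xi> \<in> B" if mem: "\<xi> \<in> B" for \<xi>
    proof -
      obtain \<psi> where \<psi>: "\<psi> \<in> carrier (Hom_module R P0 N)" "\<xi> = pullback P1 d1 \<psi>" using mem unfolding B_def by blast
      let ?\<eta> = "pullback P1 d1 (\<ominus>\<^bsub>Hom_module R P0 N\<^esub> \<psi>)"
      have \<eta>: "?\<eta> \<in> B" using H0.a_inv_closed[OF \<psi>(1)] by (simp add: B_def)
      have "?\<eta> \<otimes>\<^bsub>G\<^esub> \<xi> = pullback P1 d1 \<zero>\<^bsub>Hom_module R P0 N\<^esub>"
        unfolding mult \<psi>(2) pb_add[symmetric] H0.l_neg[OF \<psi>(1)] ..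
      also have "\<dots> = \<zero>\<^bsub>?H\<^esub>"
        using mod_hom_closed[OF d1] by (auto simp: Hom_module_def pullback_def compose_def fun_eq_iff)
      finally have "?\<eta> \<otimes>\<^bsub>G\<^esub> \<xi> = \<one>\<^bsub>G\<^esub>" by (simp add: G_def)
      hence "inv\<^bsub>G\<^esub> \<xi> = ?\<eta>" using \<eta> mem BZ by (intro G.inv_equality) (auto simp: G_def)
      thus ?thesis using \<eta> by simp
    qed
  qed
  have "B \<lhd> G" using G.normal_iff_subgroup Bsub by blast
  then interpret normal B G .
  have carr: "carrier (G Mod B) = rcosets\<^bsub>G\<^esub> B" "\<one>\<^bsub>G Mod B\<^esub> = B" by (simp_all add: FactGroup_def)
  have "trivial_group (G Mod B) \<longleftrightarrow> rcosets\<^bsub>G\<^esub> B = {B}"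
    unfolding trivial_group_def carr using factorgroup_is_group by simp
  also have "\<dots> \<longleftrightarrow> Z \<subseteq> B"
  proof
    assume eq: "rcosets\<^bsub>G\<^esub> B = {B}"
    show "Z \<subseteq> B"
    proof
      fix \<xi> assume "\<xi> \<in> Z"
      hence \<xi>: "\<xi> \<in> carrier G" by (simp add: G_def)
      hence "B #>\<^bsub>G\<^esub> \<xi> = B" using eq unfolding RCOSETS_def by blast
      thus "\<xi> \<in> B" using G.rcos_self[OF \<xi> Bsub] by simp
    qed
  next
    assume "Z \<subseteq> B"
    hence "B = carrier G" using BZ by (simp add: G_def)
    hence "B #>\<^bsub>G\<^esub> \<xi> = B" if "\<xi> \<in> carrier G" for \<xi> using G.coset_join2[OF that Bsub] that by simp
    thus "rcosets\<^bsub>G\<^esub> B = {B}" unfolding RCOSETS_def using G.one_closed by blast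
  qed
  also have "\<dots> \<longleftrightarrow> cocycles_bound R P2 d2 P1 d1 P0 N"
    unfolding cocycles_bound_iff[OF P1 d1] Z_def B_def ..
  finally show ?thesis unfolding Ext1_def G_def Z_def B_def .
qed

section \<open>Extending homomorphisms from an ideal\<close>

lemma mod_iso_inverse:
  assumes f: "f \<in> mod_hom R M N" "bij_betw f (carrier M) (carrier N)" and M: "module R M" and N: "module R N"
  shows "(\<lambda>y\<in>carrier N. inv_into (carrier M) f y) \<in> mod_hom R N M"
proof (rule mod_homI[OF _ _ _ N])
  interpret M: module R M by fact
  have inj: "inj_on f (carrier M)" and surj: "f ` carrier M = carrier N"
    using f(2) by (auto simp: bij_betw_def)
  let ?g = "inv_into (carrier M) f"
  have g: "?g y \<in> carrier M" "f (?g y) = y" if "y \<in> carrier N" for y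
    using that surj inv_into_into[of y f "carrier M"] f_inv_into_f[of y f "carrier M"] by auto
  show "?g y \<in> carrier M" if "y \<in> carrier N" for y by (rule g[OF that])
  show "?g (x \<oplus>\<^bsub>N\<^esub> y) = ?g x \<oplus>\<^bsub>M\<^esub> ?g y" if "x \<in> carrier N" "y \<in> carrier N" for x y
    by (rule inv_into_f_eq[OF inj]) (use that g in \<open>auto simp: mod_hom_add[OF f(1)]\<close>)
  show "?g (r \<odot>\<^bsub>N\<^esub> x) = r \<odot>\<^bsub>M\<^esub> ?g x" if "r \<in> carrier R" "x \<in> carrier N" for r x
    by (rule inv_into_f_eq[OF inj]) (use that g in \<open>auto simp: mod_hom_smult[OF f(1)]\<close>)
qed

text \<open>Surjectivity of the restriction from Hom(R, R) to Hom(I, R), as each endomorphism of the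
  regular module is multiplication by an element. The cokernel of this restriction is the first
  extension group of R/I by R.\<close>

definition extends :: "('a, 'm) ring_scheme \<Rightarrow> 'a set \<Rightarrow> bool" where
  "extends R I \<longleftrightarrow>
     (\<forall>\<phi>\<in>mod_hom R ((regular_module R)\<lparr>carrier := I\<rparr>) (regular_module R).
        \<exists>y\<in>carrier R. \<forall>u\<in>I. \<phi> u = y \<otimes>\<^bsub>R\<^esub> u)"

context cring
begin

lemma mod_hom_regular:
  assumes "f \<in> mod_hom R (regular_module R) M" "r \<in> carrier R" shows "f r = r \<odot>\<^bsub>M\<^esub> f \<one>"
  using mod_hom_smult[OF assms, of \<one>] assms(2) by simp

lemma fin_gen_regular: "fin_gen R (regular_module R)"
proof -
  interpret reg: module R "regular_module R" by (rule module_regular)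
  have "carrier R \<subseteq> N" if "submodule N R (regular_module R)" "{\<one>} \<subseteq> N" for N
    using that unfolding regular_submodule_iff by (metis ideal.one_imp_carrier insert_subset order_refl)
  hence "carrier R \<subseteq> submodule_gen R (regular_module R) {\<one>}"
    unfolding submodule_gen_def by (intro Inter_greatest) blast
  moreover have "submodule_gen R (regular_module R) {\<one>} \<subseteq> carrier R"
    using reg.submodule_gen_least[OF reg.carrier_is_submodule] by simp
  ultimately show ?thesis unfolding fin_gen_def by (intro exI[of _ "{\<one>}"]) auto
qed

text \<open>Constant sequences place the ring inside the carrier type required by
  \<open>projective_lift\<close>.\<close>

lemma inj_singleton_const: "inj_on (\<lambda>x. {\<lambda>_::nat. x}) T"
  by (auto intro!: inj_onI dest: fun_cong)

end

text \<open>Two presentations of the same cyclic module are compared: \<open>\<pi>\<close> from the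
  regular module with kernel \<open>I\<close>, and \<open>e\<close> from the term \<open>P0\<close>
  of an arbitrary resolution. The injection \<open>j\<close> allows \<open>C\<close> to occur as the
  target of a lifting problem.\<close>

locale presentation = cring R for R :: "('a, 'm) ring_scheme" (structure) +
  fixes I and C :: "('a, 'c, 'n) module_scheme" and \<pi> and j :: "'c \<Rightarrow> (nat \<Rightarrow> 'a) set"
    and P2 :: "'a fg_module" and d2 and P1 :: "'a fg_module" and d1 and P0 :: "'a fg_module" and e
  assumes I: "ideal I R" and C: "module R C"
    and \<pi>: "\<pi> \<in> mod_hom R (regular_module R) C" "\<pi> ` carrier R = carrier C"
      "\<And>x. x \<in> carrier R \<Longrightarrow> \<pi> x = \<zero>\<^bsub>C\<^esub> \<longleftrightarrow> x \<in> I"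
    and j: "inj_on j (carrier C)"
    and P2: "module R P2" and P1: "module R P1" and P0: "fg_projective R P0"
    and d2: "d2 \<in> mod_hom R P2 P1" and d1: "d1 \<in> mod_hom R P1 P0" and e: "e \<in> mod_hom R P0 C"
    and ex1: "d2 ` carrier P2 = mod_ker P1 P0 d1" and ex0: "d1 ` carrier P1 = mod_ker P0 C e"
    and surj: "e ` carrier P0 = carrier C"
begin

lemma P0_module: "module R P0" using P0 by (simp add: fg_projective_def)

text \<open>\<open>l\<close> exists because \<open>P0\<close> is projective and \<open>\<pi>\<close>
  is surjective; \<open>h\<close> exists because the regular module is free on one generator, which
  is sent to a preimage under \<open>e\<close> of \<open>\<pi> \<one>\<close>.\<close>

lemma lifts:
  obtains l h where "l \<in> mod_hom R P0 (regular_module R)" "h \<in> mod_hom R (regular_module R) P0"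
    "\<And>p. p \<in> carrier P0 \<Longrightarrow> \<pi> (l p) = e p" "\<And>r. r \<in> carrier R \<Longrightarrow> e (h r) = \<pi> r"
proof -
  have "\<pi> ` carrier (regular_module R) = carrier C" using \<pi>(2) by simp
  from projective_lift[OF P0 \<pi>(1) this e module_regular fin_gen_regular C inj_singleton_const j]
  obtain l where l: "l \<in> mod_hom R P0 (regular_module R)" "\<And>p. p \<in> carrier P0 \<Longrightarrow> \<pi> (l p) = e p"
    by blast
  interpret P0: module R P0 by (rule P0_module)
  have "\<pi> \<one> \<in> carrier C" using mod_hom_closed[OF \<pi>(1), of \<one>] by simp
  hence "\<pi> \<one> \<in> e ` carrier P0" using surj by simp
  then obtain p where p: "p \<in> carrier P0" "e p = \<pi> \<one>" by auto
  let ?h = "\<lambda>r\<in>carrier (regular_module R). r \<odot>\<^bsub>P0\<^esub> p"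
  have h: "?h \<in> mod_hom R (regular_module R) P0"
    by (rule mod_homI[OF _ _ _ module_regular]) (use p in \<open>auto simp: P0.smult_l_distr P0.smult_assoc1\<close>)
  have "e (?h r) = \<pi> r" if "r \<in> carrier R" for r
    using that mod_hom_smult[OF e that p(1)] mod_hom_regular[OF \<pi>(1) that] p(2) by simp
  thus ?thesis using that[OF l(1) h l(2)] by blast
qed

text \<open>
  A cocycle is a homomorphism \<open>\<chi>\<close> on the kernel of \<open>e\<close>. If \<open>\<chi> \<circ> h\<close> is the multiplication by \<open>y\<close> on \<open>I\<close>, then
  \<open>p \<mapsto> y l(p) + \<chi>(p - h(l(p)))\<close> extends \<open>\<chi>\<close> to \<open>P0\<close>.
\<close>

lemma extends_cocycles_bound:
  assumes ext: "extends R I" shows "cocycles_bound R P2 d2 P1 d1 P0 (regular_module R)"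
  unfolding cocycles_bound_def
proof (intro ballI impI)
  fix \<xi> assume \<xi>: "\<xi> \<in> mod_hom R P1 (regular_module R)"
    and "\<forall>p\<in>carrier P2. \<xi> (d2 p) = \<zero>\<^bsub>regular_module R\<^esub>"
  hence \<xi>0: "\<xi> (d2 p) = \<zero>" if "p \<in> carrier P2" for p using that by simp
  interpret P1: module R P1 by (rule P1)
  interpret P0: module R P0 by (rule P0_module)
  obtain l h where l: "l \<in> mod_hom R P0 (regular_module R)" and h: "h \<in> mod_hom R (regular_module R) P0"
    and \<pi>l: "\<And>p. p \<in> carrier P0 \<Longrightarrow> \<pi> (l p) = e p" and eh: "\<And>r. r \<in> carrier R \<Longrightarrow> e (h r) = \<pi> r"
    using lifts by blast
  have lc: "l p \<in> carrier R" if "p \<in> carrier P0" for p using mod_hom_closed[OF l that] by simp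
  have hc: "h r \<in> carrier P0" if "r \<in> carrier R" for r using mod_hom_closed[OF h] that by simp
  have \<xi>c: "\<xi> p \<in> carrier R" if "p \<in> carrier P1" for p using mod_hom_closed[OF \<xi> that] by simp
  have d1c: "d1 p \<in> carrier P0" if "p \<in> carrier P1" for p using mod_hom_closed[OF d1 that] .
  \<comment> \<open>\<open>\<xi>\<close> vanishes on the image of \<open>d2\<close>, which is the
    kernel of \<open>d1\<close>, so its value depends only on the image under \<open>d1\<close>.
    This makes \<open>\<chi>\<close> below a function on the kernel of \<open>e\<close>.\<close>
  have wd: "\<xi> p = \<xi> q" if pq: "p \<in> carrier P1" "q \<in> carrier P1" "d1 p = d1 q" for p q
  proof -
    have "d1 (p \<ominus>\<^bsub>P1\<^esub> q) = d1 p \<ominus>\<^bsub>P0\<^esub> d1 q" by (rule mod_hom_minus[OF d1 P1 P0_module pq(1,2)])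
    also have "\<dots> = \<zero>\<^bsub>P0\<^esub>" unfolding pq(3) P0.M.minus_eq by (rule P0.M.r_neg[OF d1c[OF pq(2)]])
    finally have "p \<ominus>\<^bsub>P1\<^esub> q \<in> mod_ker P1 P0 d1"
      using P1.M.minus_closed[OF pq(1,2)] by (simp add: mod_ker_def)
    then obtain z where z: "z \<in> carrier P2" "p \<ominus>\<^bsub>P1\<^esub> q = d2 z" unfolding ex1[symmetric] by blast
    have "\<xi> (p \<ominus>\<^bsub>P1\<^esub> q) = \<xi> p \<ominus>\<^bsub>regular_module R\<^esub> \<xi> q"
      by (rule mod_hom_minus[OF \<xi> P1 module_regular pq(1,2)])
    hence "\<xi> p \<ominus>\<^bsub>regular_module R\<^esub> \<xi> q = \<zero>" using \<xi>0[OF z(1)] z(2) by simp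
    interpret reg: module R "regular_module R" by (rule module_regular)
    have "\<xi> p = \<xi> p \<ominus>\<^bsub>regular_module R\<^esub> \<xi> q \<oplus>\<^bsub>regular_module R\<^esub> \<xi> q"
      using reg.M.a_assoc[of "\<xi> p" "\<ominus>\<^bsub>regular_module R\<^esub> \<xi> q" "\<xi> q"] reg.M.l_neg[of "\<xi> q"]
        reg.M.a_inv_closed[of "\<xi> q"] \<xi>c[OF pq(1)] \<xi>c[OF pq(2)]
      by (simp add: reg.M.minus_eq)
    thus ?thesis using \<open>\<xi> p \<ominus>\<^bsub>regular_module R\<^esub> \<xi> q = \<zero>\<close> \<xi>c[OF pq(2)] by simp
  qed
  define \<chi> where "\<chi> = (\<lambda>x. \<xi> (SOME p. p \<in> carrier P1 \<and> d1 p = x))"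
  have \<chi>: "\<chi> (d1 p) = \<xi> p" if "p \<in> carrier P1" for p
  proof -
    have "(SOME q. q \<in> carrier P1 \<and> d1 q = d1 p) \<in> carrier P1 \<and> d1 (SOME q. q \<in> carrier P1 \<and> d1 q = d1 p) = d1 p"
      by (rule someI[of _ p]) (simp add: that)
    thus ?thesis unfolding \<chi>_def using wd that by blast
  qed
  have kerE: "\<exists>p\<in>carrier P1. x = d1 p" if "x \<in> carrier P0" "e x = \<zero>\<^bsub>C\<^esub>" for x
    using that ex0 unfolding mod_ker_def by blast
  have \<chi>_closed: "\<chi> x \<in> carrier R" if x: "x \<in> carrier P0" "e x = \<zero>\<^bsub>C\<^esub>" for x
    using kerE[OF x] \<chi> \<xi>c by auto
  have \<chi>_add: "\<chi> (x \<oplus>\<^bsub>P0\<^esub> y) = \<chi> x \<oplus> \<chi> y"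
    if x: "x \<in> carrier P0" "e x = \<zero>\<^bsub>C\<^esub>" and y: "y \<in> carrier P0" "e y = \<zero>\<^bsub>C\<^esub>" for x y
  proof -
    obtain p q where p: "p \<in> carrier P1" "x = d1 p" and q: "q \<in> carrier P1" "y = d1 q"
      using kerE[OF x] kerE[OF y] by blast
    have "x \<oplus>\<^bsub>P0\<^esub> y = d1 (p \<oplus>\<^bsub>P1\<^esub> q)" using mod_hom_add[OF d1 p(1) q(1)] p q by simp
    thus ?thesis using \<chi>[of "p \<oplus>\<^bsub>P1\<^esub> q"] \<chi>[OF p(1)] \<chi>[OF q(1)] mod_hom_add[OF \<xi> p(1) q(1)] p q by simp
  qed
  have \<chi>_smult: "\<chi> (r \<odot>\<^bsub>P0\<^esub> x) = r \<otimes> \<chi> x"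
    if r: "r \<in> carrier R" and x: "x \<in> carrier P0" "e x = \<zero>\<^bsub>C\<^esub>" for r x
  proof -
    obtain p where p: "p \<in> carrier P1" "x = d1 p" using kerE[OF x] by blast
    have "r \<odot>\<^bsub>P0\<^esub> x = d1 (r \<odot>\<^bsub>P1\<^esub> p)" using mod_hom_smult[OF d1 r p(1)] p by simp
    thus ?thesis using \<chi>[of "r \<odot>\<^bsub>P1\<^esub> p"] \<chi>[OF p(1)] mod_hom_smult[OF \<xi> r p(1)] p r by simp
  qed
  have Ic: "u \<in> carrier R" if "u \<in> I" for u using ideal.Icarr[OF I that] .
  have hI: "e (h u) = \<zero>\<^bsub>C\<^esub>" if "u \<in> I" for u using eh[OF Ic[OF that]] \<pi>(3)[OF Ic[OF that]] that by simp
  have subI: "submodule I R (regular_module R)" using I by (simp only: regular_submodule_iff)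
  have modI: "module R ((regular_module R)\<lparr>carrier := I\<rparr>)"
    by (rule submodule.submodule_is_module[OF subI module_regular])
  have "(\<lambda>u\<in>carrier ((regular_module R)\<lparr>carrier := I\<rparr>). \<chi> (h u))
      \<in> mod_hom R ((regular_module R)\<lparr>carrier := I\<rparr>) (regular_module R)"
  proof (rule mod_homI[OF _ _ _ modI])
    fix u v r assume "u \<in> carrier ((regular_module R)\<lparr>carrier := I\<rparr>)"
    hence u: "u \<in> I" by simp
    show "\<chi> (h u) \<in> carrier (regular_module R)" using \<chi>_closed[OF hc hI] u Ic by simp
    {
      assume "v \<in> carrier ((regular_module R)\<lparr>carrier := I\<rparr>)"
      hence v: "v \<in> I" by simp
      show "\<chi> (h (u \<oplus>\<^bsub>(regular_module R)\<lparr>carrier := I\<rparr>\<^esub> v)) = \<chi> (h u) \<oplus>\<^bsub>regular_module R\<^esub> \<chi> (h v)"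
        using mod_hom_add[OF h, of u v] \<chi>_add[OF hc[OF Ic[OF u]] hI[OF u] hc[OF Ic[OF v]] hI[OF v]] Ic u v by simp
    }
    assume r: "r \<in> carrier R"
    show "\<chi> (h (r \<odot>\<^bsub>(regular_module R)\<lparr>carrier := I\<rparr>\<^esub> u)) = r \<odot>\<^bsub>regular_module R\<^esub> \<chi> (h u)"
      using mod_hom_smult[OF h r, of u] \<chi>_smult[OF r hc[OF Ic[OF u]] hI[OF u]] Ic u by simp
  qed
  then obtain y where y: "y \<in> carrier R" "\<And>u. u \<in> I \<Longrightarrow> \<chi> (h u) = y \<otimes> u"
    using ext unfolding extends_def by fastforce
  have diff: "p \<ominus>\<^bsub>P0\<^esub> h (l p) \<in> carrier P0" "e (p \<ominus>\<^bsub>P0\<^esub> h (l p)) = \<zero>\<^bsub>C\<^esub>" if p: "p \<in> carrier P0" for p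
  proof -
    interpret C: module R C by (rule C)
    show c: "p \<ominus>\<^bsub>P0\<^esub> h (l p) \<in> carrier P0" by (rule P0.M.minus_closed[OF p hc[OF lc[OF p]]])
    have "e (p \<ominus>\<^bsub>P0\<^esub> h (l p)) = e p \<ominus>\<^bsub>C\<^esub> e (h (l p))"
      by (rule mod_hom_minus[OF e P0_module C p hc[OF lc[OF p]]])
    also have "e (h (l p)) = e p" using eh[OF lc[OF p]] \<pi>l[OF p] by simp
    also have "e p \<ominus>\<^bsub>C\<^esub> e p = \<zero>\<^bsub>C\<^esub>" unfolding C.M.minus_eq by (rule C.M.r_neg[OF mod_hom_closed[OF e p]])
    finally show "e (p \<ominus>\<^bsub>P0\<^esub> h (l p)) = \<zero>\<^bsub>C\<^esub>" .
  qed
  let ?\<psi> = "\<lambda>p\<in>carrier P0. y \<otimes> l p \<oplus> \<chi> (p \<ominus>\<^bsub>P0\<^esub> h (l p))"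
  have \<psi>: "?\<psi> \<in> mod_hom R P0 (regular_module R)"
  proof (rule mod_homI[OF _ _ _ P0_module])
    fix p assume p: "p \<in> carrier P0"
    show "y \<otimes> l p \<oplus> \<chi> (p \<ominus>\<^bsub>P0\<^esub> h (l p)) \<in> carrier (regular_module R)"
      using y lc[OF p] \<chi>_closed[OF diff[OF p]] by simp
    {
      fix q assume q: "q \<in> carrier P0"
      have "h (l (p \<oplus>\<^bsub>P0\<^esub> q)) = h (l p) \<oplus>\<^bsub>P0\<^esub> h (l q)"
        using mod_hom_add[OF l p q] mod_hom_add[OF h, of "l p" "l q"] lc p q by simp
      hence "p \<oplus>\<^bsub>P0\<^esub> q \<ominus>\<^bsub>P0\<^esub> h (l (p \<oplus>\<^bsub>P0\<^esub> q)) = (p \<ominus>\<^bsub>P0\<^esub> h (l p)) \<oplus>\<^bsub>P0\<^esub> (q \<ominus>\<^bsub>P0\<^esub> h (l q))"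
        using hc[OF lc[OF p]] hc[OF lc[OF q]] p q
        by (simp add: P0.M.minus_eq P0.M.minus_add P0.M.a_ac)
      hence "\<chi> (p \<oplus>\<^bsub>P0\<^esub> q \<ominus>\<^bsub>P0\<^esub> h (l (p \<oplus>\<^bsub>P0\<^esub> q))) = \<chi> (p \<ominus>\<^bsub>P0\<^esub> h (l p)) \<oplus> \<chi> (q \<ominus>\<^bsub>P0\<^esub> h (l q))"
        using \<chi>_add[OF diff[OF p] diff[OF q]] by simp
      thus "y \<otimes> l (p \<oplus>\<^bsub>P0\<^esub> q) \<oplus> \<chi> (p \<oplus>\<^bsub>P0\<^esub> q \<ominus>\<^bsub>P0\<^esub> h (l (p \<oplus>\<^bsub>P0\<^esub> q))) =
          (y \<otimes> l p \<oplus> \<chi> (p \<ominus>\<^bsub>P0\<^esub> h (l p))) \<oplus>\<^bsub>regular_module R\<^esub> (y \<otimes> l q \<oplus> \<chi> (q \<ominus>\<^bsub>P0\<^esub> h (l q)))"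
        using y(1) lc[OF p] lc[OF q] \<chi>_closed[OF diff[OF p]] \<chi>_closed[OF diff[OF q]] mod_hom_add[OF l p q]
        by (simp add: r_distr a_ac)
    }
    fix r assume r: "r \<in> carrier R"
    have "h (l (r \<odot>\<^bsub>P0\<^esub> p)) = r \<odot>\<^bsub>P0\<^esub> h (l p)"
      using mod_hom_smult[OF l r p] mod_hom_smult[OF h r, of "l p"] lc p by simp
    hence "r \<odot>\<^bsub>P0\<^esub> p \<ominus>\<^bsub>P0\<^esub> h (l (r \<odot>\<^bsub>P0\<^esub> p)) = r \<odot>\<^bsub>P0\<^esub> (p \<ominus>\<^bsub>P0\<^esub> h (l p))"
      using hc[OF lc[OF p]] p r by (simp add: P0.M.minus_eq P0.smult_r_distr P0.smult_r_minus)
    hence "\<chi> (r \<odot>\<^bsub>P0\<^esub> p \<ominus>\<^bsub>P0\<^esub> h (l (r \<odot>\<^bsub>P0\<^esub> p))) = r \<otimes> \<chi> (p \<ominus>\<^bsub>P0\<^esub> h (l p))"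
      using \<chi>_smult[OF r diff[OF p]] by simp
    thus "y \<otimes> l (r \<odot>\<^bsub>P0\<^esub> p) \<oplus> \<chi> (r \<odot>\<^bsub>P0\<^esub> p \<ominus>\<^bsub>P0\<^esub> h (l (r \<odot>\<^bsub>P0\<^esub> p))) =
        r \<odot>\<^bsub>regular_module R\<^esub> (y \<otimes> l p \<oplus> \<chi> (p \<ominus>\<^bsub>P0\<^esub> h (l p)))"
      using y(1) lc[OF p] \<chi>_closed[OF diff[OF p]] mod_hom_smult[OF l r p] r
      by (simp add: r_distr m_lcomm)
  qed
  have "\<xi> p = ?\<psi> (d1 p)" if p: "p \<in> carrier P1" for p
  proof -
    have "d1 p \<in> mod_ker P0 C e" using p ex0 by blast
    hence x: "d1 p \<in> carrier P0" "e (d1 p) = \<zero>\<^bsub>C\<^esub>" by (simp_all add: mod_ker_def)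
    \<comment> \<open>At x = d1 p the element l(x) lies in \<open>I\<close>, where multiplication by
      \<open>y\<close> agrees with \<open>\<chi>\<close> after \<open>h\<close>; the two summands of
      \<open>?\<psi>\<close> then recombine to \<chi>(x).\<close>
    have lI: "l (d1 p) \<in> I" using \<pi>l[OF x(1)] \<pi>(3)[OF lc[OF x(1)]] x(2) by simp
    have "\<chi> (h (l (d1 p)) \<oplus>\<^bsub>P0\<^esub> (d1 p \<ominus>\<^bsub>P0\<^esub> h (l (d1 p)))) = y \<otimes> l (d1 p) \<oplus> \<chi> (d1 p \<ominus>\<^bsub>P0\<^esub> h (l (d1 p)))"
      using \<chi>_add[OF hc[OF lc[OF x(1)]] hI[OF lI] diff[OF x(1)]] y(2)[OF lI] by simp
    moreover have "h (l (d1 p)) \<oplus>\<^bsub>P0\<^esub> (d1 p \<ominus>\<^bsub>P0\<^esub> h (l (d1 p))) = d1 p"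
      using hc[OF lc[OF x(1)]] x(1)
      by (simp add: P0.M.minus_eq P0.M.a_lcomm[of "h (l (d1 p))" "d1 p"] P0.M.r_neg)
    ultimately show ?thesis using \<chi>[OF p] x(1) by simp
  qed
  thus "\<exists>\<psi>\<in>mod_hom R P0 (regular_module R). \<forall>p\<in>carrier P1. \<xi> p = \<psi> (d1 p)" using \<psi> by blast
qed

text \<open>The composite of \<open>d1\<close>, \<open>l\<close> and \<open>\<phi>\<close> is a
  cocycle. If it is bounded by \<open>\<psi>\<close>, then comparing values at h(u) for u in
  \<open>I\<close> gives w \<phi>(u) = u \<psi>(h(1)) with w = l(h(1)), and dividing by w displays
  \<open>\<phi>\<close> as a multiplication.\<close>

lemma cocycles_bound_extends:
  assumes bound: "cocycles_bound R P2 d2 P1 d1 P0 (regular_module R)"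
    and unit: "\<And>u. u \<in> I \<Longrightarrow> \<one> \<oplus> u \<in> Units R"
  shows "extends R I"
  unfolding extends_def
proof (intro ballI)
  interpret reg: module R "regular_module R" by (rule module_regular)
  interpret C: module R C by (rule C)
  fix \<phi> assume \<phi>: "\<phi> \<in> mod_hom R ((regular_module R)\<lparr>carrier := I\<rparr>) (regular_module R)"
  obtain l h where l: "l \<in> mod_hom R P0 (regular_module R)" and h: "h \<in> mod_hom R (regular_module R) P0"
    and \<pi>l: "\<And>p. p \<in> carrier P0 \<Longrightarrow> \<pi> (l p) = e p" and eh: "\<And>r. r \<in> carrier R \<Longrightarrow> e (h r) = \<pi> r"
    using lifts by blast
  have lc: "l p \<in> carrier R" if "p \<in> carrier P0" for p using mod_hom_closed[OF l that] by simp
  have hc: "h r \<in> carrier P0" if "r \<in> carrier R" for r using mod_hom_closed[OF h] that by simp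
  have d1c: "d1 p \<in> carrier P0" if "p \<in> carrier P1" for p using mod_hom_closed[OF d1 that] .
  have Ic: "u \<in> carrier R" if "u \<in> I" for u using ideal.Icarr[OF I that] .
  have \<phi>c: "\<phi> u \<in> carrier R" if "u \<in> I" for u using mod_hom_closed[OF \<phi>, of u] that by simp
  have ld: "l (d1 p) \<in> I" if p: "p \<in> carrier P1" for p
  proof -
    have "d1 p \<in> mod_ker P0 C e" using p ex0 by blast
    hence "e (d1 p) = \<zero>\<^bsub>C\<^esub>" by (simp add: mod_ker_def)
    thus ?thesis using \<pi>l[OF d1c[OF p]] \<pi>(3)[OF lc[OF d1c[OF p]]] by simp
  qed
  let ?\<xi> = "\<lambda>p\<in>carrier P1. \<phi> (l (d1 p))"
  have \<xi>: "?\<xi> \<in> mod_hom R P1 (regular_module R)"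
  proof (rule mod_homI[OF _ _ _ P1])
    fix p assume p: "p \<in> carrier P1"
    show "\<phi> (l (d1 p)) \<in> carrier (regular_module R)" using \<phi>c[OF ld[OF p]] by simp
    show "\<phi> (l (d1 (p \<oplus>\<^bsub>P1\<^esub> q))) = \<phi> (l (d1 p)) \<oplus>\<^bsub>regular_module R\<^esub> \<phi> (l (d1 q))" if q: "q \<in> carrier P1" for q
      using mod_hom_add[OF d1 p q] mod_hom_add[OF l d1c[OF p] d1c[OF q]]
        mod_hom_add[OF \<phi>, of "l (d1 p)" "l (d1 q)"] ld[OF p] ld[OF q] by simp
    show "\<phi> (l (d1 (r \<odot>\<^bsub>P1\<^esub> p))) = r \<odot>\<^bsub>regular_module R\<^esub> \<phi> (l (d1 p))" if r: "r \<in> carrier R" for r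
      using mod_hom_smult[OF d1 r p] mod_hom_smult[OF l r d1c[OF p]]
        mod_hom_smult[OF \<phi> r, of "l (d1 p)"] ld[OF p] by simp
  qed
  have I0: "\<zero> \<in> I" using I by (simp add: additive_subgroup.zero_closed ideal.axioms(1))
  have subI: "submodule I R (regular_module R)" using I by (simp only: regular_submodule_iff)
  have \<phi>0: "\<phi> \<zero> = \<zero>"
    using mod_hom_zero[OF \<phi> submodule.submodule_is_module[OF subI module_regular] module_regular] by simp
  have "?\<xi> (d2 p) = \<zero>\<^bsub>regular_module R\<^esub>" if p: "p \<in> carrier P2" for p
  proof -
    have "d2 p \<in> mod_ker P1 P0 d1" using p ex1 by blast
    hence "d2 p \<in> carrier P1" "d1 (d2 p) = \<zero>\<^bsub>P0\<^esub>" by (simp_all add: mod_ker_def)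
    thus ?thesis using mod_hom_zero[OF l P0_module module_regular] \<phi>0 by simp
  qed
  then obtain \<psi> where \<psi>: "\<psi> \<in> mod_hom R P0 (regular_module R)" "\<And>p. p \<in> carrier P1 \<Longrightarrow> \<phi> (l (d1 p)) = \<psi> (d1 p)"
    using bound \<xi> unfolding cocycles_bound_def by fastforce
  define w where "w = l (h \<one>)"
  have wc: "w \<in> carrier R" using lc hc by (simp add: w_def)
  have lh: "l (h u) = u \<otimes> w" if "u \<in> carrier R" for u
    using mod_hom_regular[OF h that] mod_hom_smult[OF l that hc[OF one_closed]] by (simp add: w_def)
  \<comment> \<open>\<open>l\<close> and \<open>h\<close> both lie over the identity of
    \<open>C\<close>, so \<open>w\<close> is congruent to 1 modulo \<open>I\<close>; by
    \<open>unit\<close> it is invertible.\<close>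
  have "\<pi> (\<ominus> \<one> \<oplus> w) = \<zero>\<^bsub>C\<^esub>"
  proof -
    have "\<pi> w = \<pi> \<one>" using \<pi>l[OF hc[OF one_closed]] eh[OF one_closed] by (simp add: w_def)
    moreover have "\<ominus> \<one> \<oplus> w \<oplus> \<one> = w" using wc by algebra
    hence "\<pi> (\<ominus> \<one> \<oplus> w) \<oplus>\<^bsub>C\<^esub> \<pi> \<one> = \<pi> w"
      using mod_hom_add[OF \<pi>(1), of "\<ominus> \<one> \<oplus> w" \<one>] wc by simp
    moreover have "\<pi> \<one> \<in> carrier C" "\<pi> (\<ominus> \<one> \<oplus> w) \<in> carrier C" using mod_hom_closed[OF \<pi>(1)] wc by simp_all
    ultimately show ?thesis using C.M.add.r_cancel_one by metis
  qed
  hence "\<ominus> \<one> \<oplus> w \<in> I" using \<pi>(3)[of "\<ominus> \<one> \<oplus> w"] wc by simp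
  hence "\<one> \<oplus> (\<ominus> \<one> \<oplus> w) \<in> Units R" by (rule unit)
  hence "w \<in> Units R" using wc by (simp add: r_neg2)
  then obtain v where v: "v \<in> carrier R" "v \<otimes> w = \<one>" using Units_l_inv_ex by blast
  have "\<phi> u = (v \<otimes> \<psi> (h \<one>)) \<otimes> u" if u: "u \<in> I" for u
  proof -
    have "e (h u) = \<zero>\<^bsub>C\<^esub>" using eh[OF Ic[OF u]] \<pi>(3)[OF Ic[OF u]] u by simp
    hence "h u \<in> mod_ker P0 C e" using hc[OF Ic[OF u]] by (simp add: mod_ker_def)
    then obtain p where p: "p \<in> carrier P1" "h u = d1 p" unfolding ex0[symmetric] by blast
    have "\<phi> (l (h u)) = \<psi> (h u)" using \<psi>(2)[OF p(1)] p(2) by simp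
    moreover have "\<psi> (h u) = u \<otimes> \<psi> (h \<one>)"
      using mod_hom_regular[OF h Ic[OF u]] mod_hom_smult[OF \<psi>(1) Ic[OF u] hc[OF one_closed]] by simp
    moreover have "\<phi> (l (h u)) = w \<otimes> \<phi> u"
      using mod_hom_smult[OF \<phi> wc, of u] u lh[OF Ic[OF u]] m_comm[OF Ic[OF u] wc] by simp
    ultimately have "w \<otimes> \<phi> u = u \<otimes> \<psi> (h \<one>)" by simp
    hence "v \<otimes> (w \<otimes> \<phi> u) = v \<otimes> (u \<otimes> \<psi> (h \<one>))" by simp
    moreover have "\<psi> (h \<one>) \<in> carrier R" using mod_hom_closed[OF \<psi>(1) hc[OF one_closed]] by simp
    ultimately show ?thesis using v wc \<phi>c[OF u] Ic[OF u] by (simp add: m_assoc[symmetric] m_comm m_lcomm)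
  qed
  moreover have "v \<otimes> \<psi> (h \<one>) \<in> carrier R" using mod_hom_closed[OF \<psi>(1) hc[OF one_closed]] v by simp
  ultimately show "\<exists>y\<in>carrier R. \<forall>u\<in>I. \<phi> u = y \<otimes> u" by blast
qed

end

context cring
begin

text \<open>\<open>extensionless\<close> quantifies over all resolutions, so for the forward
  implication one must be exhibited; it is built from free modules, with finitely generated kernels
  thanks to \<open>noeth\<close>. The backward implication treats each resolution through
  \<open>presentation\<close>.\<close>

lemma extensionless_iff_extends:
  fixes C :: "('a, 'c, 'n) module_scheme" and j :: "'c \<Rightarrow> (nat \<Rightarrow> 'a) set"
  assumes noeth: "\<And>I. ideal I R \<Longrightarrow> \<exists>G. finite G \<and> G \<subseteq> I \<and> submodule_gen R (regular_module R) G = I"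
    and I: "ideal I R" and unit: "\<And>u. u \<in> I \<Longrightarrow> \<one> \<oplus> u \<in> Units R" and C: "module R C"
    and \<pi>: "\<pi> \<in> mod_hom R (regular_module R) C" "\<pi> ` carrier R = carrier C"
      "\<And>x. x \<in> carrier R \<Longrightarrow> \<pi> x = \<zero>\<^bsub>C\<^esub> \<longleftrightarrow> x \<in> I"
    and j: "inj_on j (carrier C)"
  shows "extensionless R C \<longleftrightarrow> extends R I"
proof -
  have pres: "presentation R I C \<pi> j P2 d2 P1 d1 P0 e" if "proj_resolution R P2 d2 P1 d1 P0 e C" for P2 d2 P1 d1 P0 e
    using that assms is_cring unfolding proj_resolution_def fg_projective_def
    by (intro presentation.intro presentation_axioms.intro) (auto simp: fg_projective_def)
  have Ext: "trivial_group (Ext1 R P2 d2 P1 d1 P0 (regular_module R)) \<longleftrightarrow>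
      cocycles_bound R P2 d2 P1 d1 P0 (regular_module R)" if res: "proj_resolution R P2 d2 P1 d1 P0 e C" for P2 d2 P1 d1 P0 e
  proof (rule trivial_Ext1_iff)
    show "d1 (d2 p) = \<zero>\<^bsub>P0\<^esub>" if "p \<in> carrier P2" for p
    proof -
      have "d2 p \<in> mod_ker P1 P0 d1" using res that unfolding proj_resolution_def by blast
      thus ?thesis by (simp add: mod_ker_def)
    qed
  qed (use res in \<open>auto simp: proj_resolution_def fg_projective_def module_regular\<close>)
  show ?thesis
  proof
    assume less: "extensionless R C"
    let ?P0 = "free_module R 1" and ?e = "free_hom R C 1 (\<lambda>_. \<pi> \<one>)"
    interpret C: module R C by (rule C)
    have \<pi>1: "\<pi> \<one> \<in> carrier C" using mod_hom_closed[OF \<pi>(1), of \<one>] by simp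
    have e: "?e \<in> mod_hom R ?P0 C" using \<pi>1 by (intro free_hom_mod_hom[OF C])
    have e_apply: "?e {v} = \<pi> (v 0)" if "v \<in> vectors R 1" for v
    proof -
      have "v 0 \<in> carrier R" by (rule vectors_closed[OF that])
      thus ?thesis using free_hom_apply[OF that, of C "\<lambda>_. \<pi> \<one>"] mod_hom_regular[OF \<pi>(1), of "v 0"] \<pi>1 by simp
    qed
    have surj: "?e ` carrier ?P0 = carrier C"
    proof
      show "?e ` carrier ?P0 \<subseteq> carrier C" using mod_hom_closed[OF e] by blast
      show "carrier C \<subseteq> ?e ` carrier ?P0"
      proof
        fix y assume "y \<in> carrier C"
        then obtain r where r: "r \<in> carrier R" "y = \<pi> r" using \<pi>(2) by blast
        let ?v = "\<lambda>i. if i = 0 then r else \<zero>"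
        have v: "?v \<in> vectors R 1" using r by (simp add: vectors_def)
        have "{?v} \<in> carrier ?P0" using v by simp
        moreover have "?e {?v} = y" using e_apply[OF v] r by simp
        ultimately show "y \<in> ?e ` carrier ?P0" by (metis imageI)
      qed
    qed
    have cover: "\<exists>m f. f \<in> mod_hom R (free_module R m) (free_module R n) \<and> f ` carrier (free_module R m) = N"
      if N: "submodule N R (free_module R n)" for n N
    proof -
      interpret F: module R "free_module R n" by (rule free_module_module)
      obtain G where G: "finite G" "G \<subseteq> N" "submodule_gen R (free_module R n) G = N"
        using submodule_free_module_fin_gen[OF noeth N] by blast
      have "G \<subseteq> carrier (free_module R n)" using G(2) F.submoduleE(1)[OF N] by (rule subset_trans)
      from free_cover[OF free_module_module G(1) this] show ?thesis unfolding G(3) by metis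
    qed
    obtain m d1 where d1: "d1 \<in> mod_hom R (free_module R m) ?P0" "d1 ` carrier (free_module R m) = mod_ker ?P0 C ?e"
      using cover[OF mod_ker_submodule[OF e free_module_module C]] by blast
    obtain n d2 where d2: "d2 \<in> mod_hom R (free_module R n) (free_module R m)"
      "d2 ` carrier (free_module R n) = mod_ker (free_module R m) ?P0 d1"
      using cover[OF mod_ker_submodule[OF d1(1) free_module_module free_module_module]] by blast
    have res: "proj_resolution R (free_module R n) d2 (free_module R m) d1 ?P0 ?e C"
      unfolding proj_resolution_def using e surj d1 d2 fg_projective_free_module by blast
    hence "trivial_group (Ext1 R (free_module R n) d2 (free_module R m) d1 ?P0 (regular_module R))"
      using less unfolding extensionless_def by blast
    thus "extends R I"
      using presentation.cocycles_bound_extends[OF pres[OF res] _ unit] Ext[OF res] by blast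
  next
    assume "extends R I"
    thus "extensionless R C"
      unfolding extensionless_def using Ext presentation.extends_cocycles_bound[OF pres] by blast
  qed
qed

text \<open>The terms \<open>P 2\<close>, \<open>P 1\<close>, \<open>P 0\<close> of a totally
  acyclic complex start a resolution of the image of \<open>f 0\<close>, and exactness of the dual
  complex at \<open>P 1\<close> bounds the cocycles.\<close>

lemma gorenstein_projective_extends:
  fixes C :: "('a, 'c, 'n) module_scheme" and j :: "'c \<Rightarrow> (nat \<Rightarrow> 'a) set"
  assumes I: "ideal I R" and unit: "\<And>u. u \<in> I \<Longrightarrow> \<one> \<oplus> u \<in> Units R" and C: "module R C"
    and \<pi>: "\<pi> \<in> mod_hom R (regular_module R) C" "\<pi> ` carrier R = carrier C"
      "\<And>x. x \<in> carrier R \<Longrightarrow> \<pi> x = \<zero>\<^bsub>C\<^esub> \<longleftrightarrow> x \<in> I"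
    and j: "inj_on j (carrier C)"
    and gp: "gorenstein_projective R C"
  shows "extends R I"
proof -
  obtain P :: "int \<Rightarrow> 'a fg_module" and f where P: "\<And>i. fg_projective R (P i)"
    and f: "\<And>i. f i \<in> mod_hom R (P i) (P (i - 1))"
    and ex: "\<And>i. f (i + 1) ` carrier (P (i + 1)) = mod_ker (P i) (P (i - 1)) (f i)"
    and dex: "\<And>i. pullback (P i) (f i) ` carrier (dual_module R (P (i - 1))) =
              mod_ker (dual_module R (P i)) (dual_module R (P (i + 1))) (pullback (P (i + 1)) (f (i + 1)))"
    and iso: "mod_iso R C ((P (- 1))\<lparr>carrier := f 0 ` carrier (P 0)\<rparr>)"
    using gp unfolding gorenstein_projective_def by blast
  have mod: "module R (P i)" for i using P[of i] by (simp add: fg_projective_def)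
  let ?N = "(P (- 1))\<lparr>carrier := f 0 ` carrier (P 0)\<rparr>"
  have f0: "f 0 \<in> mod_hom R (P 0) (P (- 1))" using f[of 0] by simp
  have N: "module R ?N"
    by (rule submodule.submodule_is_module[OF mod_hom_image_submodule[OF f0 mod mod module.carrier_is_submodule[OF mod]] mod])
  obtain t where t: "t \<in> mod_hom R C ?N" "bij_betw t (carrier C) (carrier ?N)" using iso unfolding mod_iso_def by blast
  let ?g = "inv_into (carrier C) t"
  have inj: "inj_on t (carrier C)" and tim: "t ` carrier C = f 0 ` carrier (P 0)"
    using t(2) by (auto simp: bij_betw_def)
  have f0': "f 0 \<in> mod_hom R (P 0) ?N" using f0 by (auto simp: mod_hom_def PiE_def Pi_def)
  \<comment> \<open>The augmentation is \<open>f 0\<close> onto its image, followed by the inverse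
    of the given isomorphism from \<open>C\<close> to that image.\<close>
  define e where "e = compose (carrier (P 0)) (\<lambda>y\<in>carrier ?N. ?g y) (f 0)"
  have e: "e \<in> mod_hom R (P 0) C"
    unfolding e_def by (rule mod_hom_compose[OF f0' mod_iso_inverse[OF t C N] mod])
  have te: "t (e p) = f 0 p" if "p \<in> carrier (P 0)" for p
  proof -
    have "f 0 p \<in> t ` carrier C" using that tim by blast
    thus ?thesis using that f_inv_into_f[of "f 0 p" t "carrier C"] by (simp add: e_def compose_def)
  qed
  have ec: "e p \<in> carrier C" if "p \<in> carrier (P 0)" for p using mod_hom_closed[OF e that] .
  have t0: "t \<zero>\<^bsub>C\<^esub> = \<zero>\<^bsub>P (- 1)\<^esub>" using mod_hom_zero[OF t(1) C N] by simp
  interpret C: module R C by (rule C)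
  have ker: "mod_ker (P 0) C e = mod_ker (P 0) (P (- 1)) (f 0)"
  proof -
    have "e p = \<zero>\<^bsub>C\<^esub> \<longleftrightarrow> f 0 p = \<zero>\<^bsub>P (- 1)\<^esub>" if "p \<in> carrier (P 0)" for p
      using te[OF that] t0 inj_onD[OF inj _ ec[OF that] C.M.zero_closed] by metis
    thus ?thesis unfolding mod_ker_def by blast
  qed
  have surj: "e ` carrier (P 0) = carrier C"
  proof
    show "e ` carrier (P 0) \<subseteq> carrier C" using ec by blast
    show "carrier C \<subseteq> e ` carrier (P 0)"
    proof
      fix y assume y: "y \<in> carrier C"
      hence "t y \<in> f 0 ` carrier (P 0)" using tim by blast
      then obtain p where p: "p \<in> carrier (P 0)" "t y = f 0 p" by blast
      hence "y = e p" using inj_onD[OF inj _ y ec[OF p(1)]] te[OF p(1)] by simp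
      thus "y \<in> e ` carrier (P 0)" using p(1) by blast
    qed
  qed
  have pres: "presentation R I C \<pi> j (P 2) (f 2) (P 1) (f 1) (P 0) e"
    using I C \<pi> j is_cring mod P e surj f[of 2] f[of 1] ex[of 1] ex[of 0] ker
    by (intro presentation.intro presentation_axioms.intro) auto
  have "cocycles_bound R (P 2) (f 2) (P 1) (f 1) (P 0) (regular_module R)"
    using dex[of 1] f[of 1] by (subst cocycles_bound_iff[OF mod]) auto
  thus ?thesis by (rule presentation.cocycles_bound_extends[OF pres _ unit])
qed

end

section \<open>The linear algebra of a special algebra\<close>

lemma quadratic_root:
  fixes K (structure)
  assumes "algebraically_closed K" and "p \<in> carrier K" "q \<in> carrier K"
  obtains l where "l \<in> carrier K" "l \<otimes> l \<oplus> p \<otimes> l \<oplus> q = \<zero>"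
proof -
  interpret algebraically_closed K by fact
  let ?P = "[\<one>, p, q]"
  have P: "?P \<in> carrier (poly_ring K)"
    using assms unfolding univ_poly_carrier[symmetric] polynomial_def by simp
  \<comment> \<open>The list \<open>?P\<close> starts with the leading coefficient, so its degree is
    2, and a split polynomial has as many roots as its degree.\<close>
  have "size (roots ?P) = 2"
    using roots_over_carrier[OF P] by (simp add: splitted_def)
  then obtain l where "l \<in># roots ?P"
    by (metis size_empty multiset_nonemptyE zero_neq_numeral)
  hence "is_root ?P l"
    using roots_mem_iff_is_root[OF P] by simp
  hence l: "l \<in> carrier K" "eval ?P l = \<zero>" by (auto simp: is_root_def)
  have "eval ?P l = l \<otimes> l \<oplus> p \<otimes> l \<oplus> q"
    using l(1) assms by (simp add: numeral_2_eq_2 a_assoc)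
  thus ?thesis using that[OF l(1)] l(2) by simp
qed
locale special_comm_algebra =
  fixes K :: "('k, 'l) ring_scheme" and A :: "('k, 'a, 'm) module_scheme" (structure)
  assumes alg_closed: "algebraically_closed K" and special: "special_algebra K A"
begin

abbreviation "J \<equiv> radical A"
abbreviation "Q \<equiv> rad_pow A 2"
abbreviation "S \<equiv> scalars K A"

lemma short: "short_local_3_2 K A"
  using special by (simp add: special_algebra_def)

lemma algebra: "algebra K A"
  using short by (simp add: short_local_3_2_def)

end

sublocale special_comm_algebra \<subseteq> ac: algebraically_closed K
  by (rule alg_closed)
sublocale special_comm_algebra \<subseteq> cring A
  by (rule algebra.M_cring[OF algebra])
sublocale special_comm_algebra \<subseteq> Alg: algebra K A
  by (rule algebra)

context special_comm_algebra
begin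

section \<open>The maximal ideal, units and the copy of the ground field\<close>

lemma maximal_J: "maximalideal J A" and maximal_unique: "maximalideal I A \<Longrightarrow> I = J"
proof -
  obtain M where I: "maximalideal M A" "\<And>I'. maximalideal I' A \<Longrightarrow> I' = M"
    using short unfolding short_local_3_2_def local_ring_def by blast
  hence "{I. maximalideal I A} = {M}" by blast
  moreover have "M \<subseteq> carrier A"
    using ideal.Icarr[OF maximalideal.axioms(1)[OF I(1)]] by blast
  ultimately have eq: "J = M" by (auto simp: radical_def)
  show "maximalideal J A" unfolding eq by (rule I(1))
  show "I = J" if "maximalideal I A" for I
    unfolding eq by (rule I(2)[OF that])
qed

lemma ideal_J: "ideal J A"
  using maximal_J by (rule maximalideal.axioms(1))

lemma ideal_Q: "ideal Q A"
  by (simp add: numeral_2_eq_2 ideal_prod_is_ideal oneideal ideal_J)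

lemma one_notin_J: "\<one> \<notin> J"
  using ideal.one_imp_carrier[OF ideal_J] maximalideal.I_notcarr[OF maximal_J] by auto

lemma one_neq_zero [simp]: "\<one> \<noteq> \<zero>"
  using one_notin_J additive_subgroup.zero_closed[OF ideal.axioms(1)[OF ideal_J]] by metis

lemma J_carr [simp]: "x \<in> J \<Longrightarrow> x \<in> carrier A"
  by (rule ideal.Icarr[OF ideal_J])

lemma Q_carr [simp]: "x \<in> Q \<Longrightarrow> x \<in> carrier A"
  by (rule ideal.Icarr[OF ideal_Q])

lemma J_mult: assumes "x \<in> J" "y \<in> J" shows "x \<otimes> y \<in> Q"
proof -
  have "\<one> \<otimes> x \<in> carrier A \<cdot> J" using assms by (intro ideal_prod.prod) auto
  hence "x \<in> carrier A \<cdot> J" using assms by simp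
  hence "x \<otimes> y \<in> (carrier A \<cdot> J) \<cdot> J" using assms by (intro ideal_prod.prod)
  thus ?thesis by (simp add: numeral_2_eq_2)
qed

lemma Q_subset_J: "Q \<subseteq> J"
  using ideal_prod_inter[OF ideal_prod_is_ideal[OF oneideal ideal_J] ideal_J]
  by (simp add: numeral_2_eq_2)

lemma Q_J [simp]: "x \<in> Q \<Longrightarrow> x \<in> J"
  using Q_subset_J by auto

lemma QJ_zero: assumes "x \<in> Q" "y \<in> J" shows "x \<otimes> y = \<zero>"
proof -
  have "ideal_prod A Q J = {\<zero>}"
    using short by (simp add: short_local_3_2_def numeral_3_eq_3 numeral_2_eq_2)
  thus ?thesis using ideal_prod.prod[OF assms, of A] by simp
qed

lemma JQ_zero: "x \<in> J \<Longrightarrow> y \<in> Q \<Longrightarrow> x \<otimes> y = \<zero>"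
  using QJ_zero[of y x] m_comm[of x y] by simp

lemma unit_one_minus: assumes "x \<in> J" shows "\<one> \<ominus> x \<in> Units A"
proof -
  have x: "x \<in> carrier A" using assms by simp
  have "x \<otimes> x \<otimes> x = \<zero>" using QJ_zero[OF J_mult[OF assms assms] assms] .
  \<comment> \<open>The geometric series stops after the square because the cube of the radical is
    zero.\<close>
  hence "(\<one> \<oplus> x \<oplus> x \<otimes> x) \<otimes> (\<one> \<ominus> x) = \<one>" using x by algebra
  moreover have "(\<one> \<ominus> x) \<otimes> (\<one> \<oplus> x \<oplus> x \<otimes> x) = \<one>" using x calculation by algebra
  ultimately show ?thesis using x by (auto simp: Units_def intro!: bexI[of _ "\<one> \<oplus> x \<oplus> x \<otimes> x"])
qed

text \<open>\<open>J\<close> together with \<open>x\<close> generates more than the maximal ideal,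
  so 1 = j + y x with j in \<open>J\<close>; then x y = 1 - j is a unit, and so is its factor
  \<open>x\<close>.\<close>

lemma not_J_unit: assumes "x \<in> carrier A" "x \<notin> J" shows "x \<in> Units A"
proof -
  let ?I = "J <+>\<^bsub>A\<^esub> PIdl x"
  have zero: "\<zero> \<in> J" "\<zero> \<in> PIdl x" "x \<in> PIdl x"
    using assms(1) ideal_J cgenideal_ideal cgenideal_self
    by (simp_all add: additive_subgroup.zero_closed ideal.axioms(1))
  have I: "ideal ?I A" using assms by (intro add_ideals ideal_J cgenideal_ideal)
  have mem: "u \<oplus> v \<in> ?I" if "u \<in> J" "v \<in> PIdl x" for u v
    using that unfolding set_add_def' by blast
  have "J \<subseteq> ?I"
  proof
    fix j assume "j \<in> J" thus "j \<in> ?I" using mem[of j "\<zero>"] zero by simp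
  qed
  moreover have "?I \<subseteq> carrier A" by (meson I ideal.Icarr subsetI)
  moreover have "?I \<noteq> J" using mem[of "\<zero>" x] zero assms by auto
  ultimately have "?I = carrier A"
    using maximalideal.I_maximal[OF maximal_J I] by simp
  hence "\<one> \<in> ?I" by simp
  then obtain j y where j: "j \<in> J" "y \<in> carrier A" "\<one> = j \<oplus> y \<otimes> x"
    unfolding set_add_def' cgenideal_def by blast
  have "x \<otimes> y = \<one> \<ominus> j" using assms(1) J_carr[OF j(1)] j(2) unfolding j(3) by algebra
  hence "x \<otimes> y \<in> Units A" using unit_one_minus[OF j(1)] by simp
  thus ?thesis using unit_factor assms j by blast
qed

lemma unit_not_J: "x \<in> Units A \<Longrightarrow> x \<notin> J"
  using Units_l_inv_ex[of x] ideal.I_l_closed[OF ideal_J, of x] one_notin_J by metis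

text \<open>A unit kills only zero. This places annihilating elements in \<open>J\<close> and,
  together with \<open>S_Int_J\<close>, shows that a scalar killing a nonzero element is
  zero.\<close>

lemma ann_notin_J: assumes "x \<in> carrier A" "y \<in> carrier A" "x \<otimes> y = \<zero>" "y \<noteq> \<zero>" shows "x \<in> J"
proof (rule ccontr)
  assume "x \<notin> J"
  hence "x \<in> Units A" by (rule not_J_unit[OF assms(1)])
  hence "x \<otimes> y = x \<otimes> \<zero> \<longleftrightarrow> y = \<zero>" using assms by (intro Units_l_cancel) auto
  thus False using assms by simp
qed

lemma ideal_proper_J: "ideal I A \<Longrightarrow> I \<noteq> carrier A \<Longrightarrow> I \<subseteq> J"
proof
  fix x assume I: "ideal I A" "I \<noteq> carrier A" "x \<in> I"
  show "x \<in> J"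
  proof (rule ccontr)
    assume "x \<notin> J"
    hence "x \<in> Units A" using not_J_unit I by (simp add: ideal.Icarr)
    hence "\<one> \<in> I" by (metis I(1,3) Units_l_inv_ex ideal.I_l_closed)
    thus False using I ideal.one_imp_carrier by blast
  qed
qed

lemma hom_scalars: "ring_hom_ring K A (\<lambda>c. c \<odot>\<^bsub>A\<^esub> \<one>)"
proof (rule ring_hom_ringI2)
  show "(\<lambda>c. c \<odot>\<^bsub>A\<^esub> \<one>) \<in> ring_hom K A"
    by (rule ring_hom_memI)
       (simp_all add: Alg.smult_l_distr Alg.smult_assoc1 Alg.smult_assoc2)
qed (auto intro: ac.ring_axioms ring_axioms)

lemma subfield_S: "subfield S A"
  using ring_hom_ring.img_is_subfield(2)[OF hom_scalars ac.carrier_is_subfield one_neq_zero]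
  unfolding scalars_def .

lemma S_carr [simp]: "x \<in> S \<Longrightarrow> x \<in> carrier A"
  using subfieldE(3)[OF subfield_S] by auto

lemmas S_props [simp] = subring_props[OF subfield_S]

lemma S_inv: assumes "x \<in> S" "x \<noteq> \<zero>" shows "inv x \<in> S" "inv x \<otimes> x = \<one>" "x \<otimes> inv x = \<one>"
  using subfield_m_inv[OF subfield_S, of x] assms by simp_all

lemma S_unit: "x \<in> S \<Longrightarrow> x \<noteq> \<zero> \<Longrightarrow> x \<in> Units A"
  using S_inv[of x] S_carr[of x] S_carr[of "inv x"] unfolding Units_def by blast

lemma S_Int_J: "x \<in> S \<Longrightarrow> x \<in> J \<Longrightarrow> x = \<zero>"
  using S_unit unit_not_J by blast

lemma S_quadratic:
  assumes "p \<in> S" "q \<in> S"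
  obtains l where "l \<in> S" "l \<otimes> l \<oplus> p \<otimes> l \<oplus> q = \<zero>"
proof -
  interpret h: ring_hom_ring K A "\<lambda>c. c \<odot>\<^bsub>A\<^esub> \<one>" by (rule hom_scalars)
  obtain p' q' where p: "p' \<in> carrier K" "p = p' \<odot>\<^bsub>A\<^esub> \<one>" and q: "q' \<in> carrier K" "q = q' \<odot>\<^bsub>A\<^esub> \<one>"
    using assms by (auto simp: scalars_def)
  obtain l where l: "l \<in> carrier K" "l \<otimes>\<^bsub>K\<^esub> l \<oplus>\<^bsub>K\<^esub> p' \<otimes>\<^bsub>K\<^esub> l \<oplus>\<^bsub>K\<^esub> q' = \<zero>\<^bsub>K\<^esub>"
    using quadratic_root[OF alg_closed p(1) q(1)] .
  define m where "m = l \<odot>\<^bsub>A\<^esub> \<one>"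
  have "m \<otimes> m \<oplus> p \<otimes> m \<oplus> q = (l \<otimes>\<^bsub>K\<^esub> l \<oplus>\<^bsub>K\<^esub> p' \<otimes>\<^bsub>K\<^esub> l \<oplus>\<^bsub>K\<^esub> q') \<odot>\<^bsub>A\<^esub> \<one>"
    using p q l(1) by (simp only: m_def h.hom_add h.hom_mult ac.add.m_closed ac.m_closed)
  also have "\<dots> = \<zero>" using l(2) h.hom_zero by simp
  finally show ?thesis using that l(1) by (auto simp: m_def scalars_def)
qed

text \<open>\<open>LE x E\<close> is the subspace kx + E. For x in \<open>J\<close>,
  \<open>LE x Q\<close> is the ideal U(x), and nested extensions describe subspaces between
  \<open>Q\<close> and \<open>J\<close> by explicit coefficients.\<close>

abbreviation "LE \<equiv> line_extension S"
abbreviation "ann x \<equiv> {y \<in> carrier A. x \<otimes> y = \<zero>}"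

lemma LE_iff: "u \<in> LE x E \<longleftrightarrow> (\<exists>k\<in>S. \<exists>v\<in>E. u = k \<otimes> x \<oplus> v)"
  by (rule line_extension_mem_iff)

lemma Q_zero [simp]: "\<zero> \<in> Q" and J_zero [simp]: "\<zero> \<in> J"
  using ideal_Q ideal_J by (simp_all add: additive_subgroup.zero_closed ideal.axioms(1))

lemma Q_add [simp]: "x \<in> Q \<Longrightarrow> y \<in> Q \<Longrightarrow> x \<oplus> y \<in> Q"
  and J_add [simp]: "x \<in> J \<Longrightarrow> y \<in> J \<Longrightarrow> x \<oplus> y \<in> J"
  using ideal_Q ideal_J by (simp_all add: additive_subgroup.a_closed ideal.axioms(1))

lemma Q_neg [simp]: "x \<in> Q \<Longrightarrow> \<ominus> x \<in> Q"
  and J_neg [simp]: "x \<in> J \<Longrightarrow> \<ominus> x \<in> J"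
  using ideal_Q ideal_J by (simp_all add: additive_subgroup.a_inv_closed ideal.axioms(1))

lemma Q_minus [simp]: "x \<in> Q \<Longrightarrow> y \<in> Q \<Longrightarrow> x \<ominus> y \<in> Q"
  and J_minus [simp]: "x \<in> J \<Longrightarrow> y \<in> J \<Longrightarrow> x \<ominus> y \<in> J"
  by (simp_all add: a_minus_def)

lemma Q_smult [simp]: "r \<in> carrier A \<Longrightarrow> x \<in> Q \<Longrightarrow> r \<otimes> x \<in> Q" "r \<in> carrier A \<Longrightarrow> x \<in> Q \<Longrightarrow> x \<otimes> r \<in> Q"
  and J_smult [simp]: "r \<in> carrier A \<Longrightarrow> x \<in> J \<Longrightarrow> r \<otimes> x \<in> J" "r \<in> carrier A \<Longrightarrow> x \<in> J \<Longrightarrow> x \<otimes> r \<in> J"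
  using ideal_Q ideal_J by (simp_all add: ideal.I_l_closed ideal.I_r_closed)

lemma S_minus [simp]: "x \<in> S \<Longrightarrow> y \<in> S \<Longrightarrow> x \<ominus> y \<in> S"
  by (simp add: a_minus_def)

section \<open>Dimensions over the ground field, and bases of Q and J\<close>

lemma dim_mono: assumes "dimension n S E" "dimension m S F" "E \<subseteq> F" shows "n \<le> m"
proof -
  obtain Vs where "set Vs \<subseteq> carrier A" "independent S Vs" "length Vs = n" "Span S Vs = E"
    using exists_base[OF subfield_S assms(1)] by blast
  thus ?thesis
    using independent_length_le_dimension[OF subfield_S assms(2), of Vs]
      Span_base_incl[OF subfield_S, of Vs] assms(3) by auto
qed

lemma dim_eq: assumes "dimension n S E" "dimension n S F" "E \<subseteq> F" shows "E = F"
proof -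
  obtain Vs where "set Vs \<subseteq> carrier A" "independent S Vs" "length Vs = n" "Span S Vs = E"
    using exists_base[OF subfield_S assms(1)] by blast
  thus ?thesis
    using independent_length_eq_dimension[OF subfield_S assms(2), of Vs]
      Span_base_incl[OF subfield_S, of Vs] assms(3) by auto
qed

lemma dim_pick:
  assumes "dimension n S E" "dimension m S F" "m < n" obtains v where "v \<in> E" "v \<notin> F"
  using dim_mono[OF assms(1,2)] assms(3) by fastforce

lemma dim_LE: "dimension n S E \<Longrightarrow> x \<in> carrier A \<Longrightarrow> x \<notin> E \<Longrightarrow> dimension (Suc n) S (LE x E)"
  by (rule Suc_dim)

lemma dim_Q: "dimension 2 S Q"
  using short by (simp add: short_local_3_2_def)

text \<open>Rank-nullity for the residue map modulo \<open>Q\<close> restricted to \<open>J\<close>: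
  kernel of dimension 2, image of dimension 3.\<close>

lemma dim_J: "dimension 5 S J"
proof -
  let ?h = "(+>) Q"
  interpret h: ring_hom_ring A "A Quot Q" ?h by (rule ideal.rcos_ring_hom_ring[OF ideal_Q])
  have QJ: "?h x = Q \<longleftrightarrow> x \<in> Q" if "x \<in> carrier A" for x
    using that a_coset_join1[of Q x] a_coset_join2[of x Q] 
      additive_subgroup.a_subgroup[OF ideal.axioms(1)[OF ideal_Q]] by auto
  have ker: "a_kernel (A\<lparr>carrier := J\<rparr>) (A Quot Q) ?h = Q"
  proof (rule Set.set_eqI)
    fix x show "x \<in> a_kernel (A\<lparr>carrier := J\<rparr>) (A Quot Q) ?h \<longleftrightarrow> x \<in> Q"
      using QJ[of x] J_carr[of x] Q_J[of x] unfolding a_kernel_def' FactRing_def by force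
  qed
  have one: "\<one>\<^bsub>A Quot Q\<^esub> \<noteq> \<zero>\<^bsub>A Quot Q\<^esub>"
  proof -
    have "\<one> \<notin> Q" using one_notin_J Q_J[of \<one>] by blast
    hence "Q +> \<one> \<noteq> Q" using QJ[of \<one>] one_closed by blast
    thus ?thesis unfolding FactRing_def by simp
  qed
  have "finite_dimension S (carrier A)"
    using short by (simp add: short_local_3_2_def)
  moreover have "J \<subseteq> carrier A" by auto
  ultimately have "finite_dimension S J"
    using subalbegra_incl_imp_finite_dimension[OF subfield_S _ ideal_is_subalgebra[OF _ ideal_J]]
      subfieldE(3)[OF subfield_S] by blast
  then obtain n where n: "dimension n S J" unfolding finite_dimension_def by blast
  have "h.S.dimension (n - 2) (?h ` S) (?h ` J)"
    using h.rank_nullity_theorem[OF subfield_S one n, of 2] dim_Q by (simp add: ker)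
  moreover have "h.S.dimension 3 (?h ` S) (?h ` J)"
    using short by (simp add: short_local_3_2_def)
  ultimately have "n - 2 = 3"
    using h.S.dimension_is_inj[OF h.img_is_subfield(2)[OF subfield_S one]] by blast
  \<comment> \<open>Subtraction of naturals is harmless here: the difference is 3, hence not
    truncated.\<close>
  hence "n = 5" by simp
  thus ?thesis using n by simp
qed

lemma LE_zero_iff: "x \<in> carrier A \<Longrightarrow> u \<in> LE x {\<zero>} \<longleftrightarrow> (\<exists>k\<in>S. u = k \<otimes> x)"
  by (auto simp: LE_iff)

lemma span_Q:
  assumes "s \<in> Q" "s \<noteq> \<zero>" "t \<in> Q" "t \<notin> LE s {\<zero>}" "q \<in> Q"
  obtains k l where "k \<in> S" "l \<in> S" "q = k \<otimes> t \<oplus> l \<otimes> s"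
proof -
  have "dimension 2 S (LE t (LE s {\<zero>}))"
    using dim_LE[OF dim_LE[OF zero_dim], of s t] assms by (simp add: numeral_2_eq_2)
  moreover have "LE t (LE s {\<zero>}) \<subseteq> Q"
    using assms by (auto simp: LE_iff)
  ultimately have "Q = LE t (LE s {\<zero>})"
    using dim_eq[OF _ dim_Q] by blast
  hence "q \<in> LE t (LE s {\<zero>})" using assms(5) by blast
  then obtain k l where "k \<in> S" "l \<in> S" "q = k \<otimes> t \<oplus> (l \<otimes> s \<oplus> \<zero>)"
    unfolding LE_iff Bex_def by blast
  thus ?thesis using that[of k l] assms(1) by simp
qed

lemma indep_Q:
  assumes "s \<in> Q" "s \<noteq> \<zero>" "t \<in> Q" "t \<notin> LE s {\<zero>}" "k \<in> S" "l \<in> S" "k \<otimes> t \<oplus> l \<otimes> s = \<zero>"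
  shows "k = \<zero>" "l = \<zero>"
proof -
  have c: "s \<in> carrier A" "t \<in> carrier A" "k \<in> carrier A" "l \<in> carrier A" using assms by auto
  show k: "k = \<zero>"
  proof (rule ccontr)
    assume nz: "k \<noteq> \<zero>"
    have "k \<otimes> t = \<ominus> l \<otimes> s" using assms(7) c
      by (metis l_minus m_closed minus_equality minus_minus)
    hence "inv k \<otimes> (k \<otimes> t) = inv k \<otimes> (\<ominus> l \<otimes> s)" by simp
    hence "t = (inv k \<otimes> \<ominus> l) \<otimes> s"
      using S_inv[OF assms(5) nz] c by (simp add: m_assoc[symmetric] del: S_props)
    moreover have "inv k \<otimes> \<ominus> l \<in> S" using S_inv[OF assms(5) nz] assms by simp
    ultimately show False using assms(4) LE_zero_iff[OF c(1)] by blast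
  qed
  show "l = \<zero>"
  proof (rule S_Int_J[OF assms(6)])
    have "l \<otimes> s = \<zero>" using assms(7) c by (simp add: k)
    thus "l \<in> J" using ann_notin_J[OF c(4,1)] assms(2) by blast
  qed
qed

lemma Q_basis:
  obtains s t where "s \<in> Q" "s \<noteq> \<zero>" "t \<in> Q" "t \<notin> LE s {\<zero>}"
proof -
  obtain s where s: "s \<in> Q" "s \<notin> {\<zero>}"
    using dim_pick[OF dim_Q zero_dim] by auto
  obtain t where "t \<in> Q" "t \<notin> LE s {\<zero>}"
    using dim_pick[OF dim_Q dim_LE[OF zero_dim _ s(2)]] s by auto
  thus ?thesis using that s by blast
qed

text \<open>An eigenvector of \<open>x\<close> on the two-dimensional space \<open>Q\<close> shows that \<open>x - l\<close> is not a unit.\<close>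

lemma eigenvalue:
  assumes x: "x \<in> carrier A" obtains l j where "l \<in> S" "j \<in> J" "x = l \<oplus> j"
proof -
  obtain s t where st: "s \<in> Q" "s \<noteq> \<zero>" "t \<in> Q" "t \<notin> LE s {\<zero>}" by (rule Q_basis)
  obtain q p where qp: "q \<in> S" "p \<in> S" "x \<otimes> s = q \<otimes> t \<oplus> p \<otimes> s"
    using span_Q[OF st, of "x \<otimes> s"] st x by auto
  obtain v u where uv: "v \<in> S" "u \<in> S" "x \<otimes> t = v \<otimes> t \<oplus> u \<otimes> s"
    using span_Q[OF st, of "x \<otimes> t"] st x by auto
  \<comment> \<open>The quadratic is the characteristic polynomial of multiplication by
    \<open>x\<close> on \<open>Q\<close> in the basis t, s: trace p + v, determinant p v - q u. The
    second root is \<open>m\<close>, and the computation below is the Cayley-Hamilton identity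
    applied to \<open>s\<close>.\<close>
  obtain l where l: "l \<in> S" "l \<otimes> l \<oplus> \<ominus> (p \<oplus> v) \<otimes> l \<oplus> (p \<otimes> v \<ominus> q \<otimes> u) = \<zero>"
    using S_quadratic[of "\<ominus> (p \<oplus> v)" "p \<otimes> v \<ominus> q \<otimes> u"] qp uv by auto
  define m where "m = p \<oplus> v \<ominus> l"
  have m: "m \<in> S" using l qp uv by (simp add: m_def)
  have c: "s \<in> carrier A" "t \<in> carrier A" "p \<in> carrier A" "q \<in> carrier A" "u \<in> carrier A"
    "v \<in> carrier A" "l \<in> carrier A"
    using st qp uv l by auto
  have "(x \<ominus> l) \<otimes> (x \<ominus> m) \<otimes> s = x \<otimes> (x \<otimes> s) \<ominus> (p \<oplus> v) \<otimes> (x \<otimes> s) \<oplus> (p \<otimes> v \<ominus> q \<otimes> u) \<otimes> s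
      \<ominus> (l \<otimes> l \<oplus> \<ominus> (p \<oplus> v) \<otimes> l \<oplus> (p \<otimes> v \<ominus> q \<otimes> u)) \<otimes> s"
    unfolding m_def using c x by algebra
  also have "\<dots> = x \<otimes> (x \<otimes> s) \<ominus> (p \<oplus> v) \<otimes> (x \<otimes> s) \<oplus> (p \<otimes> v \<ominus> q \<otimes> u) \<otimes> s"
    unfolding l(2) using c x by algebra
  also have "\<dots> = x \<otimes> (q \<otimes> t \<oplus> p \<otimes> s) \<ominus> (p \<oplus> v) \<otimes> (q \<otimes> t \<oplus> p \<otimes> s) \<oplus> (p \<otimes> v \<ominus> q \<otimes> u) \<otimes> s"
    unfolding qp(3) ..
  also have "\<dots> = q \<otimes> (x \<otimes> t) \<oplus> p \<otimes> (x \<otimes> s) \<ominus> (p \<oplus> v) \<otimes> (q \<otimes> t \<oplus> p \<otimes> s) \<oplus> (p \<otimes> v \<ominus> q \<otimes> u) \<otimes> s"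
    using c x by algebra
  also have "\<dots> = \<zero>" unfolding qp(3) uv(3) using c by algebra
  finally have z: "(x \<ominus> l) \<otimes> (x \<ominus> m) \<otimes> s = \<zero>" .
  have cm: "x \<ominus> l \<in> carrier A" "x \<ominus> m \<in> carrier A" using c m x by auto
  \<comment> \<open>Either x - m kills the nonzero \<open>s\<close>, or x - l kills the nonzero
    product (x - m) s; whichever kills a nonzero element lies in \<open>J\<close>.\<close>
  have "x \<ominus> l \<in> J \<or> x \<ominus> m \<in> J"
  proof (cases "(x \<ominus> m) \<otimes> s = \<zero>")
    case True thus ?thesis using ann_notin_J[OF cm(2) c(1)] st(2) by simp
  next
    case False thus ?thesis
      using ann_notin_J[OF cm(1), of "(x \<ominus> m) \<otimes> s"] z cm c(1) by (simp add: m_assoc)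
  qed
  moreover have "x = y \<oplus> (x \<ominus> y)" if "y \<in> S" for y using that x S_carr[OF that] by algebra
  ultimately show ?thesis using that l(1) m by blast
qed

text \<open>If \<open>J\<close> kills a nonzero \<open>x\<close>, each nonzero multiple r x has r
  outside \<open>J\<close>, so r is a unit and r x generates the same ideal. Thus the principal
  ideal of \<open>x\<close> is simple and lies in the socle, which is \<open>Q\<close> in a special
  algebra.\<close>

lemma socle_Q: assumes x: "x \<in> carrier A" and ann: "\<And>j. j \<in> J \<Longrightarrow> j \<otimes> x = \<zero>" shows "x \<in> Q"
proof (cases "x = \<zero>")
  case False
  interpret reg: module A "regular_module A" by (rule module_regular)
  let ?N = "PIdl x" and ?M = "regular_module A"
  have N: "submodule ?N A ?M" using cgenideal_ideal[OF x] by (simp add: regular_submodule_iff)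
  have "simple_module A (?M\<lparr>carrier := ?N\<rparr>)"
    unfolding simple_module_def
  proof (intro conjI allI impI)
    show "module A (?M\<lparr>carrier := ?N\<rparr>)" by (rule submodule.submodule_is_module[OF N module_regular])
    show "carrier (?M\<lparr>carrier := ?N\<rparr>) \<noteq> {\<zero>\<^bsub>?M\<lparr>carrier := ?N\<rparr>\<^esub>}"
      using cgenideal_self[OF x] False by auto
    fix L assume "submodule L A (?M\<lparr>carrier := ?N\<rparr>)"
    hence L: "ideal L A" "L \<subseteq> ?N"
      using reg.submodule_carrier_update[OF N] by (auto simp: regular_submodule_iff)
    have "L = ?N" if "y \<in> L" "y \<noteq> \<zero>" for y
    proof -
      have "y \<in> PIdl x" using L(2) that(1) by (rule subsetD)
      then obtain r where r: "r \<in> carrier A" "y = r \<otimes> x" unfolding cgenideal_def by blast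
      hence "r \<notin> J" using ann[of r] that(2) by metis
      hence "r \<in> Units A" using not_J_unit r by simp
      then obtain u where u: "u \<in> carrier A" "u \<otimes> r = \<one>" using Units_l_inv_ex by blast
      have "u \<otimes> y = x" using u r x by (simp add: m_assoc[symmetric])
      hence "x \<in> L" using ideal.I_l_closed[OF L(1) that(1) u(1)] by simp
      thus ?thesis using cgenideal_minimal[OF L(1)] L(2) by blast
    qed
    moreover have "\<zero> \<in> L" using L(1) by (simp add: additive_subgroup.zero_closed ideal.axioms(1))
    ultimately show "L = {\<zero>\<^bsub>?M\<lparr>carrier := ?N\<rparr>\<^esub>} \<or> L = carrier (?M\<lparr>carrier := ?N\<rparr>)" by auto
  qed
  hence "?N \<subseteq> socle A ?M"
    unfolding socle_def using N by (intro order_trans[OF _ submodule_gen_incl]) auto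
  moreover have "Q = socle A ?M" using special by (simp add: special_algebra_def)
  ultimately show ?thesis using cgenideal_self[OF x] by auto
qed simp

lemma span_J:
  assumes "x \<in> J" "x \<notin> Q" "y \<in> J" "y \<notin> LE x Q" "z \<in> J" "z \<notin> LE y (LE x Q)" "w \<in> J"
  obtains k l m q where "k \<in> S" "l \<in> S" "m \<in> S" "q \<in> Q" "w = k \<otimes> z \<oplus> l \<otimes> y \<oplus> m \<otimes> x \<oplus> q"
proof -
  have "dimension 5 S (LE z (LE y (LE x Q)))"
    using dim_LE[OF dim_LE[OF dim_LE[OF dim_Q]], of x y z] assms
    by (simp add: numeral_eq_Suc)
  moreover have "LE z (LE y (LE x Q)) \<subseteq> J"
    using assms by (auto simp: LE_iff)
  ultimately have "w \<in> LE z (LE y (LE x Q))"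
    using dim_eq[OF _ dim_J] assms(7) by blast
  then obtain k l m q where "k \<in> S" "l \<in> S" "m \<in> S" "q \<in> Q" "w = k \<otimes> z \<oplus> (l \<otimes> y \<oplus> (m \<otimes> x \<oplus> q))"
    unfolding LE_iff Bex_def by blast
  thus ?thesis using that[of k l m q] assms by (simp add: a_assoc)
qed

text \<open>Membership in a bar, expressed by elements: \<open>y\<close> witnesses that the bar is
  not faithful, and \<open>z\<close> completes U(x) to a space of dimension 4.\<close>

definition linked :: "'a \<Rightarrow> bool" where
  "linked x \<longleftrightarrow> (\<exists>y\<in>J. y \<notin> Q \<and> x \<otimes> y = \<zero> \<and> (\<exists>z\<in>J. z \<notin> LE x Q \<and> y \<otimes> z = \<zero>))"

lemma nonzero_mult:
  assumes "x \<in> J" "x \<notin> Q" obtains y where "y \<in> J" "x \<otimes> y \<noteq> \<zero>"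
proof -
  have "\<exists>y\<in>J. y \<otimes> x \<noteq> \<zero>" using socle_Q[OF J_carr[OF assms(1)]] assms(2) by blast
  then obtain y where "y \<in> J" "y \<otimes> x \<noteq> \<zero>" by blast
  thus ?thesis using that[of y] assms m_comm[of x y] by simp
qed

lemma not_Q_nonzero: "x \<notin> Q \<Longrightarrow> x \<noteq> \<zero>"
  using Q_zero by blast

lemma ann_J: assumes "x \<in> J" "x \<notin> Q" "y \<in> ann x" shows "y \<in> J"
  using ann_notin_J[of y x] assms not_Q_nonzero[of x] m_comm[of x y] by simp

lemma LE_in_J: "x \<in> J \<Longrightarrow> E \<subseteq> J \<Longrightarrow> LE x E \<subseteq> J"
proof
  fix u assume *: "x \<in> J" "E \<subseteq> J" "u \<in> LE x E"
  then obtain k v where "k \<in> S" "v \<in> E" "u = k \<otimes> x \<oplus> v" unfolding LE_iff by blast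
  thus "u \<in> J" using * by (simp add: subset_iff)
qed

lemma LE_self: "x \<in> J \<Longrightarrow> E \<subseteq> J \<Longrightarrow> \<zero> \<in> E \<Longrightarrow> x \<in> LE x E"
  unfolding LE_iff by (intro bexI[of _ \<one>] bexI[of _ \<zero>]) auto

lemma LE_incl: "x \<in> J \<Longrightarrow> E \<subseteq> J \<Longrightarrow> E \<subseteq> LE x E"
proof
  fix v assume "x \<in> J" "E \<subseteq> J" "v \<in> E"
  thus "v \<in> LE x E" unfolding LE_iff by (intro bexI[of _ \<zero>] bexI[of _ v]) auto
qed

lemma LE_QE: assumes "u \<in> LE x Q" obtains k q where "k \<in> S" "q \<in> Q" "u = k \<otimes> x \<oplus> q"
  using assms unfolding LE_iff by blast

lemma LE_QI: "k \<in> S \<Longrightarrow> q \<in> Q \<Longrightarrow> u = k \<otimes> x \<oplus> q \<Longrightarrow> u \<in> LE x Q"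
  unfolding LE_iff by blast

lemma LE2_QE: assumes "u \<in> LE y (LE x Q)" "x \<in> J" "y \<in> J"
  obtains k l q where "k \<in> S" "l \<in> S" "q \<in> Q" "u = k \<otimes> y \<oplus> l \<otimes> x \<oplus> q"
proof -
  obtain k l q where "k \<in> S" "l \<in> S" "q \<in> Q" "u = k \<otimes> y \<oplus> (l \<otimes> x \<oplus> q)"
    using assms unfolding LE_iff Bex_def by blast
  thus ?thesis using that[of k l q] assms by (simp add: a_assoc)
qed

lemma LE2_QI:
  assumes "k \<in> S" "l \<in> S" "q \<in> Q" "x \<in> J" "y \<in> J" "u = k \<otimes> y \<oplus> l \<otimes> x \<oplus> q"
  shows "u \<in> LE y (LE x Q)"
proof -
  have "u = k \<otimes> y \<oplus> (l \<otimes> x \<oplus> q)" using assms by (simp add: a_assoc)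
  moreover have "l \<otimes> x \<oplus> q \<in> LE x Q" using assms(2,3) unfolding LE_iff by blast
  ultimately show ?thesis using assms(1) unfolding LE_iff[of u] by blast
qed

section \<open>Annihilators of elements of J outside Q\<close>

lemma ann_LE: assumes "x \<in> J" "x \<notin> Q" "y \<in> J" "x \<otimes> y = \<zero>" shows "LE y Q \<subseteq> ann x"
proof
  fix u assume "u \<in> LE y Q"
  then obtain k q where u: "k \<in> S" "q \<in> Q" "u = k \<otimes> y \<oplus> q" by (rule LE_QE)
  have c: "k \<in> carrier A" "q \<in> carrier A" "x \<in> carrier A" "y \<in> carrier A" using u assms by auto
  have "x \<otimes> u = k \<otimes> (x \<otimes> y) \<oplus> x \<otimes> q" unfolding u(3) using c by algebra
  also have "\<dots> = \<zero>" using JQ_zero[OF assms(1) u(2)] assms(4) c by simp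
  finally show "u \<in> ann x" using c u(3) by simp
qed

text \<open>Multiplication by \<open>a\<close> induces a map from the three-dimensional J/Q onto the
  two-dimensional \<open>Q\<close>; its kernel is a line, spanned by \<open>b\<close>.\<close>

lemma mult_onto:
  assumes a: "a \<in> J" "a \<notin> Q" and onto: "\<And>q. q \<in> Q \<Longrightarrow> \<exists>j\<in>J. a \<otimes> j = q"
  obtains b where "b \<in> J" "b \<notin> Q" "ann a = LE b Q"
proof -
  have ca: "a \<in> carrier A" using a by simp
  obtain s t where st: "s \<in> Q" "s \<noteq> \<zero>" "t \<in> Q" "t \<notin> LE s {\<zero>}" by (rule Q_basis)
  obtain x where x: "x \<in> J" "a \<otimes> x = s" using onto st(1) by blast
  obtain y where y: "y \<in> J" "a \<otimes> y = t" using onto st(3) by blast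
  have c: "x \<in> carrier A" "y \<in> carrier A" "s \<in> carrier A" "t \<in> carrier A" using x y st by auto
  have xQ: "x \<notin> Q" using JQ_zero[OF a(1), of x] x(2) st(2) by metis
  have yQ: "y \<notin> LE x Q"
  proof
    assume "y \<in> LE x Q"
    then obtain k q where k: "k \<in> S" "q \<in> Q" "y = k \<otimes> x \<oplus> q" by (rule LE_QE)
    have ck: "k \<in> carrier A" "q \<in> carrier A" using k by auto
    have "a \<otimes> y = k \<otimes> (a \<otimes> x) \<oplus> a \<otimes> q" unfolding k(3) using ca c ck by algebra
    hence "t = k \<otimes> s" using JQ_zero[OF a(1) k(2)] x(2) y(2) ck c by simp
    thus False using st(4) k(1) LE_zero_iff[OF c(3)] by blast
  qed
  have d4: "dimension 4 S (LE y (LE x Q))"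
    using dim_LE[OF dim_LE[OF dim_Q c(1) xQ] c(2) yQ] by (simp add: numeral_eq_Suc)
  obtain z where z: "z \<in> J" "z \<notin> LE y (LE x Q)" using dim_pick[OF dim_J d4] by auto
  have cz: "z \<in> carrier A" using z by simp
  obtain p r where pr: "p \<in> S" "r \<in> S" "a \<otimes> z = p \<otimes> t \<oplus> r \<otimes> s"
    using span_Q[OF st J_mult[OF a(1) z(1)]] .
  have cpr: "p \<in> carrier A" "r \<in> carrier A" using pr by auto
  \<comment> \<open>\<open>z\<close> completes the lifts x, y of the basis s, t to a basis of J/Q;
    subtracting the combination of x and y with the same product makes the product with
    \<open>a\<close> vanish.\<close>
  define b where "b = z \<ominus> p \<otimes> y \<ominus> r \<otimes> x"
  have bJ: "b \<in> J" unfolding b_def using z x y cpr by simp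
  have "a \<otimes> b = a \<otimes> z \<ominus> p \<otimes> (a \<otimes> y) \<ominus> r \<otimes> (a \<otimes> x)"
    unfolding b_def using ca c cz cpr by algebra
  also have "\<dots> = \<zero>" unfolding pr(3) x(2) y(2) using c cpr by algebra
  finally have ab: "a \<otimes> b = \<zero>" .
  have cb: "b \<in> carrier A" using bJ by simp
  have zb: "z = p \<otimes> y \<oplus> r \<otimes> x \<oplus> b" unfolding b_def using c cz cpr by algebra
  have bQ: "b \<notin> Q"
    using LE2_QI[OF pr(1,2) _ x(1) y(1) zb] z(2) by blast
  have "ann a \<subseteq> LE b Q"
  proof
    fix w assume w: "w \<in> ann a"
    hence wJ: "w \<in> J" by (rule ann_J[OF a])
    obtain k l m q where k: "k \<in> S" "l \<in> S" "m \<in> S" "q \<in> Q" "w = k \<otimes> z \<oplus> l \<otimes> y \<oplus> m \<otimes> x \<oplus> q"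
      using span_J[OF x(1) xQ y(1) yQ z wJ] .
    have ck: "k \<in> carrier A" "l \<in> carrier A" "m \<in> carrier A" "q \<in> carrier A" using k by auto
    have w2: "w = k \<otimes> b \<oplus> (l \<oplus> k \<otimes> p) \<otimes> y \<oplus> (m \<oplus> k \<otimes> r) \<otimes> x \<oplus> q"
      unfolding k(5) b_def using c cz cpr ck by algebra
    have "a \<otimes> w = k \<otimes> (a \<otimes> b) \<oplus> (l \<oplus> k \<otimes> p) \<otimes> (a \<otimes> y) \<oplus> (m \<oplus> k \<otimes> r) \<otimes> (a \<otimes> x) \<oplus> a \<otimes> q"
      unfolding w2 using ca c cb cpr ck by algebra
    also have "\<dots> = (l \<oplus> k \<otimes> p) \<otimes> t \<oplus> (m \<oplus> k \<otimes> r) \<otimes> s"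
      using JQ_zero[OF a(1) k(4)] c cb cpr ck by (simp add: ab x(2) y(2))
    finally have "(l \<oplus> k \<otimes> p) \<otimes> t \<oplus> (m \<oplus> k \<otimes> r) \<otimes> s = \<zero>" using w by simp
    hence "l \<oplus> k \<otimes> p = \<zero>" "m \<oplus> k \<otimes> r = \<zero>"
      using indep_Q[OF st, of "l \<oplus> k \<otimes> p" "m \<oplus> k \<otimes> r"] k pr by simp_all
    hence "w = k \<otimes> b \<oplus> q" unfolding w2 using c cb ck by simp
    thus "w \<in> LE b Q" by (rule LE_QI[OF k(1,4)])
  qed
  thus ?thesis using that[OF bJ bQ] ann_LE[OF a bJ ab] by blast
qed

text \<open>As \<open>a\<close> lies outside the socle, aJ is nonzero; being smaller than
  \<open>Q\<close>, it is a line, spanned by \<open>s\<close>. The kernel of the induced map from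
  J/Q to \<open>Q\<close> then has dimension 2, with basis b, c.\<close>

lemma mult_not_onto:
  assumes a: "a \<in> J" "a \<notin> Q" and nonto: "\<not> (\<forall>q\<in>Q. \<exists>j\<in>J. a \<otimes> j = q)"
  obtains s b c where "s \<in> Q" "\<And>j. j \<in> J \<Longrightarrow> \<exists>k\<in>S. a \<otimes> j = k \<otimes> s" "b \<in> J" "b \<notin> Q" "c \<in> J" "c \<notin> LE b Q"
    "ann a = LE c (LE b Q)"
proof -
  have ca: "a \<in> carrier A" using a by simp
  obtain x where x: "x \<in> J" "a \<otimes> x \<noteq> \<zero>" using nonzero_mult[OF a] .
  define s where "s = a \<otimes> x"
  have s: "s \<in> Q" "s \<noteq> \<zero>" using J_mult[OF a(1) x(1)] x(2) by (auto simp: s_def)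
  have cx: "x \<in> carrier A" "s \<in> carrier A" using x s by auto
  have multiples: "\<exists>k\<in>S. a \<otimes> j = k \<otimes> s" if j: "j \<in> J" for j
  proof (rule ccontr)
    assume "\<not> (\<exists>k\<in>S. a \<otimes> j = k \<otimes> s)"
    hence nj: "a \<otimes> j \<notin> LE s {\<zero>}" using LE_zero_iff[OF cx(2)] by blast
    \<comment> \<open>A product off the line of \<open>s\<close> forms with \<open>s\<close> a basis
      of \<open>Q\<close>, so every element of \<open>Q\<close> becomes a product with
      \<open>a\<close>.\<close>
    have "\<exists>i\<in>J. a \<otimes> i = q" if q: "q \<in> Q" for q
    proof -
      obtain k l where k: "k \<in> S" "l \<in> S" "q = k \<otimes> (a \<otimes> j) \<oplus> l \<otimes> s"
        using span_Q[OF s J_mult[OF a(1) j] nj q] .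
      have "a \<otimes> (k \<otimes> j \<oplus> l \<otimes> x) = q"
        unfolding k(3) s_def using ca cx S_carr[OF k(1)] S_carr[OF k(2)] J_carr[OF j] by algebra
      moreover have "k \<otimes> j \<oplus> l \<otimes> x \<in> J" using k j x by simp
      ultimately show ?thesis by blast
    qed
    thus False using nonto by blast
  qed
  have xQ: "x \<notin> Q" using JQ_zero[OF a(1), of x] x(2) by metis
  have d3: "dimension 3 S (LE x Q)"
    using dim_LE[OF dim_Q cx(1) xQ] by (simp add: numeral_eq_Suc)
  obtain y where y: "y \<in> J" "y \<notin> LE x Q" using dim_pick[OF dim_J d3] by auto
  have cy: "y \<in> carrier A" using y by simp
  have d4: "dimension 4 S (LE y (LE x Q))"
    using dim_LE[OF d3 cy y(2)] by (simp add: numeral_eq_Suc)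
  obtain z where z: "z \<in> J" "z \<notin> LE y (LE x Q)" using dim_pick[OF dim_J d4] by auto
  have cz: "z \<in> carrier A" using z by simp
  obtain p where p: "p \<in> S" "a \<otimes> y = p \<otimes> s" using multiples[OF y(1)] by blast
  obtain r where r: "r \<in> S" "a \<otimes> z = r \<otimes> s" using multiples[OF z(1)] by blast
  have cpr: "p \<in> carrier A" "r \<in> carrier A" using p r by auto
  \<comment> \<open>\<open>y\<close> and \<open>z\<close> complete \<open>x\<close> to a basis of
    J/Q; multiples of \<open>x\<close> are removed so that \<open>a\<close> kills the
    results.\<close>
  define b where "b = y \<ominus> p \<otimes> x"
  define c where "c = z \<ominus> r \<otimes> x"
  have bc: "b \<in> J" "c \<in> J" using x y z cpr by (simp_all add: b_def c_def)
  have cbc: "b \<in> carrier A" "c \<in> carrier A" using bc by simp_all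
  have "a \<otimes> b = a \<otimes> y \<ominus> p \<otimes> (a \<otimes> x)" unfolding b_def using ca cx cy cpr by algebra
  hence ab: "a \<otimes> b = \<zero>" unfolding p(2) s_def[symmetric] using cx cpr by (simp add: minus_eq r_neg)
  have "a \<otimes> c = a \<otimes> z \<ominus> r \<otimes> (a \<otimes> x)" unfolding c_def using ca cx cz cpr by algebra
  hence ac: "a \<otimes> c = \<zero>" unfolding r(2) s_def[symmetric] using cx cpr by (simp add: minus_eq r_neg)
  have yb: "y = p \<otimes> x \<oplus> b" unfolding b_def using cx cy cpr by algebra
  have bQ: "b \<notin> Q" using LE_QI[OF p(1) _ yb] y(2) by blast
  have cQ: "c \<notin> LE b Q"
  proof
    assume "c \<in> LE b Q"
    then obtain k q where k: "k \<in> S" "q \<in> Q" "c = k \<otimes> b \<oplus> q" by (rule LE_QE)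
    have "z = c \<oplus> r \<otimes> x" unfolding c_def using cx cz cpr by algebra
    hence "z = k \<otimes> y \<oplus> (r \<ominus> k \<otimes> p) \<otimes> x \<oplus> q"
      unfolding k(3) b_def using cx cy cpr S_carr[OF k(1)] Q_carr[OF k(2)] by algebra
    hence "z \<in> LE y (LE x Q)" by (intro LE2_QI[OF k(1) _ k(2) x(1) y(1)]) (use k p r in auto)
    thus False using z(2) by blast
  qed
  have "ann a = LE c (LE b Q)"
  proof
    show "ann a \<subseteq> LE c (LE b Q)"
    proof
      fix w assume w: "w \<in> ann a"
      hence wJ: "w \<in> J" by (rule ann_J[OF a])
      obtain k l m q where k: "k \<in> S" "l \<in> S" "m \<in> S" "q \<in> Q" "w = k \<otimes> z \<oplus> l \<otimes> y \<oplus> m \<otimes> x \<oplus> q"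
        using span_J[OF x(1) xQ y z wJ] .
      have ck: "k \<in> carrier A" "l \<in> carrier A" "m \<in> carrier A" "q \<in> carrier A" using k by auto
      have w2: "w = k \<otimes> c \<oplus> l \<otimes> b \<oplus> (m \<oplus> k \<otimes> r \<oplus> l \<otimes> p) \<otimes> x \<oplus> q"
        unfolding k(5) b_def c_def using cx cy cz cpr ck by algebra
      have "a \<otimes> w = k \<otimes> (a \<otimes> c) \<oplus> l \<otimes> (a \<otimes> b) \<oplus> (m \<oplus> k \<otimes> r \<oplus> l \<otimes> p) \<otimes> (a \<otimes> x) \<oplus> a \<otimes> q"
        unfolding w2 using ca cx cbc cpr ck by algebra
      also have "\<dots> = (m \<oplus> k \<otimes> r \<oplus> l \<otimes> p) \<otimes> s"
        using JQ_zero[OF a(1) k(4)] cx cbc cpr ck by (simp add: ab ac s_def[symmetric])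
      finally have "(m \<oplus> k \<otimes> r \<oplus> l \<otimes> p) \<otimes> s = \<zero>" using w by simp
      hence "m \<oplus> k \<otimes> r \<oplus> l \<otimes> p \<in> J" using ann_notin_J[OF _ cx(2) _ s(2)] ck cpr by simp
      moreover have "m \<oplus> k \<otimes> r \<oplus> l \<otimes> p \<in> S" using k p r by simp
      ultimately have "m \<oplus> k \<otimes> r \<oplus> l \<otimes> p = \<zero>" using S_Int_J by blast
      hence "w = k \<otimes> c \<oplus> l \<otimes> b \<oplus> q" unfolding w2 using cx cbc ck by simp
      thus "w \<in> LE c (LE b Q)" by (rule LE2_QI[OF k(1,2,4) bc])
    qed
    show "LE c (LE b Q) \<subseteq> ann a"
    proof
      fix w assume "w \<in> LE c (LE b Q)"
      then obtain k l q where k: "k \<in> S" "l \<in> S" "q \<in> Q" "w = k \<otimes> c \<oplus> l \<otimes> b \<oplus> q"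
        using LE2_QE[OF _ bc] by blast
      have ck: "k \<in> carrier A" "l \<in> carrier A" "q \<in> carrier A" using k by auto
      have "a \<otimes> w = k \<otimes> (a \<otimes> c) \<oplus> l \<otimes> (a \<otimes> b) \<oplus> a \<otimes> q"
        unfolding k(4) using ca cbc ck by algebra
      also have "\<dots> = \<zero>" using JQ_zero[OF a(1) k(3)] ck by (simp add: ab ac)
      finally show "w \<in> ann a" using k(4) ck cbc by simp
    qed
  qed
  thus ?thesis using that[OF s(1) multiples bc(1) bQ bc(2) cQ] by blast
qed

lemma dim_LE2:
  assumes "b \<in> J" "b \<notin> Q" "c \<in> J" "c \<notin> LE b Q"
  shows "dimension 3 S (LE b Q)" "dimension 4 S (LE c (LE b Q))"
  using dim_LE[OF dim_Q _ assms(2)] dim_LE[OF dim_LE[OF dim_Q _ assms(2)] _ assms(4)] assms(1,3)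
  by (simp_all add: numeral_eq_Suc)

text \<open>If \<open>a\<close> squares to zero, \<open>a\<close> itself is the annihilating
  element, because ann(a) has dimension 4 and thus exceeds U(a). Otherwise two elements u, v of
  ann(a) outside \<open>Q\<close> with u v = 0 suffice: as a a is nonzero, a v = 0 would force a v
  from U(a) into \<open>Q\<close>.\<close>

lemma not_onto_linked:
  assumes a: "a \<in> J" "a \<notin> Q" and b: "b \<in> J" "b \<notin> Q" and c: "c \<in> J" "c \<notin> LE b Q"
    and ann: "ann a = LE c (LE b Q)"
  shows "linked a"
proof -
  have car: "a \<in> carrier A" "b \<in> carrier A" "c \<in> carrier A" using a b c by auto
  have sub: "LE b Q \<subseteq> J" using LE_in_J[OF b(1) Q_subset_J] .
  have "c \<in> ann a" "b \<in> ann a"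
    unfolding ann using LE_self[OF c(1) sub] LE_incl[OF c(1) sub] LE_self[OF b(1) Q_subset_J]
      LE_incl[OF b(1) Q_subset_J] Q_zero by blast+
  hence ab: "a \<otimes> b = \<zero>" and ac: "a \<otimes> c = \<zero>" by auto
  show ?thesis
  proof (cases "a \<otimes> a = \<zero>")
    case True
    have "dimension 3 S (LE a Q)" using dim_LE[OF dim_Q car(1) a(2)] by (simp add: numeral_eq_Suc)
    then obtain z where "z \<in> ann a" "z \<notin> LE a Q"
      using dim_pick[of 4 "ann a" 3 "LE a Q"] dim_LE2(2)[OF b c] ann by auto
    thus ?thesis using True a ann_J[OF a, of z] unfolding linked_def by blast
  next
    case False
    have link: "linked a" if u: "u \<in> J" "u \<notin> Q" "a \<otimes> u = \<zero>" and v: "v \<in> J" "v \<notin> Q" "a \<otimes> v = \<zero>"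
      and uv: "u \<otimes> v = \<zero>" for u v
    proof -
      have "v \<notin> LE a Q"
      proof
        assume "v \<in> LE a Q"
        then obtain k q where k: "k \<in> S" "q \<in> Q" "v = k \<otimes> a \<oplus> q" by (rule LE_QE)
        have ck: "k \<in> carrier A" "q \<in> carrier A" using k by auto
        have "a \<otimes> v = k \<otimes> (a \<otimes> a) \<oplus> a \<otimes> q" unfolding k(3) using car ck by algebra
        hence "k \<otimes> (a \<otimes> a) = \<zero>" using v(3) JQ_zero[OF a(1) k(2)] ck car by simp
        hence "k \<in> J" using ann_notin_J[OF ck(1) _ _ False] car by simp
        hence "k = \<zero>" using S_Int_J k(1) by blast
        hence "v = q" using k(3) ck car by simp
        thus False using v(2) k(2) by simp
      qed
      thus ?thesis using u v uv unfolding linked_def by blast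
    qed
    have shift: "c \<ominus> k \<otimes> b \<in> J \<and> c \<ominus> k \<otimes> b \<notin> Q \<and> a \<otimes> (c \<ominus> k \<otimes> b) = \<zero>" if k: "k \<in> S" for k
    proof (intro conjI)
      have ck: "k \<in> carrier A" using k by simp
      show "c \<ominus> k \<otimes> b \<in> J" using b c ck by simp
      have "c = k \<otimes> b \<oplus> (c \<ominus> k \<otimes> b)" using car ck by algebra
      thus "c \<ominus> k \<otimes> b \<notin> Q" using LE_QI[OF k] c(2) by blast
      have "a \<otimes> (c \<ominus> k \<otimes> b) = a \<otimes> c \<ominus> k \<otimes> (a \<otimes> b)" using car ck by algebra
      thus "a \<otimes> (c \<ominus> k \<otimes> b) = \<zero>" using ck by (simp add: ab ac minus_eq)
    qed
    have bb: "b \<otimes> b \<in> Q" "b \<otimes> c \<in> Q" "c \<otimes> c \<in> Q" using J_mult b c by auto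
    \<comment> \<open>In the first two cases a product vanishes after at most a shift of
      \<open>c\<close> by a multiple of \<open>b\<close>; in the last, b b and b c form a basis of
      \<open>Q\<close>, in which c c is expressed.\<close>
    consider "b \<otimes> b = \<zero>" | "b \<otimes> b \<noteq> \<zero>" "b \<otimes> c \<in> LE (b \<otimes> b) {\<zero>}"
      | "b \<otimes> b \<noteq> \<zero>" "b \<otimes> c \<notin> LE (b \<otimes> b) {\<zero>}" by blast
    thus ?thesis
    proof cases
      case 1 thus ?thesis using link[OF b ab b ab] by blast
    next
      case 2
      then obtain k where k: "k \<in> S" "b \<otimes> c = k \<otimes> (b \<otimes> b)"
        using LE_zero_iff[of "b \<otimes> b"] car by blast
      have "b \<otimes> (c \<ominus> k \<otimes> b) = b \<otimes> c \<ominus> k \<otimes> (b \<otimes> b)" using car S_carr[OF k(1)] by algebra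
      hence "b \<otimes> (c \<ominus> k \<otimes> b) = \<zero>" using car k by (simp add: minus_eq r_neg)
      thus ?thesis using link[OF b ab, of "c \<ominus> k \<otimes> b"] shift[OF k(1)] by blast
    next
      case 3
      obtain k l where k: "k \<in> S" "l \<in> S" "c \<otimes> c = k \<otimes> (b \<otimes> c) \<oplus> l \<otimes> (b \<otimes> b)"
        using span_Q[OF bb(1) 3(1) bb(2) 3(2) bb(3)] .
      have "\<ominus> k \<in> S" "\<ominus> l \<in> S" using k by auto
      \<comment> \<open>\<open>t\<close> and k - t are the two roots of T^2 - k T - l, so c c - k b
        c - l b b factors as below.\<close>
      then obtain t where t: "t \<in> S" "t \<otimes> t \<oplus> \<ominus> k \<otimes> t \<oplus> \<ominus> l = \<zero>" by (rule S_quadratic)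
      have ck: "k \<in> carrier A" "l \<in> carrier A" "t \<in> carrier A" using k t by auto
      have "(c \<ominus> t \<otimes> b) \<otimes> (c \<ominus> (k \<ominus> t) \<otimes> b) = c \<otimes> c \<ominus> k \<otimes> (b \<otimes> c) \<ominus> l \<otimes> (b \<otimes> b)
          \<ominus> (t \<otimes> t \<oplus> \<ominus> k \<otimes> t \<oplus> \<ominus> l) \<otimes> (b \<otimes> b)"
        using car ck by algebra
      also have "\<dots> = \<zero>" unfolding k(3) t(2) using car ck by algebra
      finally have "(c \<ominus> t \<otimes> b) \<otimes> (c \<ominus> (k \<ominus> t) \<otimes> b) = \<zero>" .
      thus ?thesis
        using link[of "c \<ominus> t \<otimes> b" "c \<ominus> (k \<ominus> t) \<otimes> b"] shift[OF t(1)] shift[of "k \<ominus> t"] k t by auto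
    qed
  qed
qed

text \<open>Multiplication by \<open>a\<close> is onto \<open>Q\<close>, as its failure would make
  \<open>a\<close> linked. For \<open>b\<close>, unlinkedness says directly that ann(b) lies in
  U(a); its dimension is thus at most 3, while it would be 4 if multiplication by \<open>b\<close>
  missed part of \<open>Q\<close>.\<close>

lemma not_linked_pair:
  assumes a: "a \<in> J" "a \<notin> Q" and nl: "\<not> linked a"
  obtains b where "b \<in> J" "b \<notin> Q" "ann a = LE b Q" "ann b = LE a Q"
    "\<And>q. q \<in> Q \<Longrightarrow> \<exists>j\<in>J. a \<otimes> j = q" "\<And>q. q \<in> Q \<Longrightarrow> \<exists>j\<in>J. b \<otimes> j = q"
proof -
  have onto_a: "\<forall>q\<in>Q. \<exists>j\<in>J. a \<otimes> j = q"
  proof (rule ccontr)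
    assume "\<not> (\<forall>q\<in>Q. \<exists>j\<in>J. a \<otimes> j = q)"
    thus False
    proof (rule mult_not_onto[OF a])
      fix b c assume "b \<in> J" "b \<notin> Q" "c \<in> J" "c \<notin> LE b Q" "ann a = LE c (LE b Q)"
      hence "linked a" by (rule not_onto_linked[OF a])
      thus False using nl by simp
    qed
  qed
  obtain b where b: "b \<in> J" "b \<notin> Q" "ann a = LE b Q" using mult_onto[OF a] onto_a by blast
  have "b \<in> ann a" unfolding b(3) using LE_self[OF b(1) Q_subset_J] by simp
  hence ab: "a \<otimes> b = \<zero>" by simp
  have ba: "b \<otimes> a = \<zero>" using ab a(1) b(1) m_comm[of a b] by simp
  have sub: "ann b \<subseteq> LE a Q"
    using nl ann_J[OF b(1,2)] b(1,2) ab unfolding linked_def by blast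
  have eq: "ann b = LE a Q" using sub ann_LE[OF b(1,2) a(1) ba] by blast
  have d3: "dimension 3 S (LE a Q)" using dim_LE[OF dim_Q _ a(2)] a(1) by (simp add: numeral_eq_Suc)
  have onto_b: "\<forall>q\<in>Q. \<exists>j\<in>J. b \<otimes> j = q"
  proof (rule ccontr)
    assume "\<not> (\<forall>q\<in>Q. \<exists>j\<in>J. b \<otimes> j = q)"
    thus False
    proof (rule mult_not_onto[OF b(1,2)])
      fix u v assume *: "u \<in> J" "u \<notin> Q" "v \<in> J" "v \<notin> LE u Q" and ann: "ann b = LE v (LE u Q)"
      have "dimension 4 S (ann b)" unfolding ann using dim_LE2(2)[OF *] .
      from dim_mono[OF this d3 sub] show False by simp
    qed
  qed
  show ?thesis using that[OF b eq] onto_a onto_b by blast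
qed

text \<open>The split is by whether aJ = Q. The failures of extension, locality and reflexivity are
  all computed in these two normal forms.\<close>

lemma linked_cases:
  assumes a: "a \<in> J" "a \<notin> Q" and l: "linked a"
  obtains (onto) b s d where "b \<in> J" "b \<notin> Q" "ann a = LE b Q" "\<And>q. q \<in> Q \<Longrightarrow> \<exists>j\<in>J. a \<otimes> j = q"
      "s \<in> Q" "\<And>j. j \<in> J \<Longrightarrow> \<exists>k\<in>S. b \<otimes> j = k \<otimes> s" "d \<in> J" "d \<notin> LE a Q" "b \<otimes> d = \<zero>"
  | (not_onto) s b c where "s \<in> Q" "\<And>j. j \<in> J \<Longrightarrow> \<exists>k\<in>S. a \<otimes> j = k \<otimes> s"
      "b \<in> J" "b \<notin> Q" "c \<in> J" "c \<notin> LE b Q" "ann a = LE c (LE b Q)"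
proof (cases "\<forall>q\<in>Q. \<exists>j\<in>J. a \<otimes> j = q")
  case False
  show ?thesis by (rule mult_not_onto[OF a False]) (rule not_onto)
next
  case True
  obtain b where b: "b \<in> J" "b \<notin> Q" "ann a = LE b Q" using mult_onto[OF a] True by blast
  obtain u d where u: "u \<in> J" "u \<notin> Q" "a \<otimes> u = \<zero>" and d: "d \<in> J" "d \<notin> LE a Q" "u \<otimes> d = \<zero>"
    using l unfolding linked_def by blast
  \<comment> \<open>The annihilating element \<open>u\<close> may be replaced by \<open>b\<close>:
    it is a nonzero scalar multiple of \<open>b\<close> plus an element of \<open>Q\<close>, and
    \<open>Q\<close> kills \<open>d\<close>.\<close>
  have "u \<in> LE b Q" unfolding b(3)[symmetric] using u by simp
  then obtain k q where k: "k \<in> S" "q \<in> Q" "u = k \<otimes> b \<oplus> q" by (rule LE_QE)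
  have cc: "k \<in> carrier A" "q \<in> carrier A" "b \<in> carrier A" "d \<in> carrier A" using k b d by auto
  have k0: "k \<noteq> \<zero>" using k u(2) cc by auto
  have "u \<otimes> d = k \<otimes> (b \<otimes> d) \<oplus> q \<otimes> d" unfolding k(3) using cc by algebra
  hence "k \<otimes> (b \<otimes> d) = \<zero>" using d(3) QJ_zero[OF k(2) d(1)] cc by simp
  hence bd: "b \<otimes> d = \<zero>"
    using ann_notin_J[OF cc(1), of "b \<otimes> d"] S_Int_J[OF k(1)] k0 cc by blast
  have "b \<in> ann a" unfolding b(3) using LE_self[OF b(1) Q_subset_J] by simp
  hence "a \<otimes> b = \<zero>" by simp
  hence ba: "b \<otimes> a = \<zero>" using a(1) b(1) m_comm[of a b] by simp
  \<comment> \<open>Otherwise ann(b) would have dimension 3 and equal U(a), but it contains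
    \<open>d\<close>.\<close>
  have "\<not> (\<forall>q\<in>Q. \<exists>j\<in>J. b \<otimes> j = q)"
  proof
    assume "\<forall>q\<in>Q. \<exists>j\<in>J. b \<otimes> j = q"
    then obtain e where e: "e \<in> J" "e \<notin> Q" "ann b = LE e Q" using mult_onto[OF b(1,2)] by blast
    have "dimension 3 S (ann b)" unfolding e(3) using dim_LE[OF dim_Q _ e(2)] e(1) by (simp add: numeral_eq_Suc)
    moreover have "dimension 3 S (LE a Q)" using dim_LE[OF dim_Q _ a(2)] a(1) by (simp add: numeral_eq_Suc)
    ultimately have "LE a Q = ann b" using dim_eq[OF _ _ ann_LE[OF b(1,2) a(1) ba]] by blast
    moreover have "d \<in> ann b" using bd d by simp
    ultimately show False using d(2) by blast
  qed
  thus ?thesis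
  proof (rule mult_not_onto[OF b(1,2)])
    fix s assume s: "s \<in> Q" "\<And>j. j \<in> J \<Longrightarrow> \<exists>k\<in>S. b \<otimes> j = k \<otimes> s"
    show ?thesis
    proof (rule onto[OF b _ s d(1,2) bd])
      show "\<And>q. q \<in> Q \<Longrightarrow> \<exists>j\<in>J. a \<otimes> j = q" using True by blast
    qed
  qed
qed

end

section \<open>Bars\<close>

lemma set_addI:
  fixes R (structure) shows "x \<in> X1 \<Longrightarrow> y \<in> X2 \<Longrightarrow> x \<oplus> y \<in> X1 <+>\<^bsub>R\<^esub> X2"
  unfolding set_add_def' by blast

lemma set_addE:
  fixes R (structure)
  assumes "u \<in> X1 <+>\<^bsub>R\<^esub> X2" obtains x y where "x \<in> X1" "y \<in> X2" "u = x \<oplus> y"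
  using assms unfolding set_add_def' by blast

context special_comm_algebra
begin

text \<open>Because A = k + J by \<open>eigenvalue\<close>, a multiple r x is a scalar multiple of
  \<open>x\<close> up to an element of \<open>Q\<close>.\<close>

lemma U_ideal_eq: assumes x: "x \<in> J" shows "U_ideal A x = LE x Q"
proof
  have cx: "x \<in> carrier A" using x by simp
  show "U_ideal A x \<subseteq> LE x Q"
  proof
    fix u assume "u \<in> U_ideal A x"
    then obtain r q where r: "r \<in> carrier A" "q \<in> Q" "u = r \<otimes> x \<oplus> q"
      unfolding U_ideal_def cgenideal_def by (auto elim: set_addE)
    obtain l j where l: "l \<in> S" "j \<in> J" "r = l \<oplus> j" using eigenvalue[OF r(1)] .
    have "u = l \<otimes> x \<oplus> (j \<otimes> x \<oplus> q)"
      unfolding r(3) l(3) using cx S_carr[OF l(1)] J_carr[OF l(2)] Q_carr[OF r(2)] by algebra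
    moreover have "j \<otimes> x \<oplus> q \<in> Q" using J_mult[OF l(2) x] r(2) by simp
    ultimately show "u \<in> LE x Q" using LE_QI[OF l(1)] by blast
  qed
  show "LE x Q \<subseteq> U_ideal A x"
  proof
    fix u assume "u \<in> LE x Q"
    then obtain k q where "k \<in> S" "q \<in> Q" "u = k \<otimes> x \<oplus> q" by (rule LE_QE)
    moreover have "k \<otimes> x \<in> PIdl x" using S_carr[OF calculation(1)] unfolding cgenideal_def by blast
    ultimately show "u \<in> U_ideal A x" unfolding U_ideal_def by (auto intro: set_addI)
  qed
qed

lemma ideal_LE: assumes x: "x \<in> J" shows "ideal (LE x Q) A"
  unfolding U_ideal_eq[OF x, symmetric] U_ideal_def
  by (intro add_ideals cgenideal_ideal ideal_Q) (use x in simp)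

lemma ideal_LE2: assumes x: "x \<in> J" and y: "y \<in> J" shows "ideal (LE y (LE x Q)) A"
proof -
  have cx: "x \<in> carrier A" "y \<in> carrier A" using x y by auto
  have eq: "LE y (LE x Q) = LE y Q <+>\<^bsub>A\<^esub> LE x Q"
  proof
    show "LE y (LE x Q) \<subseteq> LE y Q <+>\<^bsub>A\<^esub> LE x Q"
    proof
      fix u assume "u \<in> LE y (LE x Q)"
      then obtain k v where u: "k \<in> S" "v \<in> LE x Q" "u = k \<otimes> y \<oplus> v"
        unfolding LE_iff[of u y] by blast
      have "k \<otimes> y = k \<otimes> y \<oplus> \<zero>" using S_carr[OF u(1)] cx by simp
      hence "k \<otimes> y \<in> LE y Q" by (rule LE_QI[OF u(1) Q_zero])
      thus "u \<in> LE y Q <+>\<^bsub>A\<^esub> LE x Q" using u(2) unfolding u(3) by (rule set_addI)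
    qed
    show "LE y Q <+>\<^bsub>A\<^esub> LE x Q \<subseteq> LE y (LE x Q)"
    proof
      fix u assume "u \<in> LE y Q <+>\<^bsub>A\<^esub> LE x Q"
      then obtain v w where v: "v \<in> LE y Q" "w \<in> LE x Q" "u = v \<oplus> w" by (rule set_addE)
      obtain k q where k: "k \<in> S" "q \<in> Q" "v = k \<otimes> y \<oplus> q" using v(1) by (rule LE_QE)
      obtain l p where l: "l \<in> S" "p \<in> Q" "w = l \<otimes> x \<oplus> p" using v(2) by (rule LE_QE)
      show "u \<in> LE y (LE x Q)"
      proof (rule LE2_QI[OF k(1) l(1) _ x y])
        show "q \<oplus> p \<in> Q" using k l by simp
        show "u = k \<otimes> y \<oplus> l \<otimes> x \<oplus> (q \<oplus> p)"
          unfolding v(3) k(3) l(3)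
          using cx S_carr[OF k(1)] S_carr[OF l(1)] Q_carr[OF k(2)] Q_carr[OF l(2)] by algebra
      qed
    qed
  qed
  show ?thesis unfolding eq by (rule add_ideals[OF ideal_LE[OF y] ideal_LE[OF x]])
qed

text \<open>When xJ is all of \<open>Q\<close>, the summand \<open>Q\<close> is absorbed by the
  principal ideal.\<close>

lemma LE_U: "x \<in> J \<Longrightarrow> \<forall>q\<in>Q. \<exists>j\<in>J. x \<otimes> j = q \<Longrightarrow> LE x Q = PIdl x"
proof
  assume x: "x \<in> J" and onto: "\<forall>q\<in>Q. \<exists>j\<in>J. x \<otimes> j = q"
  have cx: "x \<in> carrier A" using x by simp
  show "PIdl x \<subseteq> LE x Q"
    by (rule cgenideal_minimal[OF ideal_LE[OF x] LE_self[OF x Q_subset_J Q_zero]])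
  show "LE x Q \<subseteq> PIdl x"
  proof
    fix u assume "u \<in> LE x Q"
    then obtain k q where k: "k \<in> S" "q \<in> Q" "u = k \<otimes> x \<oplus> q" by (rule LE_QE)
    obtain j where j: "j \<in> J" "x \<otimes> j = q" using onto k by blast
    have "u = (k \<oplus> j) \<otimes> x" unfolding k(3) j(2)[symmetric]
      using cx S_carr[OF k(1)] J_carr[OF j(1)] by algebra
    moreover have "k \<oplus> j \<in> carrier A" using k j by simp
    ultimately show "u \<in> PIdl x" unfolding cgenideal_def by blast
  qed
qed

lemma complement_not_Q:
  assumes "complement_in_radical K A E" "a \<in> E" "a \<noteq> \<zero>" shows "a \<in> J" "a \<notin> Q"
proof -
  have E: "submodule E K A" "E \<inter> Q = {\<zero>}" "E <+>\<^bsub>A\<^esub> Q = J"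
    using assms(1) by (auto simp: complement_in_radical_def)
  show "a \<notin> Q" using E(2) assms by blast
  have "a \<in> carrier A" using Alg.submoduleE(1)[OF E(1)] assms(2) by blast
  hence "a = a \<oplus> \<zero>" by simp
  hence "a \<in> E <+>\<^bsub>A\<^esub> Q" using set_addI[OF assms(2) Q_zero, of A] by simp
  thus "a \<in> J" using E(3) by simp
qed

text \<open>The action of a coset is \<open>the_elem\<close> of an image. For arguments in
  \<open>J\<close> that image is a singleton, as \<open>Q\<close> kills \<open>J\<close>; hence the
  coset of \<open>r\<close> acts as \<open>r\<close>.\<close>

lemma not_faithful_iff:
  assumes "N \<subseteq> J"
  shows "\<not> faithful_module (A Quot Q) (factor_action ((regular_module A)\<lparr>carrier := N\<rparr>)) \<longleftrightarrow>
    (\<exists>r\<in>carrier A. r \<notin> Q \<and> (\<forall>m\<in>N. r \<otimes> m = \<zero>))"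
proof -
  have act: "the_elem ((\<lambda>r. r \<otimes> m) ` (Q +> r)) = r \<otimes> m" if r: "r \<in> carrier A" and m: "m \<in> N" for r m
  proof -
    have mJ: "m \<in> J" using m assms by blast
    have "(q \<oplus> r) \<otimes> m = r \<otimes> m" if "q \<in> Q" for q
      using QJ_zero[OF that mJ] r mJ that by (simp add: l_distr)
    moreover have "r \<in> Q +> r" using Q_zero r unfolding a_r_coset_def' by force
    ultimately have "(\<lambda>r. r \<otimes> m) ` (Q +> r) = {r \<otimes> m}"
      unfolding a_r_coset_def' by force
    thus ?thesis by simp
  qed
  have cos: "Q +> r = Q \<longleftrightarrow> r \<in> Q" if "r \<in> carrier A" for r
    using that a_coset_join1[of Q r] a_coset_join2[of r Q] 
      additive_subgroup.a_subgroup[OF ideal.axioms(1)[OF ideal_Q]] by auto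
  have "faithful_module (A Quot Q) (factor_action ((regular_module A)\<lparr>carrier := N\<rparr>)) \<longleftrightarrow>
    (\<forall>r\<in>carrier A. (\<forall>m\<in>N. the_elem ((\<lambda>r. r \<otimes> m) ` (Q +> r)) = \<zero>) \<longrightarrow> Q +> r = Q)"
    unfolding faithful_module_def factor_action_def FactRing_def
    by (auto simp: A_RCOSETS_def')
  also have "\<dots> \<longleftrightarrow> (\<forall>r\<in>carrier A. (\<forall>m\<in>N. r \<otimes> m = \<zero>) \<longrightarrow> r \<in> Q)"
    using act cos by (intro ball_cong refl) simp
  finally show ?thesis by blast
qed

text \<open>A bar through \<open>a\<close> has dimension 4, one more than U(a), so it contains an
  element outside U(a); the element annihilating the bar kills \<open>a\<close> and so lies in
  \<open>J\<close>. Conversely c, a and \<open>Q\<close> span a bar annihilated by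
  \<open>b\<close>.\<close>

lemma bar_iff_linked: assumes a: "a \<in> J" "a \<notin> Q" shows "(\<exists>N. bar K A N \<and> a \<in> N) \<longleftrightarrow> linked a"
proof
  have d3: "dimension 3 S (LE a Q)" using dim_LE[OF dim_Q _ a(2)] a(1) by (simp add: numeral_eq_Suc)
  assume "\<exists>N. bar K A N \<and> a \<in> N"
  then obtain N where N: "ideal N A" "N \<subseteq> J" "dimension 4 S N" "a \<in> N"
    and nf: "\<not> faithful_module (A Quot Q) (factor_action ((regular_module A)\<lparr>carrier := N\<rparr>))"
    unfolding bar_def by blast
  obtain r where r: "r \<in> carrier A" "r \<notin> Q" "\<forall>m\<in>N. r \<otimes> m = \<zero>"
    using nf unfolding not_faithful_iff[OF N(2)] by blast
  have rJ: "r \<in> J" using ann_notin_J[OF r(1), of a] r(3) N(4) a(1) not_Q_nonzero[OF a(2)] by simp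
  obtain z where z: "z \<in> N" "z \<notin> LE a Q" using dim_pick[OF N(3) d3] by auto
  have "a \<otimes> r = \<zero>" using r(3) N(4) m_comm[of a r] r(1) a(1) by simp
  thus "linked a" unfolding linked_def using rJ r z N(2) by blast
next
  assume "linked a"
  then obtain b c where b: "b \<in> J" "b \<notin> Q" "a \<otimes> b = \<zero>" and c: "c \<in> J" "c \<notin> LE a Q" "b \<otimes> c = \<zero>"
    unfolding linked_def by blast
  let ?N = "LE c (LE a Q)"
  have sub: "LE a Q \<subseteq> J" by (rule LE_in_J[OF a(1) Q_subset_J])
  have NJ: "?N \<subseteq> J" by (rule LE_in_J[OF c(1) sub])
  have car: "a \<in> carrier A" "b \<in> carrier A" "c \<in> carrier A" using a b c by auto
  have "b \<otimes> m = \<zero>" if mN: "m \<in> ?N" for m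
  proof -
    obtain k l q where k: "k \<in> S" "l \<in> S" "q \<in> Q" "m = k \<otimes> c \<oplus> l \<otimes> a \<oplus> q"
      using LE2_QE[OF mN a(1) c(1)] .
    have ck: "k \<in> carrier A" "l \<in> carrier A" "q \<in> carrier A" using k by auto
    have "b \<otimes> m = k \<otimes> (b \<otimes> c) \<oplus> l \<otimes> (a \<otimes> b) \<oplus> b \<otimes> q"
      unfolding k(4) using car ck by algebra
    thus ?thesis using b(3) c(3) JQ_zero[OF b(1) k(3)] ck by simp
  qed
  hence "\<not> faithful_module (A Quot Q) (factor_action ((regular_module A)\<lparr>carrier := ?N\<rparr>))"
    unfolding not_faithful_iff[OF NJ] using b(2) car(2) by blast
  hence "bar K A ?N"
    unfolding bar_def using ideal_LE2[OF a(1) c(1)] NJ dim_LE2(2)[OF a c(1,2)] by blast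
  moreover have "a \<in> ?N"
    using LE_incl[OF c(1) sub] LE_self[OF a(1) Q_subset_J Q_zero] by blast
  ultimately show "\<exists>N. bar K A N \<and> a \<in> N" by blast
qed

end

section \<open>Cyclic modules and atoms\<close>

lemma mod_iso_sym:
  assumes "mod_iso R M N" "module R M" "module R N" shows "mod_iso R N M"
proof -
  obtain f where f: "f \<in> mod_hom R M N" "bij_betw f (carrier M) (carrier N)"
    using assms(1) unfolding mod_iso_def by blast
  have "bij_betw (\<lambda>y\<in>carrier N. inv_into (carrier M) f y) (carrier N) (carrier M)"
    using bij_betw_inv_into[OF f(2)] by (rule bij_betw_cong[THEN iffD1, rotated]) simp
  thus ?thesis using mod_iso_inverse[OF f assms(2,3)] unfolding mod_iso_def by blast
qed

lemma mod_iso_refl: "module R M \<Longrightarrow> mod_iso R M M"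
  unfolding mod_iso_def
  by (rule bexI[OF _ mod_homI[of M "\<lambda>x. x"]]) (auto simp: bij_betw_def inj_on_def)

lemma mod_hom_codomain:
  assumes "f \<in> mod_hom R M N" "f ` carrier M \<subseteq> N'" shows "f \<in> mod_hom R M (N\<lparr>carrier := N'\<rparr>)"
  using assms by (auto simp: mod_hom_def PiE_def Pi_def image_subset_iff)

lemma Hom_module_module:
  assumes M: "module R M" and N: "module R N" shows "module R (Hom_module R M N)"
proof -
  interpret M: module R M by fact
  interpret N: module R N by fact
  have cl: "f x \<in> carrier N" if "f \<in> mod_hom R M N" "x \<in> carrier M" for f x using that by auto
  have s: "(\<lambda>x\<in>carrier M. r \<odot>\<^bsub>N\<^esub> f x) \<in> mod_hom R M N" if "r \<in> carrier R" "f \<in> mod_hom R M N" for r f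
  proof (rule mod_homI[OF _ _ _ M])
    show "r \<odot>\<^bsub>N\<^esub> f (t \<odot>\<^bsub>M\<^esub> x) = t \<odot>\<^bsub>N\<^esub> (r \<odot>\<^bsub>N\<^esub> f x)" if "t \<in> carrier R" "x \<in> carrier M" for t x
      using that \<open>r \<in> _\<close> cl[OF \<open>f \<in> _\<close>] mod_hom_smult[OF \<open>f \<in> _\<close> that]
      by (simp add: N.smult_assoc1[symmetric] M.R.m_comm)
  qed (use that in \<open>auto simp: cl mod_hom_add N.smult_r_distr\<close>)
  show ?thesis
  proof (rule moduleI[OF M.R.is_cring Hom_module_abelian_group[OF M N]])
    show "\<one>\<^bsub>R\<^esub> \<odot>\<^bsub>Hom_module R M N\<^esub> f = f" if "f \<in> carrier (Hom_module R M N)" for f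
    proof -
      have f: "f \<in> mod_hom R M N" using that by (simp add: Hom_module_def)
      have "(\<lambda>x\<in>carrier M. \<one>\<^bsub>R\<^esub> \<odot>\<^bsub>N\<^esub> f x) = f"
        by (rule mod_hom_ext[OF s[OF M.R.one_closed f] f]) (simp add: cl[OF f])
      thus ?thesis by (simp add: Hom_module_def)
    qed
  qed (auto simp: Hom_module_def s cl N.smult_l_distr N.smult_r_distr N.smult_assoc1 cong: restrict_cong)
qed

context cring
begin

text \<open>A homomorphism out of a cyclic module is given by an image of the generator with large
  enough annihilator. The cyclic module enters through an abstract presentation \<open>f\<close>, so
  that C(a) and principal ideals are both covered.\<close>

lemma cyclic_hom:
  assumes f: "f \<in> mod_hom R (regular_module R) M" "f ` carrier R = carrier M" and M: "module R M"
    and N: "module R N" and z: "z \<in> carrier N"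
    and ker: "\<And>r. r \<in> carrier R \<Longrightarrow> f r = \<zero>\<^bsub>M\<^esub> \<Longrightarrow> r \<odot>\<^bsub>N\<^esub> z = \<zero>\<^bsub>N\<^esub>"
  obtains g where "g \<in> mod_hom R M N" "\<And>r. r \<in> carrier R \<Longrightarrow> g (f r) = r \<odot>\<^bsub>N\<^esub> z"
proof -
  interpret M: module R M by fact
  interpret N: module R N by fact
  have fc: "f r \<in> carrier M" if "r \<in> carrier R" for r using mod_hom_closed[OF f(1)] that by simp
  have wd: "r \<odot>\<^bsub>N\<^esub> z = t \<odot>\<^bsub>N\<^esub> z" if "r \<in> carrier R" "t \<in> carrier R" "f r = f t" for r t
  proof -
    have eq: "r = (r \<ominus> t) \<oplus> t" using that by algebra
    have c: "r \<ominus> t \<in> carrier R" using that by simp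
    have "f r = f (r \<ominus> t) \<oplus>\<^bsub>M\<^esub> f t" using mod_hom_add[OF f(1), of "r \<ominus> t" t] c that(2) eq by simp
    hence "f (r \<ominus> t) = \<zero>\<^bsub>M\<^esub>"
      using that(3) fc[OF c] fc[OF that(2)] by (metis M.M.add.r_cancel_one')
    hence "(r \<ominus> t) \<odot>\<^bsub>N\<^esub> z = \<zero>\<^bsub>N\<^esub>" by (rule ker[OF c])
    thus ?thesis using eq N.smult_l_distr[OF c that(2) z] N.smult_closed[OF that(2) z] by simp
  qed
  define g where "g = (\<lambda>x\<in>carrier M. (SOME r. r \<in> carrier R \<and> f r = x) \<odot>\<^bsub>N\<^esub> z)"
  have g: "g (f r) = r \<odot>\<^bsub>N\<^esub> z" if "r \<in> carrier R" for r
  proof -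
    have "(SOME t. t \<in> carrier R \<and> f t = f r) \<in> carrier R \<and> f (SOME t. t \<in> carrier R \<and> f t = f r) = f r"
      by (rule someI[of _ r]) (simp add: that)
    thus ?thesis using wd[OF _ that] fc[OF that] by (simp add: g_def)
  qed
  have surj: "\<exists>r\<in>carrier R. x = f r" if "x \<in> carrier M" for x using that f(2) by blast
  have "(\<lambda>x\<in>carrier M. g x) \<in> mod_hom R M N"
  proof (rule mod_homI[OF _ _ _ M])
    fix x assume "x \<in> carrier M"
    then obtain r where r: "r \<in> carrier R" "x = f r" using surj by blast
    show "g x \<in> carrier N" using g[OF r(1)] r z by simp
    show "g (x \<oplus>\<^bsub>M\<^esub> y) = g x \<oplus>\<^bsub>N\<^esub> g y" if "y \<in> carrier M" for y
    proof -
      obtain t where t: "t \<in> carrier R" "y = f t" using surj \<open>y \<in> _\<close> by blast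
      have "x \<oplus>\<^bsub>M\<^esub> y = f (r \<oplus> t)" using mod_hom_add[OF f(1), of r t] r t by simp
      thus ?thesis using g[OF r(1)] g[OF t(1)] g[of "r \<oplus> t"] r t z by (simp add: N.smult_l_distr)
    qed
    show "g (s \<odot>\<^bsub>M\<^esub> x) = s \<odot>\<^bsub>N\<^esub> g x" if "s \<in> carrier R" for s
    proof -
      have "s \<odot>\<^bsub>M\<^esub> x = f (s \<otimes> r)" using mod_hom_smult[OF f(1), of s r] r that by simp
      thus ?thesis using g[OF r(1)] g[of "s \<otimes> r"] r z that by (simp add: N.smult_assoc1)
    qed
  qed
  moreover have "(\<lambda>x\<in>carrier M. g x) = g" by (auto simp: g_def)
  ultimately show ?thesis using that g by simp
qed

lemma cyclic_iso:
  assumes f: "f \<in> mod_hom R (regular_module R) M" "f ` carrier R = carrier M" and M: "module R M"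
    and N: "module R N" and z: "z \<in> carrier N"
    and ker: "\<And>r. r \<in> carrier R \<Longrightarrow> f r = \<zero>\<^bsub>M\<^esub> \<longleftrightarrow> r \<odot>\<^bsub>N\<^esub> z = \<zero>\<^bsub>N\<^esub>"
  obtains g where "g \<in> mod_hom R M N" "inj_on g (carrier M)"
    "g ` carrier M = (\<lambda>r. r \<odot>\<^bsub>N\<^esub> z) ` carrier R"
proof -
  interpret M: module R M by fact
  interpret N: module R N by fact
  have ker1: "r \<odot>\<^bsub>N\<^esub> z = \<zero>\<^bsub>N\<^esub>" if "r \<in> carrier R" "f r = \<zero>\<^bsub>M\<^esub>" for r using ker that by blast
  obtain g where g: "g \<in> mod_hom R M N" "\<And>r. r \<in> carrier R \<Longrightarrow> g (f r) = r \<odot>\<^bsub>N\<^esub> z"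
    using cyclic_hom[OF f M N z ker1] by blast
  have "inj_on g (carrier M)"
  proof (rule inj_onI)
    fix x y assume xy: "x \<in> carrier M" "y \<in> carrier M" "g x = g y"
    have d: "x \<ominus>\<^bsub>M\<^esub> y \<in> carrier M" by (rule M.M.minus_closed[OF xy(1,2)])
    then obtain r where r: "r \<in> carrier R" "x \<ominus>\<^bsub>M\<^esub> y = f r" using f(2) by blast
    have "g (x \<ominus>\<^bsub>M\<^esub> y) = g x \<ominus>\<^bsub>N\<^esub> g y" by (rule mod_hom_minus[OF g(1) M N xy(1,2)])
    also have "\<dots> = \<zero>\<^bsub>N\<^esub>" unfolding xy(3) N.M.minus_eq by (rule N.M.r_neg[OF mod_hom_closed[OF g(1) xy(2)]])
    finally have "x \<ominus>\<^bsub>M\<^esub> y = \<zero>\<^bsub>M\<^esub>" using g(2)[OF r(1)] ker[OF r(1)] r(2) by simp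
    moreover have "x = (x \<ominus>\<^bsub>M\<^esub> y) \<oplus>\<^bsub>M\<^esub> y"
      using xy(1,2) by (simp add: M.M.minus_eq M.M.a_assoc M.M.l_neg)
    ultimately show "x = y" using xy(2) by simp
  qed
  moreover have "g ` carrier M = (\<lambda>r. r \<odot>\<^bsub>N\<^esub> z) ` carrier R"
    unfolding f(2)[symmetric] image_image by (rule image_cong[OF refl g(2)])
  ultimately show ?thesis using that g(1) by blast
qed

lemma free_module_1_apply:
  assumes "module R M" "m \<in> carrier M" "v \<in> vectors R 1"
  shows "free_hom R M 1 (\<lambda>_. m) {v} = v 0 \<odot>\<^bsub>M\<^esub> m"
proof -
  interpret M: module R M by fact
  have "v 0 \<in> carrier R" by (rule vectors_closed[OF assms(3)])
  thus ?thesis using assms by (simp add: free_hom_apply)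
qed

definition vector1 :: "'a \<Rightarrow> nat \<Rightarrow> 'a" where
  "vector1 r = (\<lambda>i. if i = 0 then r else \<zero>)"

lemma vector1: "r \<in> carrier R \<Longrightarrow> vector1 r \<in> vectors R 1" "vector1 r 0 = r"
  by (simp_all add: vector1_def vectors_def)

lemma vectors_1: "v \<in> vectors R 1 \<Longrightarrow> v = vector1 (v 0)"
  by (auto simp: vector1_def vectors_def fun_eq_iff)

lemma free_module_1_carrier: "carrier (free_module R 1) = (\<lambda>r. {vector1 r}) ` carrier R"
proof
  show "carrier (free_module R 1) \<subseteq> (\<lambda>r. {vector1 r}) ` carrier R"
  proof
    fix Y assume "Y \<in> carrier (free_module R 1)"
    then obtain v where v: "v \<in> vectors R 1" "Y = {v}" by auto
    thus "Y \<in> (\<lambda>r. {vector1 r}) ` carrier R"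
      using vectors_1[OF v(1)] vectors_closed[OF v(1), of 0] by (intro image_eqI[of _ _ "v 0"]) auto
  qed
  show "(\<lambda>r. {vector1 r}) ` carrier R \<subseteq> carrier (free_module R 1)"
    using vector1(1) by (simp add: image_subset_iff)
qed

lemma free_module_1_smult: "r \<in> carrier R \<Longrightarrow> r \<odot>\<^bsub>free_module R 1\<^esub> {vector1 x} = {vector1 (r \<otimes> x)}"
  by (auto simp: vector1_def)

lemma vector1_inject: "vector1 r = vector1 s \<longleftrightarrow> r = s"
  using vector1(2) by metis

lemma free_module_1_zero: "\<zero>\<^bsub>free_module R 1\<^esub> = {vector1 \<zero>}"
  by (simp add: vector1_def)

end

section \<open>Finite generation, functionals and composition series over A\<close>

context special_comm_algebra
begin

lemma ideal_finite_dim: assumes "ideal I A" obtains n where "dimension n S I"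
proof -
  have "finite_dimension S (carrier A)"
    using short by (simp add: short_local_3_2_def)
  moreover have "I \<subseteq> carrier A" using ideal.Icarr[OF assms] by blast
  ultimately have "finite_dimension S I"
    using subalbegra_incl_imp_finite_dimension[OF subfield_S _ ideal_is_subalgebra[OF _ assms]]
      subfieldE(3)[OF subfield_S] by blast
  thus ?thesis using that unfolding finite_dimension_def by blast
qed

text \<open>A k-basis generates the ideal. This is the Noetherian hypothesis of
  \<open>extensionless_iff_extends\<close>.\<close>

lemma ideal_fin_gen:
  assumes I: "ideal I A" shows "\<exists>G. finite G \<and> G \<subseteq> I \<and> submodule_gen A (regular_module A) G = I"
proof -
  interpret reg: module A "regular_module A" by (rule module_regular)
  obtain n where "dimension n S I" using ideal_finite_dim[OF I] .
  then obtain Us where Us: "set Us \<subseteq> carrier A" "Span S Us = I"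
    using exists_base[OF subfield_S] by blast
  have sub: "set Us \<subseteq> I" using Span_base_incl[OF subfield_S Us(1)] Us(2) by simp
  have "I \<subseteq> N" if N: "submodule N A (regular_module A)" "set Us \<subseteq> N" for N
    using subalgebra_Span_incl[OF subfield_S ideal_is_subalgebra[OF subfieldE(3)[OF subfield_S]] N(2)]
      N(1) Us(2) by (simp only: regular_submodule_iff)
  hence "I \<subseteq> submodule_gen A (regular_module A) (set Us)"
    unfolding submodule_gen_def by (intro Inter_greatest) blast
  moreover have "submodule_gen A (regular_module A) (set Us) \<subseteq> I"
    using reg.submodule_gen_least[OF _ sub] I by (simp only: regular_submodule_iff)
  ultimately show ?thesis using sub by (intro exI[of _ "set Us"]) auto
qed

text \<open>The coordinate along \<open>x\<close> on kx + E. Two representations differ by a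
  multiple of \<open>x\<close> in \<open>E\<close>, and \<open>x\<close> lies outside
  \<open>E\<close>, so the choice made by \<open>SOME\<close> is forced.\<close>

lemma coefficient:
  assumes E: "dimension n S E" and x: "x \<in> carrier A" "x \<notin> E"
  obtains \<kappa> where "\<And>k v. k \<in> S \<Longrightarrow> v \<in> E \<Longrightarrow> \<kappa> (k \<otimes> x \<oplus> v) = k"
proof -
  note E_props = space_subgroup_props[OF subfield_S E]
  define \<kappa> where "\<kappa> = (\<lambda>u. SOME k. k \<in> S \<and> (\<exists>v\<in>E. u = k \<otimes> x \<oplus> v))"
  have "\<kappa> (k \<otimes> x \<oplus> v) = k" if k: "k \<in> S" and v: "v \<in> E" for k v
  proof -
    let ?l = "\<kappa> (k \<otimes> x \<oplus> v)"
    have "?l \<in> S \<and> (\<exists>w\<in>E. k \<otimes> x \<oplus> v = ?l \<otimes> x \<oplus> w)"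
      unfolding \<kappa>_def by (rule someI[of _ k]) (use k v in blast)
    then obtain w where l: "?l \<in> S" and w: "w \<in> E" "k \<otimes> x \<oplus> v = ?l \<otimes> x \<oplus> w" by blast
    have c: "k \<in> carrier A" "?l \<in> carrier A" "v \<in> carrier A" "w \<in> carrier A"
      using k l v w E_props(1) by auto
    have "(?l \<ominus> k) \<otimes> x = (?l \<otimes> x \<oplus> w) \<ominus> (k \<otimes> x) \<ominus> w" using c x by algebra
    also have "\<dots> = v \<oplus> \<ominus> w" unfolding w(2)[symmetric] using c x by algebra
    finally have mem: "(?l \<ominus> k) \<otimes> x \<in> E" using E_props(3)[OF v E_props(4)[OF w(1)]] by simp
    have "?l \<ominus> k = \<zero>"
    proof (rule ccontr)
      assume "?l \<ominus> k \<noteq> \<zero>"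
      hence "?l \<ominus> k \<in> S - {\<zero>}" using l k by simp
      thus False using E_props(6)[OF _ x(1) mem] x(2) by blast
    qed
    thus ?thesis using c by (simp add: r_right_minus_eq)
  qed
  thus ?thesis using that by blast
qed

text \<open>The map is the coordinate along \<open>x\<close>, times \<open>p\<close>. It is A-linear
  since A = k + J: scalars are respected, and elements of \<open>J\<close> move kx + E into
  \<open>E\<close>, where the coordinate is zero, and kill \<open>p\<close> in
  \<open>Q\<close>.\<close>

lemma functional_hom:
  assumes E: "dimension n S E" and x: "x \<in> carrier A" "x \<notin> E" and W: "ideal (LE x E) A" "LE x E \<subseteq> J"
    and JW: "\<And>j w. j \<in> J \<Longrightarrow> w \<in> LE x E \<Longrightarrow> j \<otimes> w \<in> E" and p: "p \<in> Q"
  obtains h where "h \<in> mod_hom A ((regular_module A)\<lparr>carrier := LE x E\<rparr>) (regular_module A)"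
    "\<And>k v. k \<in> S \<Longrightarrow> v \<in> E \<Longrightarrow> h (k \<otimes> x \<oplus> v) = k \<otimes> p"
proof -
  note E_props = space_subgroup_props[OF subfield_S E]
  obtain \<kappa> where \<kappa>: "\<And>k v. k \<in> S \<Longrightarrow> v \<in> E \<Longrightarrow> \<kappa> (k \<otimes> x \<oplus> v) = k" using coefficient[OF E x] by blast
  have WE: "\<exists>k v. k \<in> S \<and> v \<in> E \<and> u = k \<otimes> x \<oplus> v" if "u \<in> LE x E" for u
    using that unfolding LE_iff by blast
  have cp: "p \<in> carrier A" using p by simp
  have mod: "module A ((regular_module A)\<lparr>carrier := LE x E\<rparr>)"
    using W(1) by (intro submodule.submodule_is_module[OF _ module_regular]) (simp only: regular_submodule_iff)
  have "(\<lambda>u\<in>carrier ((regular_module A)\<lparr>carrier := LE x E\<rparr>). \<kappa> u \<otimes> p)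
      \<in> mod_hom A ((regular_module A)\<lparr>carrier := LE x E\<rparr>) (regular_module A)"
  proof (rule mod_homI[OF _ _ _ mod])
    fix u assume "u \<in> carrier ((regular_module A)\<lparr>carrier := LE x E\<rparr>)"
    hence uW: "u \<in> LE x E" by simp
    then obtain k v where u: "k \<in> S" "v \<in> E" "u = k \<otimes> x \<oplus> v" using WE by blast
    have ku: "\<kappa> u = k" using \<kappa>[OF u(1,2)] u(3) by simp
    have c: "k \<in> carrier A" "v \<in> carrier A" using u E_props(1) by auto
    show "\<kappa> u \<otimes> p \<in> carrier (regular_module A)" using ku c cp by simp
    show "\<kappa> (u \<oplus>\<^bsub>(regular_module A)\<lparr>carrier := LE x E\<rparr>\<^esub> u') \<otimes> p = \<kappa> u \<otimes> p \<oplus>\<^bsub>regular_module A\<^esub> \<kappa> u' \<otimes> p"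
      if "u' \<in> carrier ((regular_module A)\<lparr>carrier := LE x E\<rparr>)" for u'
    proof -
      have "u' \<in> LE x E" using that by simp
      then obtain l w where u': "l \<in> S" "w \<in> E" "u' = l \<otimes> x \<oplus> w" using WE by blast
      have c': "l \<in> carrier A" "w \<in> carrier A" using u' E_props(1) by auto
      have "u \<oplus> u' = (k \<oplus> l) \<otimes> x \<oplus> (v \<oplus> w)" unfolding u(3) u'(3) using c c' x by algebra
      hence "\<kappa> (u \<oplus> u') = k \<oplus> l" using \<kappa>[of "k \<oplus> l" "v \<oplus> w"] u u' E_props(3) by simp
      moreover have "\<kappa> u' = l" using \<kappa>[OF u'(1,2)] u'(3) by simp
      ultimately show ?thesis using ku c c' cp by (simp add: l_distr)
    qed
    show "\<kappa> (r \<odot>\<^bsub>(regular_module A)\<lparr>carrier := LE x E\<rparr>\<^esub> u) \<otimes> p = r \<odot>\<^bsub>regular_module A\<^esub> (\<kappa> u \<otimes> p)"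
      if r: "r \<in> carrier A" for r
    proof -
      obtain l j where l: "l \<in> S" "j \<in> J" "r = l \<oplus> j" using eigenvalue[OF r] .
      have cl: "l \<in> carrier A" "j \<in> carrier A" "u \<in> carrier A" using l uW W by auto
      have "r \<otimes> u = (l \<otimes> k) \<otimes> x \<oplus> (l \<otimes> v \<oplus> j \<otimes> u)"
      proof -
        have "r \<otimes> u = l \<otimes> u \<oplus> j \<otimes> u" unfolding l(3) using cl by algebra
        also have "l \<otimes> u = (l \<otimes> k) \<otimes> x \<oplus> l \<otimes> v" unfolding u(3) using cl(1) c x by algebra
        finally show ?thesis using cl c x by (simp add: a_assoc)
      qed
      moreover have "l \<otimes> v \<oplus> j \<otimes> u \<in> E" using E_props(3)[OF E_props(5)[OF l(1) u(2)] JW[OF l(2) uW]] .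
      ultimately have "\<kappa> (r \<otimes> u) = l \<otimes> k" using \<kappa>[of "l \<otimes> k"] l(1) u(1) by simp
      moreover have "r \<otimes> (k \<otimes> p) = (l \<otimes> k) \<otimes> p \<oplus> k \<otimes> (j \<otimes> p)"
        unfolding l(3) using cl(1,2) c cp by algebra
      hence "r \<otimes> (k \<otimes> p) = (l \<otimes> k) \<otimes> p" using JQ_zero[OF l(2) p] cl c cp by simp
      ultimately show ?thesis using ku by simp
    qed
  qed
  moreover have "(\<lambda>u\<in>carrier ((regular_module A)\<lparr>carrier := LE x E\<rparr>). \<kappa> u \<otimes> p) (k \<otimes> x \<oplus> v) = k \<otimes> p"
    if "k \<in> S" "v \<in> E" for k v
  proof -
    have "k \<otimes> x \<oplus> v \<in> LE x E" using that unfolding LE_iff by blast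
    thus ?thesis using \<kappa>[OF that] by simp
  qed
  ultimately show ?thesis using that by blast
qed

lemma dim_carrier: "dimension 6 S (carrier A)"
proof -
  have "LE \<one> J = carrier A"
  proof
    show "LE \<one> J \<subseteq> carrier A"
    proof
      fix u assume "u \<in> LE \<one> J"
      then obtain k j where "k \<in> S" "j \<in> J" "u = k \<otimes> \<one> \<oplus> j" unfolding LE_iff by blast
      thus "u \<in> carrier A" by simp
    qed
    show "carrier A \<subseteq> LE \<one> J"
    proof
      fix u assume "u \<in> carrier A"
      then obtain l j where l: "l \<in> S" "j \<in> J" "u = l \<oplus> j" by (rule eigenvalue)
      hence "u = l \<otimes> \<one> \<oplus> j" by simp
      thus "u \<in> LE \<one> J" using l(1,2) unfolding LE_iff by blast
    qed
  qed
  thus ?thesis using dim_LE[OF dim_J one_closed one_notin_J] by (simp add: numeral_eq_Suc)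
qed

text \<open>\<open>I1\<close> contains the kernel of \<open>f\<close>, so submodules between the two
  images correspond to ideals between \<open>I1\<close> and \<open>I2\<close>; the dimensions differ
  by one and leave no room.\<close>

lemma maximal_submodule_image:
  assumes f: "f \<in> mod_hom A (regular_module A) M" and M: "module A M"
    and ker: "\<And>x. x \<in> carrier A \<Longrightarrow> f x = \<zero>\<^bsub>M\<^esub> \<Longrightarrow> x \<in> I1"
    and I: "ideal I1 A" "ideal I2 A" "I1 \<subseteq> I2" "dimension n S I1" "dimension (Suc n) S I2"
  shows "maximal_submodule (f ` I1) A (M\<lparr>carrier := f ` I2\<rparr>)"
proof -
  interpret reg: module A "regular_module A" by (rule module_regular)
  interpret M: module A M by fact
  have Ic: "I1 \<subseteq> carrier A" "I2 \<subseteq> carrier A" by (rule subsetI, rule ideal.Icarr[OF I(1)], assumption) (rule subsetI, rule ideal.Icarr[OF I(2)], assumption)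
  have sub: "submodule (f ` I1) A M" "submodule (f ` I2) A M"
    using mod_hom_image_submodule[OF f module_regular M] I(1,2) by (simp_all only: regular_submodule_iff)
  have pre: "x \<in> T" if T: "ideal T A" "I1 \<subseteq> T" and x: "x \<in> carrier A" "f x \<in> f ` T" for T x
  proof -
    obtain y where y: "y \<in> T" "f x = f y" using x by blast
    have cy: "y \<in> carrier A" using ideal.Icarr[OF T(1) y(1)] .
    have "f (x \<ominus>\<^bsub>regular_module A\<^esub> y) = f x \<ominus>\<^bsub>M\<^esub> f y"
      using x cy by (intro mod_hom_minus[OF f module_regular M]) auto
    also have "\<dots> = \<zero>\<^bsub>M\<^esub>" unfolding y(2) M.M.minus_eq using mod_hom_closed[OF f, of y] cy by (simp add: M.M.r_neg)
    finally have "x \<ominus>\<^bsub>regular_module A\<^esub> y \<in> I1"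
      using ker reg.M.minus_closed[of x y] x cy by simp
    hence "(x \<ominus>\<^bsub>regular_module A\<^esub> y) \<oplus> y \<in> T"
      using T y(1) by (meson additive_subgroup.a_closed ideal.axioms(1) subsetD)
    moreover have "(x \<ominus>\<^bsub>regular_module A\<^esub> y) \<oplus> y = x"
      using reg.M.a_assoc[of x "\<ominus>\<^bsub>regular_module A\<^esub> y" y] reg.M.l_neg[of y] reg.M.a_inv_closed[of y] x cy
      by (simp add: reg.M.minus_eq)
    ultimately show ?thesis by simp
  qed
  have neq: "f ` I1 \<noteq> f ` I2"
  proof
    assume eq: "f ` I1 = f ` I2"
    have "I2 \<subseteq> I1" using pre[OF I(1) order_refl] Ic(2) eq by blast
    thus False using dim_mono[OF I(5) I(4)] by simp
  qed
  show ?thesis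
    unfolding maximal_submodule_def M.submodule_carrier_update[OF sub(2)]
  proof (intro conjI allI impI)
    show "submodule (f ` I1) A M" by (rule sub)
    show "f ` I1 \<subseteq> f ` I2" using I(3) by blast
    show "f ` I1 \<noteq> carrier (M\<lparr>carrier := f ` I2\<rparr>)" using neq by simp
    fix L assume L: "(submodule L A M \<and> L \<subseteq> f ` I2) \<and> f ` I1 \<subseteq> L"
    let ?L = "{x \<in> carrier A. f x \<in> L}"
    have idL: "ideal ?L A"
      using mod_hom_vimage_submodule[OF f module_regular M] L by (simp add: regular_submodule_iff)
    have "I1 \<subseteq> ?L" using L Ic by blast
    have "?L \<subseteq> I2" using pre[OF I(2,3)] L by blast
    obtain d where d: "dimension d S ?L" using ideal_finite_dim[OF idL] .
    have "n \<le> d" "d \<le> Suc n" using dim_mono[OF I(4) d \<open>I1 \<subseteq> ?L\<close>] dim_mono[OF d I(5) \<open>?L \<subseteq> I2\<close>] .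
    hence "d = n \<or> d = Suc n" by auto
    hence "?L = I1 \<or> ?L = I2"
      using dim_eq[OF I(4) _ \<open>I1 \<subseteq> ?L\<close>] dim_eq[OF _ I(5) \<open>?L \<subseteq> I2\<close>] d by blast
    moreover have "f ` ?L = L"
    proof
      show "L \<subseteq> f ` ?L"
      proof
        fix y assume y: "y \<in> L"
        then obtain i where i: "i \<in> I2" "y = f i" using L by blast
        hence "i \<in> ?L" using y Ic(2) by blast
        thus "y \<in> f ` ?L" unfolding i(2) by (rule imageI)
      qed
    qed auto
    ultimately show "L = f ` I1 \<or> L = carrier (M\<lparr>carrier := f ` I2\<rparr>)" by auto
  qed
qed

text \<open>The chain U(a), kx + U(a), J, A has dimensions 3, 4, 5, 6, and its image is a
  composition series of length 3. The image of \<open>J\<close> is the only maximal submodule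
  because proper ideals lie in \<open>J\<close>.\<close>

lemma cyclic_atom:
  assumes a: "a \<in> J" "a \<notin> Q" and f: "f \<in> mod_hom A (regular_module A) M" "f ` carrier A = carrier M"
    and M: "module A M" and ker: "\<And>x. x \<in> carrier A \<Longrightarrow> f x = \<zero>\<^bsub>M\<^esub> \<longleftrightarrow> x \<in> LE a Q"
  shows "atom_module A M"
proof -
  interpret M: module A M by fact
  have ca: "a \<in> carrier A" using a by simp
  have d3: "dimension 3 S (LE a Q)" using dim_LE[OF dim_Q ca a(2)] by (simp add: numeral_eq_Suc)
  obtain x where x: "x \<in> J" "x \<notin> LE a Q" using dim_pick[OF dim_J d3] by auto
  have UJ: "LE a Q \<subseteq> J" by (rule LE_in_J[OF a(1) Q_subset_J])
  have d4: "dimension 4 S (LE x (LE a Q))" by (rule dim_LE2(2)[OF a x])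
  have Ux: "LE a Q \<subseteq> LE x (LE a Q)" by (rule LE_incl[OF x(1) UJ])
  have xJ: "LE x (LE a Q) \<subseteq> J" by (rule LE_in_J[OF x(1) UJ])
  have Jc: "J \<subseteq> carrier A" by auto
  have ker': "y \<in> I" if "LE a Q \<subseteq> I" "y \<in> carrier A" "f y = \<zero>\<^bsub>M\<^esub>" for I y
    using ker that by blast
  note idl = ideal_LE[OF a(1)] ideal_LE2[OF a(1) x(1)]
  have max1: "maximal_submodule (f ` LE a Q) A (M\<lparr>carrier := f ` LE x (LE a Q)\<rparr>)"
    using d3 d4 by (intro maximal_submodule_image[OF f(1) M ker'[OF order_refl] idl Ux, of 3]) (simp_all add: numeral_eq_Suc)
  have max2: "maximal_submodule (f ` LE x (LE a Q)) A (M\<lparr>carrier := f ` J\<rparr>)"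
    using dim_J d4 by (intro maximal_submodule_image[OF f(1) M ker'[OF Ux] idl(2) ideal_J xJ, of 4]) (simp_all add: numeral_eq_Suc)
  have max3: "maximal_submodule (f ` J) A (M\<lparr>carrier := f ` carrier A\<rparr>)"
    using dim_J dim_carrier by (intro maximal_submodule_image[OF f(1) M ker'[OF UJ] ideal_J oneideal Jc, of 5]) (simp_all add: numeral_eq_Suc)
  have f0: "f ` LE a Q = {\<zero>\<^bsub>M\<^esub>}"
  proof -
    have "f y = \<zero>\<^bsub>M\<^esub>" if "y \<in> LE a Q" for y using ker that UJ by auto
    hence "f ` LE a Q = (\<lambda>_. \<zero>\<^bsub>M\<^esub>) ` LE a Q" by (intro image_cong refl)
    moreover have "LE a Q \<noteq> {}" using LE_self[OF a(1) Q_subset_J Q_zero] by blast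
    ultimately show ?thesis by (simp add: image_constant_conv)
  qed
  have sub: "submodule (f ` I) A M" if "ideal I A" for I
    using mod_hom_image_submodule[OF f(1) module_regular M] that by (simp only: regular_submodule_iff)
  have len: "has_length A M 3"
  proof -
    define F where "F = (\<lambda>i::nat. if i = 0 then f ` LE a Q else if i = 1 then f ` LE x (LE a Q)
      else if i = 2 then f ` J else f ` carrier A)"
    have "submodule (F i) A M" for i
      unfolding F_def using sub idl ideal_J oneideal by simp
    moreover have "maximal_submodule (F i) A (M\<lparr>carrier := F (Suc i)\<rparr>)" if "i < 3" for i
    proof -
      have "i = 0 \<or> i = 1 \<or> i = 2" using that by auto
      thus ?thesis using max1 max2 max3 by (auto simp: F_def)
    qed
    moreover have "F 0 = {\<zero>\<^bsub>M\<^esub>}" "F 3 = carrier M" using f0 f(2) by (simp_all add: F_def)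
    ultimately show ?thesis unfolding has_length_def by blast
  qed
  have local: "local_module A M"
    unfolding local_module_def
  proof (rule ex1I[of _ "f ` J"])
    show "maximal_submodule (f ` J) A M" using max3 f(2) by simp
    fix N assume N: "maximal_submodule N A M"
    hence N': "submodule N A M" "N \<noteq> carrier M" "\<And>L. submodule L A M \<Longrightarrow> N \<subseteq> L \<Longrightarrow> L = N \<or> L = carrier M"
      unfolding maximal_submodule_def by blast+
    let ?N = "{x \<in> carrier A. f x \<in> N}"
    have im: "f ` ?N = N"
    proof
      show "N \<subseteq> f ` ?N"
      proof
        fix y assume y: "y \<in> N"
        hence "y \<in> f ` carrier A" using f(2) M.submoduleE(1)[OF N'(1)] by blast
        then obtain i where i: "i \<in> carrier A" "y = f i" by blast
        hence "i \<in> ?N" using y by blast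
        thus "y \<in> f ` ?N" unfolding i(2) by (rule imageI)
      qed
    qed auto
    have "ideal ?N A"
      using mod_hom_vimage_submodule[OF f(1) module_regular M N'(1)] by (simp add: regular_submodule_iff)
    moreover have "?N \<noteq> carrier A" using im f(2) N'(2) by metis
    ultimately have "?N \<subseteq> J" by (rule ideal_proper_J)
    hence "N \<subseteq> f ` J" using im by blast
    from N'(3)[OF sub[OF ideal_J] this] show "N = f ` J"
      using max3 f(2) unfolding maximal_submodule_def by auto
  qed
  have f1: "r \<odot>\<^bsub>M\<^esub> f y = f (r \<otimes> y)" if "r \<in> carrier A" "y \<in> carrier A" for r y
    using mod_hom_smult[OF f(1), of r y] that by simp
  have loewy: "has_loewy_length A M 2"
    unfolding has_loewy_length_def
  proof (intro conjI ballI allI impI)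
    fix r m assume r: "r \<in> Q" and "m \<in> carrier M"
    then obtain y where y: "y \<in> carrier A" "m = f y" using f(2) by blast
    have "r \<otimes> y \<in> LE a Q" using LE_incl[OF a(1) Q_subset_J] r y by auto
    thus "r \<odot>\<^bsub>M\<^esub> m = \<zero>\<^bsub>M\<^esub>" using f1[of r y] ker[of "r \<otimes> y"] r y by simp
  next
    fix m :: nat assume "m < 2"
    have "\<exists>r\<in>rad_pow A m. r \<notin> LE a Q"
    proof (cases "m = 0")
      case True
      have "\<one> \<notin> LE a Q" using UJ one_notin_J by blast
      thus ?thesis using True by auto
    next
      case False
      hence m1: "m = Suc 0" using \<open>m < 2\<close> by simp
      \<comment> \<open>The first power of the radical is by definition the product of the whole
        ring with \<open>J\<close>, so \<open>x\<close> is presented as a product.\<close>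
      have "\<one> \<otimes> x \<in> carrier A \<cdot> J" by (rule ideal_prod.prod[OF one_closed x(1)])
      hence "x \<in> rad_pow A m" unfolding m1 using x(1) by simp
      thus ?thesis using x by auto
    qed
    then obtain r where r: "r \<in> rad_pow A m" "r \<notin> LE a Q" by blast
    have rc: "r \<in> carrier A"
    proof (cases "m = 0")
      case False
      hence m1: "m = Suc 0" using \<open>m < 2\<close> by simp
      show ?thesis using r(1) ideal_prod_in_carrier[OF oneideal ideal_J] unfolding m1 by auto
    qed (use r in auto)
    have "r \<odot>\<^bsub>M\<^esub> f \<one> \<noteq> \<zero>\<^bsub>M\<^esub>" using f1[OF rc one_closed] ker[OF rc] r(2) rc by simp
    moreover have "f \<one> \<in> carrier M" using mod_hom_closed[OF f(1), of \<one>] by simp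
    ultimately show "\<not> (\<forall>r\<in>rad_pow A m. \<forall>x\<in>carrier M. r \<odot>\<^bsub>M\<^esub> x = \<zero>\<^bsub>M\<^esub>)" using r(1) by blast
  qed
  show ?thesis unfolding atom_module_def using M local len loewy by blast
qed

end

section \<open>The atom defined by an element\<close>

context cring
begin

abbreviation "rank1 \<equiv> free_module R 1"

definition mult_map :: "'a \<Rightarrow> (nat \<Rightarrow> 'a) set \<Rightarrow> (nat \<Rightarrow> 'a) set" where
  "mult_map x = free_hom R rank1 1 (\<lambda>_. {vector1 x})"

lemma vector1_rank1: "r \<in> carrier R \<Longrightarrow> {vector1 r} \<in> carrier rank1"
  unfolding free_module_1_carrier by blast

lemma rank1E: assumes "Y \<in> carrier rank1" obtains r where "r \<in> carrier R" "Y = {vector1 r}"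
  using assms unfolding free_module_1_carrier by blast

lemma rank1_hom_apply:
  assumes "module R M" "m \<in> carrier M" "r \<in> carrier R"
  shows "free_hom R M 1 (\<lambda>_. m) {vector1 r} = r \<odot>\<^bsub>M\<^esub> m"
  using free_module_1_apply[OF assms(1,2) vector1(1)[OF assms(3)]] by (simp only: vector1(2))

lemma mult_map:
  assumes x: "x \<in> carrier R"
  shows "mult_map x \<in> mod_hom R rank1 rank1"
    and "r \<in> carrier R \<Longrightarrow> mult_map x {vector1 r} = {vector1 (r \<otimes> x)}"
proof -
  show "mult_map x \<in> mod_hom R rank1 rank1"
    unfolding mult_map_def by (rule free_hom_mod_hom[OF free_module_module vector1_rank1[OF x]])
  show "r \<in> carrier R \<Longrightarrow> mult_map x {vector1 r} = {vector1 (r \<otimes> x)}"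
    unfolding mult_map_def
    by (simp only: rank1_hom_apply[OF free_module_module vector1_rank1[OF x]] free_module_1_smult)
qed

lemma mult_map_image: "x \<in> carrier R \<Longrightarrow> mult_map x ` carrier rank1 = (\<lambda>r. {vector1 (r \<otimes> x)}) ` carrier R"
  unfolding free_module_1_carrier image_image by (rule image_cong[OF refl mult_map(2)])

lemma mult_map_exact:
  assumes x: "x \<in> carrier R" and y: "y \<in> carrier R" and ann: "{r \<in> carrier R. y \<otimes> r = \<zero>} = PIdl x"
  shows "mult_map x ` carrier rank1 = mod_ker rank1 rank1 (mult_map y)"
proof
  have xy: "y \<otimes> (r \<otimes> x) = \<zero>" if "r \<in> carrier R" for r
  proof -
    have "r \<otimes> x \<in> PIdl x" using that unfolding cgenideal_def by blast
    thus ?thesis unfolding ann[symmetric] by simp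
  qed
  show "mult_map x ` carrier rank1 \<subseteq> mod_ker rank1 rank1 (mult_map y)"
  proof
    fix Y assume "Y \<in> mult_map x ` carrier rank1"
    then obtain r where r: "r \<in> carrier R" "Y = {vector1 (r \<otimes> x)}" unfolding mult_map_image[OF x] by blast
    have rx: "r \<otimes> x \<in> carrier R" using r x by simp
    have "mult_map y Y = \<zero>\<^bsub>rank1\<^esub>"
      using mult_map(2)[OF y rx] xy[OF r(1)] m_comm[OF rx y] r(2) by (simp only: free_module_1_zero)
    thus "Y \<in> mod_ker rank1 rank1 (mult_map y)"
      using vector1_rank1[OF rx] r(2) unfolding mod_ker_def by blast
  qed
  show "mod_ker rank1 rank1 (mult_map y) \<subseteq> mult_map x ` carrier rank1"
  proof
    fix Y assume "Y \<in> mod_ker rank1 rank1 (mult_map y)"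
    hence Y: "Y \<in> carrier rank1" "mult_map y Y = \<zero>\<^bsub>rank1\<^esub>" unfolding mod_ker_def by blast+
    obtain s where s: "s \<in> carrier R" "Y = {vector1 s}" using Y(1) by (rule rank1E)
    have "{vector1 (s \<otimes> y)} = {vector1 \<zero>}"
      using Y(2) unfolding s(2) mult_map(2)[OF y s(1)] free_module_1_zero .
    hence "s \<otimes> y = \<zero>" using vector1_inject by blast
    hence "s \<in> PIdl x" unfolding ann[symmetric] using s(1) m_comm[OF s(1) y] by simp
    then obtain r where "r \<in> carrier R" "s = r \<otimes> x" unfolding cgenideal_def by blast
    thus "Y \<in> mult_map x ` carrier rank1" unfolding mult_map_image[OF x] s(2) by blast
  qed
qed

text \<open>A functional on the free module of rank one is determined by its value at 1, and pulling
  back along \<open>mult_map x\<close> multiplies this value by \<open>x\<close>. Thus the dual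
  sequence again consists of multiplications and is exact by the same annihilator condition.\<close>

lemma mult_map_dual_exact:
  assumes x: "x \<in> carrier R" and y: "y \<in> carrier R" and ann: "{r \<in> carrier R. y \<otimes> r = \<zero>} = PIdl x"
  shows "pullback rank1 (mult_map x) ` carrier (dual_module R rank1) =
    mod_ker (dual_module R rank1) (dual_module R rank1) (pullback rank1 (mult_map y))"
proof
  show "pullback rank1 (mult_map x) ` carrier (dual_module R rank1) \<subseteq>
    mod_ker (dual_module R rank1) (dual_module R rank1) (pullback rank1 (mult_map y))"
  proof
    fix \<xi> assume "\<xi> \<in> pullback rank1 (mult_map x) ` carrier (dual_module R rank1)"
    then obtain \<psi> where \<psi>: "\<psi> \<in> mod_hom R rank1 (regular_module R)" "\<xi> = compose (carrier rank1) \<psi> (mult_map x)"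
      unfolding pullback_def Hom_module_def by auto
    have \<xi>: "\<xi> \<in> mod_hom R rank1 (regular_module R)"
      unfolding \<psi>(2) by (rule mod_hom_compose[OF mult_map(1)[OF x] \<psi>(1) free_module_module])
    have zero: "\<xi> (mult_map y Y) = \<zero>" if Y: "Y \<in> carrier rank1" for Y
    proof -
      obtain r where r: "r \<in> carrier R" "Y = {vector1 r}" using Y by (rule rank1E)
      have ry: "r \<otimes> y \<in> carrier R" using r y by simp
      have "x \<in> {r \<in> carrier R. y \<otimes> r = \<zero>}" unfolding ann by (rule cgenideal_self[OF x])
      hence yx: "y \<otimes> x = \<zero>" by simp
      have "mult_map x (mult_map y Y) = {vector1 (r \<otimes> y \<otimes> x)}"
        unfolding r(2) mult_map(2)[OF y r(1)] mult_map(2)[OF x ry] ..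
      also have "r \<otimes> y \<otimes> x = \<zero>" using r y x yx by (simp add: m_assoc)
      finally have "\<psi> (mult_map x (mult_map y Y)) = \<zero>"
        using mod_hom_zero[OF \<psi>(1) free_module_module module_regular] by (simp only: free_module_1_zero regular_module_simps)
      thus ?thesis unfolding \<psi>(2) compose_def using mod_hom_closed[OF mult_map(1)[OF y] Y] Y by (simp only: restrict_apply if_True)
    qed
    have "pullback rank1 (mult_map y) \<xi> = \<zero>\<^bsub>dual_module R rank1\<^esub>"
      unfolding pullback_def compose_def Hom_module_def using zero by (auto simp del: free_module_simps)
    thus "\<xi> \<in> mod_ker (dual_module R rank1) (dual_module R rank1) (pullback rank1 (mult_map y))"
      using \<xi> unfolding mod_ker_def Hom_module_def by simp
  qed
  show "mod_ker (dual_module R rank1) (dual_module R rank1) (pullback rank1 (mult_map y)) \<subseteq>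
    pullback rank1 (mult_map x) ` carrier (dual_module R rank1)"
    unfolding cocycles_bound_iff[OF free_module_module mult_map(1)[OF x], symmetric] cocycles_bound_def
  proof (intro ballI impI)
    fix \<xi> assume \<xi>: "\<xi> \<in> mod_hom R rank1 (regular_module R)"
      and zero: "\<forall>p\<in>carrier rank1. \<xi> (mult_map y p) = \<zero>\<^bsub>regular_module R\<^esub>"
    have scale: "\<xi> {vector1 r} = r \<otimes> \<xi> {vector1 \<one>}" if "r \<in> carrier R" for r
      using mod_hom_smult[OF \<xi> that vector1_rank1[OF one_closed]] that
      by (simp only: free_module_1_smult r_one regular_module_simps)
    have c: "\<xi> {vector1 \<one>} \<in> carrier R"
      using mod_hom_closed[OF \<xi> vector1_rank1[OF one_closed]] by (simp only: regular_module_simps)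
    have "\<xi> (mult_map y {vector1 \<one>}) = \<zero>"
      using zero vector1_rank1[OF one_closed] by (simp only: regular_module_simps)
    hence "y \<otimes> \<xi> {vector1 \<one>} = \<zero>" using mult_map(2)[OF y one_closed] scale[OF y] y by (simp only: l_one)
    hence "\<xi> {vector1 \<one>} \<in> PIdl x" unfolding ann[symmetric] using c by simp
    then obtain r where r: "r \<in> carrier R" "\<xi> {vector1 \<one>} = r \<otimes> x" unfolding cgenideal_def by blast
    have r': "r \<in> carrier (regular_module R)" using r by simp
    let ?\<psi> = "free_hom R (regular_module R) 1 (\<lambda>_. r)"
    have \<psi>: "?\<psi> \<in> mod_hom R rank1 (regular_module R)" by (rule free_hom_mod_hom[OF module_regular r'])
    have "\<xi> p = ?\<psi> (mult_map x p)" if p: "p \<in> carrier rank1" for p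
    proof -
      obtain s where s: "s \<in> carrier R" "p = {vector1 s}" using p by (rule rank1E)
      have sx: "s \<otimes> x \<in> carrier R" using s x by simp
      have "?\<psi> (mult_map x p) = (s \<otimes> x) \<otimes> r"
        unfolding s(2) mult_map(2)[OF x s(1)] rank1_hom_apply[OF module_regular r' sx] by simp
      also have "\<dots> = s \<otimes> (r \<otimes> x)" using s r x by (simp add: m_ac)
      finally show ?thesis unfolding s(2) scale[OF s(1)] r(2) ..
    qed
    thus "\<exists>\<psi>\<in>mod_hom R rank1 (regular_module R). \<forall>p\<in>carrier rank1. \<xi> p = \<psi> (mult_map x p)" using \<psi> by blast
  qed
qed

end

locale special_element = special_comm_algebra +
  fixes a assumes a: "a \<in> J" "a \<notin> Q"
begin

abbreviation "U \<equiv> LE a Q"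
abbreviation "C \<equiv> C_module A a"
abbreviation "\<pi> \<equiv> coset_hom A U"

lemma a_carr: "a \<in> carrier A" using a by simp

lemma ideal_U: "ideal U A" by (rule ideal_LE[OF a(1)])

lemma U_J: "U \<subseteq> J" by (rule LE_in_J[OF a(1) Q_subset_J])

lemma dim_U: "dimension 3 S U" using dim_LE[OF dim_Q a_carr a(2)] by (simp add: numeral_eq_Suc)

lemma C_eq: "C = quot_module (regular_module A) U"
  by (simp add: C_module_def U_ideal_eq[OF a(1)])

lemma C_mod: "module A C"
  and \<pi>_hom: "\<pi> \<in> mod_hom A (regular_module A) C"
  and \<pi>_surj: "\<pi> ` carrier A = carrier C"
  and \<pi>_ker: "x \<in> carrier A \<Longrightarrow> \<pi> x = \<zero>\<^bsub>C\<^esub> \<longleftrightarrow> x \<in> U"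
  unfolding C_eq using ideal.quot_module[OF ideal_U is_cring] by blast+

lemma \<pi>_closed: "x \<in> carrier A \<Longrightarrow> \<pi> x \<in> carrier C"
  using \<pi>_surj by blast

lemma C_E: assumes "x \<in> carrier C" obtains r where "r \<in> carrier A" "x = \<pi> r"
  using assms unfolding \<pi>_surj[symmetric] by blast

lemma atom_C: "atom_module A C"
  by (rule cyclic_atom[OF a \<pi>_hom \<pi>_surj C_mod \<pi>_ker])

lemma unit_U: assumes "u \<in> U" shows "\<one> \<oplus> u \<in> Units A"
proof -
  have u: "u \<in> J" using assms U_J by blast
  have "\<one> \<ominus> (\<ominus> u) = \<one> \<oplus> u" using J_carr[OF u] by algebra
  thus ?thesis using unit_one_minus[OF J_neg[OF u]] by simp
qed

text \<open>Places the cosets that form C(a) inside the carrier type of \<open>'a fg_module\<close>: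
  a set of ring elements becomes a set of constant sequences.\<close>

lemma inj_constant_image: "inj_on (\<lambda>Z. (\<lambda>x _::nat. x) ` Z) T"
proof -
  have "inj (\<lambda>x _::nat. x)" by (auto intro!: injI dest: fun_cong)
  thus ?thesis by (intro inj_onI) (rule inj_image_eq_iff[THEN iffD1])
qed

lemma extensionless_C_iff: "extensionless A C \<longleftrightarrow> extends A U"
  by (rule extensionless_iff_extends[OF ideal_fin_gen ideal_U unit_U C_mod \<pi>_hom \<pi>_surj \<pi>_ker inj_constant_image])

lemma gorenstein_projective_imp_extends: "gorenstein_projective A C \<Longrightarrow> extends A U"
  by (rule gorenstein_projective_extends[OF ideal_U unit_U C_mod \<pi>_hom \<pi>_surj \<pi>_ker inj_constant_image])

text \<open>ann(a) lies in \<open>J\<close> and so is killed by \<open>Q\<close>; being killed by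
  \<open>a\<close> is therefore the same as being killed by U(a).\<close>

lemma U_ann: assumes "u \<in> U" "z \<in> ann a" shows "u \<otimes> z = \<zero>"
proof -
  obtain k q where u: "k \<in> S" "q \<in> Q" "u = k \<otimes> a \<oplus> q" using assms(1) by (rule LE_QE)
  have z: "z \<in> J" using ann_J[OF a assms(2)] .
  have "u \<otimes> z = k \<otimes> (a \<otimes> z) \<oplus> q \<otimes> z"
    unfolding u(3) using a_carr S_carr[OF u(1)] Q_carr[OF u(2)] J_carr[OF z] by algebra
  thus ?thesis using assms(2) QJ_zero[OF u(2) z] u(1) by simp
qed

lemma a_U: "a \<in> U" by (rule LE_self[OF a(1) Q_subset_J Q_zero])

lemma submodule_mod: "ideal I A \<Longrightarrow> module A ((regular_module A)\<lparr>carrier := I\<rparr>)"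
  by (rule submodule.submodule_is_module[OF _ module_regular]) (simp only: regular_submodule_iff)

lemma PIdl_hom:
  assumes x: "x \<in> carrier A" and N: "module A N" and z: "z \<in> carrier N"
    and ker: "\<And>r. r \<in> ann x \<Longrightarrow> r \<odot>\<^bsub>N\<^esub> z = \<zero>\<^bsub>N\<^esub>"
  obtains g where "g \<in> mod_hom A ((regular_module A)\<lparr>carrier := PIdl x\<rparr>) N"
    "\<And>r. r \<in> carrier A \<Longrightarrow> g (r \<otimes> x) = r \<odot>\<^bsub>N\<^esub> z"
proof -
  let ?M = "(regular_module A)\<lparr>carrier := PIdl x\<rparr>"
  let ?f = "\<lambda>r\<in>carrier (regular_module A). r \<otimes> x"
  have f: "?f \<in> mod_hom A (regular_module A) ?M"
  proof (rule mod_homI[OF _ _ _ module_regular])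
    show "r \<otimes> x \<in> carrier ?M" if "r \<in> carrier (regular_module A)" for r
      using that by (auto simp: cgenideal_def)
  qed (use x in \<open>simp_all add: l_distr m_assoc\<close>)
  have surj: "?f ` carrier A = carrier ?M" by (auto simp: cgenideal_def)
  have M: "module A ?M" by (rule submodule_mod[OF cgenideal_ideal[OF x]])
  have k: "r \<odot>\<^bsub>N\<^esub> z = \<zero>\<^bsub>N\<^esub>" if "r \<in> carrier A" "?f r = \<zero>\<^bsub>?M\<^esub>" for r
    using that x m_comm[of r x] by (intro ker) simp
  obtain g where g: "g \<in> mod_hom A ?M N" "\<And>r. r \<in> carrier A \<Longrightarrow> g (?f r) = r \<odot>\<^bsub>N\<^esub> z"
    using cyclic_hom[OF f surj M N z k] by blast
  have "g (r \<otimes> x) = r \<odot>\<^bsub>N\<^esub> z" if "r \<in> carrier A" for r using g(2)[OF that] that by simp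
  thus ?thesis using that[OF g(1)] by blast
qed

text \<open>As both multiplications are onto \<open>Q\<close>, \<open>LE_U\<close> makes the two
  annihilators principal: ann(a) = Ab and ann(b) = Aa, a pair of exact zero divisors.\<close>

lemma exact_pair:
  assumes "\<not> linked a"
  obtains b where "b \<in> J" "b \<notin> Q" "ann a = LE b Q" "ann b = U" "LE b Q = PIdl b" "U = PIdl a"
proof (rule not_linked_pair[OF a assms])
  fix b assume b: "b \<in> J" "b \<notin> Q" "ann a = LE b Q" "ann b = U"
    and onto: "\<And>q. q \<in> Q \<Longrightarrow> \<exists>j\<in>J. a \<otimes> j = q" "\<And>q. q \<in> Q \<Longrightarrow> \<exists>j\<in>J. b \<otimes> j = q"
  have "LE b Q = PIdl b" using onto(2) by (intro LE_U[OF b(1)]) blast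
  moreover have "U = PIdl a" using onto(1) by (intro LE_U[OF a(1)]) blast
  ultimately show thesis using that b by blast
qed

text \<open>\<open>b\<close> kills the image of \<open>a\<close> under \<open>\<phi>\<close>, which
  therefore lies in ann(b) = Aa, say as y a. As U(a) = Aa, multiplication by y agrees with
  \<open>\<phi>\<close> everywhere.\<close>

lemma not_linked_extends: assumes "\<not> linked a" shows "extends A U"
  unfolding extends_def
proof
  fix \<phi> assume \<phi>: "\<phi> \<in> mod_hom A ((regular_module A)\<lparr>carrier := U\<rparr>) (regular_module A)"
  obtain b where b': "b \<in> J" "b \<notin> Q" "ann a = LE b Q" "ann b = U" "LE b Q = PIdl b" "U = PIdl a"
    using exact_pair[OF assms] .
  note b = b'(1,3,4,6)
  have \<phi>a: "\<phi> a \<in> carrier A" using mod_hom_closed[OF \<phi>, of a] a_U by simp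
  have "b \<in> ann a" unfolding b(2) by (rule LE_self[OF b(1) Q_subset_J Q_zero])
  hence ba: "b \<otimes> a = \<zero>" using m_comm[of a b] a_carr by simp
  have "\<phi> (b \<otimes> a) = b \<otimes> \<phi> a" using mod_hom_smult[OF \<phi>, of b a] a_U b(1) by simp
  moreover have "\<phi> \<zero> = \<zero>" using mod_hom_zero[OF \<phi> submodule_mod[OF ideal_U] module_regular] by simp
  ultimately have "b \<otimes> \<phi> a = \<zero>" using ba by simp
  hence "\<phi> a \<in> ann b" using \<phi>a by simp
  hence "\<phi> a \<in> PIdl a" unfolding b(3,4) .
  then obtain y where y: "y \<in> carrier A" "\<phi> a = y \<otimes> a" unfolding cgenideal_def by blast
  have "\<phi> u = y \<otimes> u" if u: "u \<in> U" for u
  proof -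
    have "u \<in> PIdl a" using u unfolding b(4) .
    then obtain r where r: "r \<in> carrier A" "u = r \<otimes> a" unfolding cgenideal_def by blast
    have "\<phi> u = r \<otimes> \<phi> a" using mod_hom_smult[OF \<phi> r(1), of a] a_U r(2) by simp
    thus ?thesis using y r a_carr by (simp add: m_lcomm)
  qed
  thus "\<exists>y\<in>carrier A. \<forall>u\<in>U. \<phi> u = y \<otimes> u" using y(1) by blast
qed

lemma dim_line: "s \<in> carrier A \<Longrightarrow> s \<noteq> \<zero> \<Longrightarrow> dimension 1 S (LE s {\<zero>})"
  using dim_LE[OF zero_dim, of s] by simp

text \<open>The statement that all products are multiples of \<open>s\<close> gives no lower bound
  on xJ. But \<open>x\<close> lies outside the socle, so some product is nonzero, and rescaling its
  factor reaches \<open>s\<close> itself.\<close>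

lemma multiples_nonzero:
  assumes "x \<in> J" "x \<notin> Q" "s \<in> Q" "\<And>j. j \<in> J \<Longrightarrow> \<exists>k\<in>S. x \<otimes> j = k \<otimes> s"
  shows "s \<noteq> \<zero>" and "\<exists>j\<in>J. x \<otimes> j = s"
proof -
  obtain y where y: "y \<in> J" "x \<otimes> y \<noteq> \<zero>" using nonzero_mult[OF assms(1,2)] .
  obtain k where k: "k \<in> S" "x \<otimes> y = k \<otimes> s" using assms(4)[OF y(1)] by blast
  have c: "x \<in> carrier A" "y \<in> carrier A" "s \<in> carrier A" "k \<in> carrier A" using assms y k by auto
  show "s \<noteq> \<zero>" using k(2) y(2) c by auto
  have k0: "k \<noteq> \<zero>" using k(2) y(2) c by auto
  note i = S_inv[OF k(1) k0]
  have ic: "inv k \<in> carrier A" using i(1) by simp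
  have "x \<otimes> (inv k \<otimes> y) = inv k \<otimes> (x \<otimes> y)" using c ic by (simp add: m_lcomm)
  also have "\<dots> = (inv k \<otimes> k) \<otimes> s" unfolding k(2) using c ic by (simp add: m_assoc)
  also have "\<dots> = s" using i(2) c by simp
  finally show "\<exists>j\<in>J. x \<otimes> j = s" using y(1) ic by (intro bexI[of _ "inv k \<otimes> y"]) auto
qed

lemma not_Q_line: assumes "s \<in> Q" "x \<in> J" "x \<notin> Q" shows "x \<notin> LE s {\<zero>}"
  using assms LE_zero_iff[of s x] by auto

text \<open>If aJ = Q, then U(a) = Aa, and a \<mapsto> d is well defined because ann(a) kills
  \<open>d\<close>; were it a multiplication, \<open>d\<close> would lie in Aa. If aJ is a line ks,
  the map that fixes some t in \<open>Q\<close> off the line and kills ka + ks is A-linear; a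
  multiplication killing \<open>a\<close> is by an element of \<open>J\<close>, which kills
  t.\<close>

lemma linked_not_extends: assumes "linked a" shows "\<not> extends A U"
proof
  assume ext: "extends A U"
  show False
    using a assms
  proof (cases rule: linked_cases)
    case (onto b s d)
    have Ua: "U = PIdl a" using onto(4) by (intro LE_U[OF a(1)]) blast
    have d: "d \<in> carrier (regular_module A)" using onto(7) by simp
    have "r \<odot>\<^bsub>regular_module A\<^esub> d = \<zero>\<^bsub>regular_module A\<^esub>" if "r \<in> ann a" for r
    proof -
      have "r \<in> LE b Q" using that onto(3) by simp
      then obtain k q where r: "k \<in> S" "q \<in> Q" "r = k \<otimes> b \<oplus> q" by (rule LE_QE)
      have "r \<otimes> d = k \<otimes> (b \<otimes> d) \<oplus> q \<otimes> d"
        unfolding r(3) using S_carr[OF r(1)] Q_carr[OF r(2)] J_carr[OF onto(1)] J_carr[OF onto(7)] by algebra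
      thus ?thesis using onto(9) QJ_zero[OF r(2) onto(7)] r(1) by simp
    qed
    from PIdl_hom[OF a_carr module_regular d this]
    obtain g where g: "g \<in> mod_hom A ((regular_module A)\<lparr>carrier := U\<rparr>) (regular_module A)"
      "\<And>r. r \<in> carrier A \<Longrightarrow> g (r \<otimes> a) = r \<otimes> d" unfolding Ua by auto
    obtain y where y: "y \<in> carrier A" "\<And>u. u \<in> U \<Longrightarrow> g u = y \<otimes> u" using ext g(1) unfolding extends_def by blast
    have "d = y \<otimes> a" using g(2)[OF one_closed] y(2)[OF a_U] a_carr onto(7) by simp
    hence "d \<in> U" unfolding Ua cgenideal_def using y(1) by blast
    thus False using onto(8) by blast
  next
    case (not_onto s b c)
    note s0 = multiples_nonzero(1)[OF a not_onto(1,2)]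
    have cs: "s \<in> carrier A" using not_onto(1) by simp
    have d1: "dimension 1 S (LE s {\<zero>})" by (rule dim_line[OF cs s0])
    obtain t where t: "t \<in> Q" "t \<notin> LE s {\<zero>}" using dim_pick[OF dim_Q d1] by auto
    have ct: "t \<in> carrier A" using t by simp
    \<comment> \<open>A hyperplane of U(a) that contains aJ = ks, hence the product of
      \<open>J\<close> with U(a), as \<open>functional_hom\<close> requires.\<close>
    let ?E = "LE a (LE s {\<zero>})"
    have dE: "dimension 2 S ?E" using dim_LE[OF d1 a_carr not_Q_line[OF not_onto(1) a]] by (simp add: numeral_2_eq_2)
    note E_props = space_subgroup_props[OF subfield_S dE]
    have Emem: "u \<in> ?E \<longleftrightarrow> (\<exists>k\<in>S. \<exists>l\<in>S. u = k \<otimes> a \<oplus> l \<otimes> s)" for u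
      unfolding LE_iff[of u a] Bex_def LE_zero_iff[OF cs] by blast
    have tE: "t \<notin> ?E"
    proof
      assume "t \<in> ?E"
      then obtain k l where kl: "k \<in> S" "l \<in> S" "t = k \<otimes> a \<oplus> l \<otimes> s" unfolding Emem by blast
      have c: "k \<in> carrier A" "l \<in> carrier A" using kl by auto
      have "k \<otimes> a = t \<ominus> l \<otimes> s" unfolding kl(3) using c a_carr cs by algebra
      hence ka: "k \<otimes> a \<in> Q" using t(1) not_onto(1) c by simp
      have "k = \<zero>"
      proof (rule ccontr)
        assume "k \<noteq> \<zero>"
        thus False using space_subgroup_props(6)[OF subfield_S dim_Q, of k a] kl(1) a_carr ka a(2) by blast
      qed
      hence "t = l \<otimes> s" using kl(3) c a_carr cs by simp
      thus False using t(2) kl(2) unfolding LE_zero_iff[OF cs] by blast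
    qed
    have "LE t ?E \<subseteq> U"
    proof
      fix u assume "u \<in> LE t ?E"
      then obtain m v where m: "m \<in> S" "v \<in> ?E" "u = m \<otimes> t \<oplus> v" unfolding LE_iff[of u t] by blast
      obtain k l where k: "k \<in> S" "l \<in> S" "v = k \<otimes> a \<oplus> l \<otimes> s" using m(2) unfolding Emem by blast
      have "u = k \<otimes> a \<oplus> (m \<otimes> t \<oplus> l \<otimes> s)"
        unfolding m(3) k(3) using S_carr[OF m(1)] S_carr[OF k(1)] S_carr[OF k(2)] ct cs a_carr by algebra
      thus "u \<in> U" by (rule LE_QI[OF k(1), rotated]) (use m(1) k(2) t(1) not_onto(1) in simp)
    qed
    moreover have "dimension 3 S (LE t ?E)" using dim_LE[OF dE ct tE] by (simp add: numeral_eq_Suc)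
    ultimately have Ut: "LE t ?E = U" using dim_eq[OF _ dim_U] by blast
    have JU: "j \<otimes> w \<in> ?E" if j: "j \<in> J" and w: "w \<in> LE t ?E" for j w
    proof -
      obtain k q where k: "k \<in> S" "q \<in> Q" "w = k \<otimes> a \<oplus> q" using w unfolding Ut by (rule LE_QE)
      obtain l where l: "l \<in> S" "a \<otimes> j = l \<otimes> s" using not_onto(2)[OF j] by blast
      have c: "k \<in> carrier A" "l \<in> carrier A" "q \<in> carrier A" "j \<in> carrier A" using k l j by auto
      have "j \<otimes> w = k \<otimes> (a \<otimes> j) \<oplus> j \<otimes> q" unfolding k(3) using c a_carr by algebra
      also have "\<dots> = \<zero> \<otimes> a \<oplus> (k \<otimes> l) \<otimes> s" unfolding l(2) JQ_zero[OF j k(2)] using c cs a_carr by algebra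
      finally show ?thesis unfolding Emem using k(1) l(1) by (intro bexI[of _ \<zero>] bexI[of _ "k \<otimes> l"]) auto
    qed
    have id: "ideal (LE t ?E) A" "LE t ?E \<subseteq> J" unfolding Ut by (rule ideal_U, rule U_J)
    obtain h where h: "h \<in> mod_hom A ((regular_module A)\<lparr>carrier := U\<rparr>) (regular_module A)"
      "\<And>k v. k \<in> S \<Longrightarrow> v \<in> ?E \<Longrightarrow> h (k \<otimes> t \<oplus> v) = k \<otimes> t"
      using functional_hom[OF dE ct tE id JU t(1)] unfolding Ut by blast
    obtain y where y: "y \<in> carrier A" "\<And>u. u \<in> U \<Longrightarrow> h u = y \<otimes> u" using ext h(1) unfolding extends_def by blast
    have tU: "t \<in> U" using LE_incl[OF a(1) Q_subset_J] t(1) by blast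
    have ht: "h t = t" using h(2)[of \<one> \<zero>] E_props(2) ct by simp
    have "a \<in> ?E" unfolding Emem using a_carr cs by (intro bexI[of _ \<one>] bexI[of _ \<zero>]) auto
    hence "h a = \<zero>" using h(2)[of \<zero> a] ct a_carr by simp
    hence "y \<otimes> a = \<zero>" using y(2)[OF a_U] by simp
    hence "y \<in> J" using ann_notin_J[OF y(1) a_carr] not_Q_nonzero[OF a(2)] by blast
    hence "y \<otimes> t = \<zero>" using JQ_zero t(1) by blast
    hence "t = \<zero>" using ht y(2)[OF tU] by simp
    thus False using t(2) LE_zero_iff[OF cs, of t] cs by (metis S_props(2) l_null)
  qed
qed

section \<open>The dual of C(a) and its trace in A\<close>

abbreviation "T \<equiv> (regular_module A)\<lparr>carrier := ann a\<rparr>"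

text \<open>Together with \<open>dual_exists\<close>: evaluation at the generator
  \<open>\<pi> \<one>\<close> identifies the dual of C(a) with ann(a).\<close>

lemma dual_value:
  assumes \<phi>: "\<phi> \<in> mod_hom A C (regular_module A)"
  shows "r \<in> carrier A \<Longrightarrow> \<phi> (\<pi> r) = r \<otimes> \<phi> (\<pi> \<one>)" and "\<phi> (\<pi> \<one>) \<in> ann a"
proof -
  have val: "\<phi> (\<pi> r) = r \<otimes> \<phi> (\<pi> \<one>)" if "r \<in> carrier A" for r
    using mod_hom_regular[OF \<pi>_hom that] mod_hom_smult[OF \<phi> that \<pi>_closed[OF one_closed]] by simp
  thus "r \<in> carrier A \<Longrightarrow> \<phi> (\<pi> r) = r \<otimes> \<phi> (\<pi> \<one>)" .
  have "\<pi> a = \<zero>\<^bsub>C\<^esub>" using \<pi>_ker[OF a_carr] a_U by blast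
  hence "\<phi> (\<pi> a) = \<zero>" using mod_hom_zero[OF \<phi> C_mod module_regular] by simp
  hence "a \<otimes> \<phi> (\<pi> \<one>) = \<zero>" using val[OF a_carr] by simp
  moreover have "\<phi> (\<pi> \<one>) \<in> carrier A" using mod_hom_closed[OF \<phi> \<pi>_closed[OF one_closed]] by simp
  ultimately show "\<phi> (\<pi> \<one>) \<in> ann a" by simp
qed

lemma dual_exists:
  assumes z: "z \<in> ann a"
  obtains \<phi> where "\<phi> \<in> mod_hom A C (regular_module A)" "\<And>r. r \<in> carrier A \<Longrightarrow> \<phi> (\<pi> r) = r \<otimes> z"
proof -
  have zc: "z \<in> carrier (regular_module A)" using z by simp
  have ker: "r \<odot>\<^bsub>regular_module A\<^esub> z = \<zero>\<^bsub>regular_module A\<^esub>" if "r \<in> carrier A" "\<pi> r = \<zero>\<^bsub>C\<^esub>" for r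
    using U_ann[OF _ z, of r] \<pi>_ker[OF that(1)] that(2) by simp
  from cyclic_hom[OF \<pi>_hom \<pi>_surj C_mod module_regular zc ker] that show ?thesis by auto
qed

lemma ideal_ann: "ideal (ann a) A"
proof (rule idealI[OF ring_axioms])
  show "subgroup (ann a) (add_monoid A)"
  proof (rule add.subgroupI)
    have "\<zero> \<in> ann a" using a_carr by simp
    thus "ann a \<noteq> {}" by blast
  qed (use a_carr in \<open>auto simp: r_distr r_minus\<close>)
  fix z x assume "z \<in> ann a" and x: "x \<in> carrier A"
  hence z: "z \<in> carrier A" "a \<otimes> z = \<zero>" by auto
  have "a \<otimes> (x \<otimes> z) = x \<otimes> (a \<otimes> z)" "a \<otimes> (z \<otimes> x) = x \<otimes> (a \<otimes> z)"
    using a_carr z(1) x by (simp_all add: m_ac)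
  thus "x \<otimes> z \<in> ann a" "z \<otimes> x \<in> ann a" using z x by simp_all
qed

text \<open>Every image consists of multiples of an element of ann(a), and each z in ann(a) is the
  value at the generator of some homomorphism.\<close>

lemma trace_eq: "trace_submodule A C (regular_module A) = ann a"
proof
  interpret reg: module A "regular_module A" by (rule module_regular)
  have sub: "(\<Union>f\<in>mod_hom A C (regular_module A). f ` carrier C) \<subseteq> ann a"
  proof (rule UN_least, rule image_subsetI)
    fix \<phi> x assume \<phi>: "\<phi> \<in> mod_hom A C (regular_module A)" and "x \<in> carrier C"
    then obtain r where r: "r \<in> carrier A" "x = \<pi> r" by (elim C_E)
    show "\<phi> x \<in> ann a"
      unfolding r(2) dual_value(1)[OF \<phi> r(1)] by (rule ideal.I_l_closed[OF ideal_ann dual_value(2)[OF \<phi>] r(1)])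
  qed
  show "trace_submodule A C (regular_module A) \<subseteq> ann a"
    unfolding trace_submodule_def
    using reg.submodule_gen_least[OF _ sub] ideal_ann by (simp only: regular_submodule_iff)
  show "ann a \<subseteq> trace_submodule A C (regular_module A)"
  proof
    fix z assume z: "z \<in> ann a"
    then obtain \<phi> where \<phi>: "\<phi> \<in> mod_hom A C (regular_module A)" "\<And>r. r \<in> carrier A \<Longrightarrow> \<phi> (\<pi> r) = r \<otimes> z"
      using dual_exists by blast
    have "\<phi> (\<pi> \<one>) = z" using \<phi>(2)[OF one_closed] z by simp
    hence "z \<in> \<phi> ` carrier C" using \<pi>_closed[OF one_closed] by blast
    hence "z \<in> (\<Union>f\<in>mod_hom A C (regular_module A). f ` carrier C)" using \<phi>(1) by blast
    thus "z \<in> trace_submodule A C (regular_module A)"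
      unfolding trace_submodule_def by (rule subsetD[OF submodule_gen_incl])
  qed
qed

text \<open>Here ann(a) = Ab, which is A modulo ann(b) = U(a), so \<open>cyclic_atom\<close> applies
  to multiplication by \<open>b\<close>.\<close>

lemma not_linked_atom_T: assumes "\<not> linked a" shows "atom_module A T"
proof -
  obtain b where b: "b \<in> J" "b \<notin> Q" "ann a = LE b Q" "ann b = U" "LE b Q = PIdl b" "U = PIdl a"
    using exact_pair[OF assms] .
  have cb: "b \<in> carrier A" using b by simp
  have eq: "ann a = PIdl b" unfolding b(3,5) ..
  let ?f = "\<lambda>r\<in>carrier (regular_module A). r \<otimes> b"
  have f: "?f \<in> mod_hom A (regular_module A) T"
  proof (rule mod_homI[OF _ _ _ module_regular])
    show "r \<otimes> b \<in> carrier T" if "r \<in> carrier (regular_module A)" for r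
      unfolding eq using that by (auto simp: cgenideal_def)
  qed (use cb in \<open>simp_all add: l_distr m_assoc\<close>)
  have surj: "?f ` carrier A = carrier T" unfolding eq by (auto simp: cgenideal_def)
  have ker: "?f r = \<zero>\<^bsub>T\<^esub> \<longleftrightarrow> r \<in> U" if "r \<in> carrier A" for r
    unfolding b(4)[symmetric] using that m_comm[OF that cb] by simp
  show ?thesis by (rule cyclic_atom[OF a f surj submodule_mod[OF ideal_ann] ker])
qed

lemma maximal_ideal_step:
  assumes I: "ideal I1 A" "ideal I2 A" "I1 \<subseteq> I2" "dimension n S I1" "dimension (Suc n) S I2"
  shows "maximal_submodule I1 A ((regular_module A)\<lparr>carrier := I2\<rparr>)"
proof -
  let ?f = "\<lambda>x\<in>carrier (regular_module A). x"
  have f: "?f \<in> mod_hom A (regular_module A) (regular_module A)"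
    by (rule mod_homI[OF _ _ _ module_regular]) auto
  have im: "?f ` I = I" if "ideal I A" for I
  proof -
    have "?f ` I = (\<lambda>x. x) ` I" using ideal.Icarr[OF that] by (intro image_cong) auto
    thus ?thesis by simp
  qed
  have z: "\<zero> \<in> I1" using I(1) by (simp add: additive_subgroup.zero_closed ideal.axioms(1))
  have ker: "x \<in> I1" if "x \<in> carrier A" "?f x = \<zero>\<^bsub>regular_module A\<^esub>" for x using that z by simp
  show ?thesis
    using maximal_submodule_image[OF f module_regular ker I] unfolding im[OF I(1)] im[OF I(2)] .
qed

text \<open>Two different maximal submodules of ann(a) contradict locality. If ann(a) = kb + Q, they
  are \<open>Q\<close> and Ab = kb + ks; if ann(a) = kc + kb + Q, they are kb + Q and kc +
  Q.\<close>

lemma linked_not_atom_T: assumes "linked a" shows "\<not> atom_module A T"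
proof
  assume "atom_module A T"
  hence "local_module A T" unfolding atom_module_def by blast
  then obtain N where N: "\<And>N'. maximal_submodule N' A T \<Longrightarrow> N' = N"
    unfolding local_module_def by (elim ex1E) blast
  show False
    using a assms
  proof (cases rule: linked_cases)
    case (onto b s d)
    have cb: "b \<in> carrier A" "s \<in> carrier A" using onto(1,5) by simp_all
    note s0 = multiples_nonzero[OF onto(1,2,5,6)]
    have d2: "dimension 2 S (LE b (LE s {\<zero>}))"
      using dim_LE[OF dim_line[OF cb(2) s0(1)] cb(1) not_Q_line[OF onto(5,1,2)]] by (simp add: numeral_2_eq_2)
    have mem: "u \<in> LE b (LE s {\<zero>}) \<longleftrightarrow> (\<exists>k\<in>S. \<exists>l\<in>S. u = k \<otimes> b \<oplus> l \<otimes> s)" for u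
      unfolding LE_iff[of u b] Bex_def LE_zero_iff[OF cb(2)] by blast
    obtain i where i: "i \<in> J" "b \<otimes> i = s" using s0(2) by blast
    \<comment> \<open>Ab has dimension 2 instead of 3 because bJ is the line ks and not all of
      \<open>Q\<close>.\<close>
    have "PIdl b = LE b (LE s {\<zero>})"
    proof
      show "PIdl b \<subseteq> LE b (LE s {\<zero>})"
      proof
        fix u assume "u \<in> PIdl b"
        then obtain r where r: "r \<in> carrier A" "u = r \<otimes> b" unfolding cgenideal_def by blast
        obtain l j where l: "l \<in> S" "j \<in> J" "r = l \<oplus> j" using eigenvalue[OF r(1)] .
        obtain k where k: "k \<in> S" "b \<otimes> j = k \<otimes> s" using onto(6)[OF l(2)] by blast
        have "u = l \<otimes> b \<oplus> b \<otimes> j" unfolding r(2) l(3) using cb S_carr[OF l(1)] J_carr[OF l(2)] by algebra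
        thus "u \<in> LE b (LE s {\<zero>})" unfolding mem k(2) using l(1) k(1) by blast
      qed
      show "LE b (LE s {\<zero>}) \<subseteq> PIdl b"
      proof
        fix u assume "u \<in> LE b (LE s {\<zero>})"
        then obtain k l where kl: "k \<in> S" "l \<in> S" "u = k \<otimes> b \<oplus> l \<otimes> s" unfolding mem by blast
        have "u = (k \<oplus> l \<otimes> i) \<otimes> b" unfolding kl(3) i(2)[symmetric]
          using cb S_carr[OF kl(1)] S_carr[OF kl(2)] J_carr[OF i(1)] by algebra
        moreover have "k \<oplus> l \<otimes> i \<in> carrier A" using kl i by simp
        ultimately show "u \<in> PIdl b" unfolding cgenideal_def by blast
      qed
    qed
    hence id: "ideal (LE b (LE s {\<zero>})) A" using cgenideal_ideal[OF cb(1)] by simp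
    have dT: "dimension (Suc 2) S (ann a)"
      unfolding onto(3) using dim_LE[OF dim_Q cb(1) onto(2)] .
    have sub: "LE b (LE s {\<zero>}) \<subseteq> ann a"
    proof
      fix u assume "u \<in> LE b (LE s {\<zero>})"
      then obtain k l where kl: "k \<in> S" "l \<in> S" "u = k \<otimes> b \<oplus> l \<otimes> s" unfolding mem by blast
      show "u \<in> ann a" unfolding onto(3) by (rule LE_QI[OF kl(1) _ kl(3)]) (use kl onto(5) in simp)
    qed
    have subQ: "Q \<subseteq> ann a" unfolding onto(3) by (rule LE_incl[OF onto(1) Q_subset_J])
    have "LE b (LE s {\<zero>}) = N" "Q = N"
      using N[OF maximal_ideal_step[OF id ideal_ann sub d2 dT]]
        N[OF maximal_ideal_step[OF ideal_Q ideal_ann subQ dim_Q dT]] .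
    moreover have "b \<in> LE b (LE s {\<zero>})"
      unfolding mem using cb by (intro bexI[of _ \<one>] bexI[of _ \<zero>]) auto
    ultimately show False using onto(2) by blast
  next
    case (not_onto s b c)
    have bQ: "LE b Q \<subseteq> J" by (rule LE_in_J[OF not_onto(3) Q_subset_J])
    have cQ: "c \<notin> Q" using not_onto(6) LE_incl[OF not_onto(3) Q_subset_J] by blast
    have cc: "c \<in> carrier A" using not_onto(5) by simp
    note d = dim_LE2[OF not_onto(3-6)]
    have d3: "dimension 3 S (LE c Q)" using dim_LE[OF dim_Q cc cQ] by (simp add: numeral_eq_Suc)
    have dT: "dimension (Suc 3) S (ann a)" using d(2) unfolding not_onto(7) by (simp add: numeral_eq_Suc)
    have sub1: "LE b Q \<subseteq> ann a" unfolding not_onto(7) by (rule LE_incl[OF not_onto(5) bQ])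
    have sub2: "LE c Q \<subseteq> ann a"
    proof
      fix u assume "u \<in> LE c Q"
      then obtain k q where k: "k \<in> S" "q \<in> Q" "u = k \<otimes> c \<oplus> q" by (rule LE_QE)
      have "q \<in> LE b Q" using LE_incl[OF not_onto(3) Q_subset_J] k(2) by blast
      thus "u \<in> ann a" unfolding not_onto(7) k(3) LE_iff[of "k \<otimes> c \<oplus> q" c] using k(1) by blast
    qed
    have "LE b Q = N" "LE c Q = N"
      using N[OF maximal_ideal_step[OF ideal_LE[OF not_onto(3)] ideal_ann sub1 d(1) dT]]
        N[OF maximal_ideal_step[OF ideal_LE[OF not_onto(5)] ideal_ann sub2 d3 dT]] .
    thus False using LE_self[OF not_onto(5) Q_subset_J Q_zero] not_onto(6) by blast
  qed
qed

section \<open>Consequences of an exact pair of zero divisors\<close>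

lemma rank1_mod: "module A rank1"
  by (rule free_module_module)

lemma vector1_zero_iff: "r \<in> carrier A \<Longrightarrow> b \<in> carrier A \<Longrightarrow>
    r \<odot>\<^bsub>rank1\<^esub> {vector1 b} = \<zero>\<^bsub>rank1\<^esub> \<longleftrightarrow> r \<otimes> b = \<zero>"
  by (simp only: free_module_1_smult free_module_1_zero) (auto dest: vector1_inject[THEN iffD1])

text \<open>C(a) = A/U(a) and U(a) = ann(b), so C(a) is isomorphic to Ab inside the free module of
  rank one.\<close>

lemma C_embeds:
  assumes b: "b \<in> carrier A" "ann b = U"
  obtains g where "g \<in> mod_hom A C rank1" "inj_on g (carrier C)" "g ` carrier C = mult_map b ` carrier rank1"
proof -
  have ker: "\<pi> r = \<zero>\<^bsub>C\<^esub> \<longleftrightarrow> r \<odot>\<^bsub>rank1\<^esub> {vector1 b} = \<zero>\<^bsub>rank1\<^esub>" if "r \<in> carrier A" for r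
  proof -
    have "r \<in> U \<longleftrightarrow> r \<otimes> b = \<zero>" unfolding b(2)[symmetric] using that m_comm[OF that b(1)] by simp
    thus ?thesis unfolding vector1_zero_iff[OF that b(1)] \<pi>_ker[OF that] .
  qed
  have "(\<lambda>r. r \<odot>\<^bsub>rank1\<^esub> {vector1 b}) ` carrier A = mult_map b ` carrier rank1"
    unfolding mult_map_image[OF b(1)] by (rule image_cong[OF refl free_module_1_smult])
  thus ?thesis
    using cyclic_iso[OF \<pi>_hom \<pi>_surj C_mod rank1_mod vector1_rank1[OF b(1)] ker] that by metis
qed

lemma mult_map_image_mod: "b \<in> carrier A \<Longrightarrow> module A (rank1\<lparr>carrier := mult_map b ` carrier rank1\<rparr>)"
  by (rule submodule.submodule_is_module[OF mod_hom_image_submodule[OF mult_map(1) rank1_mod rank1_mod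
        module.carrier_is_submodule[OF rank1_mod]] rank1_mod])

lemma C_iso:
  assumes b: "b \<in> carrier A" "ann b = U"
  shows "mod_iso A C (rank1\<lparr>carrier := mult_map b ` carrier rank1\<rparr>)"
proof -
  obtain g where g: "g \<in> mod_hom A C rank1" "inj_on g (carrier C)" "g ` carrier C = mult_map b ` carrier rank1"
    using C_embeds[OF b] .
  have "g \<in> mod_hom A C (rank1\<lparr>carrier := mult_map b ` carrier rank1\<rparr>)"
    by (rule mod_hom_codomain[OF g(1)]) (simp only: g(3))
  moreover have "bij_betw g (carrier C) (carrier (rank1\<lparr>carrier := mult_map b ` carrier rank1\<rparr>))"
    using g(2,3) by (simp add: bij_betw_def)
  ultimately show ?thesis unfolding mod_iso_def by blast
qed

lemma not_linked_torsionless: assumes "\<not> linked a" shows "torsionless A C"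
proof -
  obtain b where b: "b \<in> J" "b \<notin> Q" "ann a = LE b Q" "ann b = U" "LE b Q = PIdl b" "U = PIdl a"
    using exact_pair[OF assms] .
  obtain g where "g \<in> mod_hom A C rank1" "inj_on g (carrier C)"
    using C_embeds[OF J_carr[OF b(1)] b(4)] .
  thus ?thesis unfolding torsionless_def using fg_projective_free_module by blast
qed

lemma not_linked_gorenstein: assumes "\<not> linked a" shows "gorenstein_projective A C"
proof -
  obtain b where b: "b \<in> J" "b \<notin> Q" "ann a = LE b Q" "ann b = U" "LE b Q = PIdl b" "U = PIdl a"
    using exact_pair[OF assms] .
  have cb: "b \<in> carrier A" using b by simp
  have ann: "ann a = PIdl b" "ann b = PIdl a" using b by simp_all
  \<comment> \<open>Even indices carry \<open>b\<close>, so that the image of \<open>f 0\<close> is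
    Ab, the copy of C(a).\<close>
  define f where "f = (\<lambda>i::int. mult_map (if even i then b else a))"
  have f: "f i \<in> mod_hom A rank1 rank1" for i using mult_map(1) cb a_carr by (simp add: f_def)
  have ex: "f (i + 1) ` carrier rank1 = mod_ker rank1 rank1 (f i)" for i
    using mult_map_exact[OF a_carr cb ann(2)] mult_map_exact[OF cb a_carr ann(1)]
    by (cases "even i") (simp_all only: f_def even_plus_one_iff not_True_eq_False not_False_eq_True if_True if_False)
  have dex: "pullback rank1 (f i) ` carrier (dual_module A rank1) =
      mod_ker (dual_module A rank1) (dual_module A rank1) (pullback rank1 (f (i + 1)))" for i
    using mult_map_dual_exact[OF a_carr cb ann(2)] mult_map_dual_exact[OF cb a_carr ann(1)]
    by (cases "even i") (simp_all only: f_def even_plus_one_iff not_True_eq_False not_False_eq_True if_True if_False)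
  have iso: "mod_iso A C (rank1\<lparr>carrier := f 0 ` carrier rank1\<rparr>)"
    using C_iso[OF cb b(4)] by (simp only: f_def even_zero if_True)
  show ?thesis
    unfolding gorenstein_projective_def
    by (rule exI[of _ "\<lambda>_. rank1"], rule exI[of _ f]) (intro conjI allI fg_projective_free_module f ex dex iso)
qed

lemma free_projective_cover:
  assumes M: "module A M" and m: "m \<in> carrier M" and surj: "(\<lambda>r. r \<odot>\<^bsub>M\<^esub> m) ` carrier A = carrier M"
    and ker: "\<And>r. r \<in> carrier A \<Longrightarrow> r \<odot>\<^bsub>M\<^esub> m = \<zero>\<^bsub>M\<^esub> \<Longrightarrow> r \<in> J"
  shows "projective_cover A rank1 (free_hom A M 1 (\<lambda>_. m)) M"
proof -
  let ?p = "free_hom A M 1 (\<lambda>_. m)"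
  interpret F: module A rank1 by (rule rank1_mod)
  have p: "?p \<in> mod_hom A rank1 M" by (rule free_hom_mod_hom[OF M m])
  have ap: "?p {vector1 r} = r \<odot>\<^bsub>M\<^esub> m" if "r \<in> carrier A" for r by (rule rank1_hom_apply[OF M m that])
  have "?p ` carrier rank1 = (\<lambda>r. r \<odot>\<^bsub>M\<^esub> m) ` carrier A"
    unfolding free_module_1_carrier image_image by (rule image_cong[OF refl ap])
  hence sp: "?p ` carrier rank1 = carrier M" using surj by simp
  have "L = carrier rank1" if L: "submodule L A rank1" "L <+>\<^bsub>rank1\<^esub> mod_ker rank1 M ?p = carrier rank1" for L
  proof
    have Lc: "L \<subseteq> carrier rank1" by (rule F.submoduleE(1)[OF L(1)])
    show "L \<subseteq> carrier rank1" by (rule Lc)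
    have "{vector1 \<one>} \<in> L <+>\<^bsub>rank1\<^esub> mod_ker rank1 M ?p" unfolding L(2) by (rule vector1_rank1[OF one_closed])
    then obtain Y Z where YZ: "Y \<in> L" "Z \<in> mod_ker rank1 M ?p" "{vector1 \<one>} = Y \<oplus>\<^bsub>rank1\<^esub> Z"
      by (rule set_addE)
    obtain y where y: "y \<in> carrier A" "Y = {vector1 y}" using subsetD[OF Lc YZ(1)] by (rule rank1E)
    have Zc: "Z \<in> carrier rank1" "?p Z = \<zero>\<^bsub>M\<^esub>" using YZ(2) unfolding mod_ker_def by blast+
    obtain z where z: "z \<in> carrier A" "Z = {vector1 z}" using Zc(1) by (rule rank1E)
    have zJ: "z \<in> J" using ker[OF z(1)] Zc(2) ap[OF z(1)] z(2) by simp
    have "vector1 \<one> = (\<lambda>i. vector1 y i \<oplus> vector1 z i)"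
      using YZ(3) unfolding y(2) z(2) by (simp only: free_module_simps the_elem_eq singleton_inject)
    from fun_cong[OF this, of 0] have one: "\<one> = y \<oplus> z" by (simp only: vector1(2))
    have "y \<in> Units A"
    proof -
      have "\<one> \<ominus> z = y" unfolding one using y(1) z(1) by algebra
      thus ?thesis using unit_one_minus[OF zJ] by simp
    qed
    then obtain v where v: "v \<in> carrier A" "v \<otimes> y = \<one>" using Units_l_inv_ex by blast
    show "carrier rank1 \<subseteq> L"
    proof
      fix W assume "W \<in> carrier rank1"
      then obtain r where r: "r \<in> carrier A" "W = {vector1 r}" by (rule rank1E)
      have rv: "r \<otimes> v \<in> carrier A" using r v by simp
      have "(r \<otimes> v) \<odot>\<^bsub>rank1\<^esub> Y = {vector1 ((r \<otimes> v) \<otimes> y)}" unfolding y(2) by (rule free_module_1_smult[OF rv])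
      also have "(r \<otimes> v) \<otimes> y = r" using r v y by (simp add: m_assoc)
      finally show "W \<in> L" unfolding r(2) using F.submoduleE(4)[OF L(1) rv YZ(1)] by simp
    qed
  qed
  thus ?thesis unfolding projective_cover_def using fg_projective_free_module p sp by blast
qed

text \<open>The cover of C(a) by A has kernel U(a) = Aa, and the cover of Aa by A has kernel ann(a)
  = Ab, which is isomorphic to C(a). The intermediate syzygy \<open>?N\<close> is Aa.\<close>

lemma not_linked_periodic: assumes "\<not> linked a" shows "Omega_periodic_le2 A C"
proof -
  obtain b where b: "b \<in> J" "b \<notin> Q" "ann a = LE b Q" "ann b = U" "LE b Q = PIdl b" "U = PIdl a"
    using exact_pair[OF assms] .
  have cb: "b \<in> carrier A" using b by simp
  have ann: "ann a = PIdl b" "ann b = PIdl a" using b by simp_all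
  let ?p = "free_hom A C 1 (\<lambda>_. \<pi> \<one>)"
  let ?N = "rank1\<lparr>carrier := mult_map a ` carrier rank1\<rparr>"
  have \<pi>1: "\<pi> r = r \<odot>\<^bsub>C\<^esub> \<pi> \<one>" if "r \<in> carrier A" for r by (rule mod_hom_regular[OF \<pi>_hom that])
  have N: "module A ?N" by (rule mult_map_image_mod[OF a_carr])
  have "(\<lambda>r. r \<odot>\<^bsub>C\<^esub> \<pi> \<one>) ` carrier A = \<pi> ` carrier A" by (rule image_cong[OF refl \<pi>1[symmetric]])
  hence imC: "(\<lambda>r. r \<odot>\<^bsub>C\<^esub> \<pi> \<one>) ` carrier A = carrier C" unfolding \<pi>_surj .
  have kerC: "r \<in> J" if "r \<in> carrier A" "r \<odot>\<^bsub>C\<^esub> \<pi> \<one> = \<zero>\<^bsub>C\<^esub>" for r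
    using that(2) unfolding \<pi>1[OF that(1), symmetric] \<pi>_ker[OF that(1)] by (rule subsetD[OF U_J])
  have cov1: "projective_cover A rank1 ?p C"
    by (rule free_projective_cover[OF C_mod \<pi>_closed[OF one_closed] imC kerC])
  have "mod_ker rank1 C ?p = mult_map a ` carrier rank1"
  proof -
    have "?p {vector1 r} = \<zero>\<^bsub>C\<^esub> \<longleftrightarrow> mult_map b {vector1 r} = \<zero>\<^bsub>rank1\<^esub>" if r: "r \<in> carrier A" for r
    proof -
      have "?p {vector1 r} = \<zero>\<^bsub>C\<^esub> \<longleftrightarrow> r \<in> ann b"
        unfolding rank1_hom_apply[OF C_mod \<pi>_closed[OF one_closed] r] \<pi>1[OF r, symmetric] \<pi>_ker[OF r] b(4) ..
      also have "\<dots> \<longleftrightarrow> r \<otimes> b = \<zero>" using r m_comm[OF r cb] by simp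
      also have "\<dots> \<longleftrightarrow> mult_map b {vector1 r} = \<zero>\<^bsub>rank1\<^esub>"
        unfolding mult_map(2)[OF cb r] free_module_1_zero using vector1_inject by blast
      finally show ?thesis .
    qed
    hence "mod_ker rank1 C ?p = mod_ker rank1 rank1 (mult_map b)"
      unfolding mod_ker_def free_module_1_carrier by blast
    thus ?thesis using mult_map_exact[OF a_carr cb ann(2)] by simp
  qed
  hence syz1: "is_syzygy A C ?N"
    unfolding is_syzygy_def using cov1 mod_iso_refl[OF N] by metis
  let ?m = "{vector1 a}"
  let ?q = "free_hom A ?N 1 (\<lambda>_. ?m)"
  have m: "?m \<in> carrier ?N"
    using mult_map_image[OF a_carr] a_carr by (simp only: module.simps ring.simps partial_object.simps) (force intro!: image_eqI[of _ _ \<one>])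
  have imN: "(\<lambda>r. r \<odot>\<^bsub>?N\<^esub> ?m) ` carrier A = carrier ?N"
  proof -
    have "(\<lambda>r. r \<odot>\<^bsub>rank1\<^esub> ?m) ` carrier A = mult_map a ` carrier rank1"
      unfolding mult_map_image[OF a_carr] by (rule image_cong[OF refl free_module_1_smult])
    thus ?thesis by (simp del: free_module_simps)
  qed
  have kerN: "r \<odot>\<^bsub>?N\<^esub> ?m = \<zero>\<^bsub>?N\<^esub> \<longleftrightarrow> r \<otimes> a = \<zero>" if "r \<in> carrier A" for r
    using vector1_zero_iff[OF that a_carr] by (simp del: free_module_simps)
  have kJ: "r \<in> J" if "r \<in> carrier A" "r \<odot>\<^bsub>?N\<^esub> ?m = \<zero>\<^bsub>?N\<^esub>" for r
    using that kerN[OF that(1)] ann_notin_J[OF that(1) a_carr] not_Q_nonzero[OF a(2)] by blast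
  have cov2: "projective_cover A rank1 ?q ?N" by (rule free_projective_cover[OF N m imN kJ])
  have ker2: "mod_ker rank1 ?N ?q = mult_map b ` carrier rank1"
  proof -
    have "?q {vector1 r} = \<zero>\<^bsub>?N\<^esub> \<longleftrightarrow> mult_map a {vector1 r} = \<zero>\<^bsub>rank1\<^esub>" if r: "r \<in> carrier A" for r
      unfolding rank1_hom_apply[OF N m r] kerN[OF r] mult_map(2)[OF a_carr r] free_module_1_zero
      using vector1_inject by blast
    hence "mod_ker rank1 ?N ?q = mod_ker rank1 rank1 (mult_map a)"
      unfolding mod_ker_def free_module_1_carrier by blast
    thus ?thesis using mult_map_exact[OF cb a_carr ann(1)] by simp
  qed
  have "is_syzygy A ?N C"
    unfolding is_syzygy_def
    using cov2 mod_iso_sym[OF C_iso[OF cb b(4)] C_mod mult_map_image_mod[OF cb]] ker2 by metis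
  thus ?thesis unfolding Omega_periodic_le2_def using syz1 N by blast
qed

section \<open>Evaluation into the bidual of C(a)\<close>

abbreviation "D \<equiv> dual_module A C"

definition evaluation where
  "evaluation x = (\<lambda>\<phi>\<in>carrier D. \<phi> x)"

lemma D_carrier: "carrier D = mod_hom A C (regular_module A)"
  by (simp add: Hom_module_def)

lemma D_mod: "module A D"
  by (rule Hom_module_module[OF C_mod module_regular])

lemma evaluation_hom: assumes x: "x \<in> carrier C" shows "evaluation x \<in> mod_hom A D (regular_module A)"
  unfolding evaluation_def
proof (rule mod_homI[OF _ _ _ D_mod])
  show "\<phi> x \<in> carrier (regular_module A)" if "\<phi> \<in> carrier D" for \<phi>
    using that mod_hom_closed[OF _ x] unfolding D_carrier by blast
qed (use x in \<open>simp_all add: Hom_module_def\<close>)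

lemma reflexive_iff: "reflexive_module A C \<longleftrightarrow>
    inj_on evaluation (carrier C) \<and> evaluation ` carrier C = mod_hom A D (regular_module A)"
proof -
  have "evaluation = (\<lambda>x. \<lambda>\<phi>\<in>carrier D. \<phi> x)" by (rule ext) (simp add: evaluation_def)
  thus ?thesis unfolding reflexive_module_def bij_betw_def by (simp add: Hom_module_def)
qed

text \<open>The dual is cyclic, generated by the homomorphism \<open>\<beta>\<close> with value
  \<open>b\<close> at the generator, since ann(a) = Ab. Injectivity: rb = 0 puts r in ann(b) = U(a).
  Surjectivity: a functional on the dual is determined by its value at \<open>\<beta>\<close>, which
  is killed by \<open>a\<close> and hence of the form rb.\<close>

lemma not_linked_reflexive: assumes "\<not> linked a" shows "reflexive_module A C"
proof -
  obtain b where b: "b \<in> J" "b \<notin> Q" "ann a = LE b Q" "ann b = U" "LE b Q = PIdl b" "U = PIdl a"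
    using exact_pair[OF assms] .
  have cb: "b \<in> carrier A" using b by simp
  have "b \<in> ann a" unfolding b(3) by (rule LE_self[OF b(1) Q_subset_J Q_zero])
  then obtain \<beta> where \<beta>: "\<beta> \<in> mod_hom A C (regular_module A)" "\<And>r. r \<in> carrier A \<Longrightarrow> \<beta> (\<pi> r) = r \<otimes> b"
    using dual_exists by blast
  have \<beta>D: "\<beta> \<in> carrier D" unfolding D_carrier by (rule \<beta>(1))
  have multiple: "\<exists>t\<in>carrier A. \<phi> = t \<odot>\<^bsub>D\<^esub> \<beta>" if \<phi>: "\<phi> \<in> carrier D" for \<phi>
  proof -
    have \<phi>': "\<phi> \<in> mod_hom A C (regular_module A)" using \<phi> unfolding D_carrier .
    have "\<phi> (\<pi> \<one>) \<in> PIdl b" using dual_value(2)[OF \<phi>'] unfolding b(3,5) .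
    then obtain t where t: "t \<in> carrier A" "\<phi> (\<pi> \<one>) = t \<otimes> b" unfolding cgenideal_def by blast
    have tD: "t \<odot>\<^bsub>D\<^esub> \<beta> \<in> mod_hom A C (regular_module A)"
      using module.smult_closed[OF D_mod t(1) \<beta>D] unfolding D_carrier .
    have "\<phi> = t \<odot>\<^bsub>D\<^esub> \<beta>"
    proof (rule mod_hom_ext[OF \<phi>' tD])
      fix x assume x: "x \<in> carrier C"
      then obtain r where r: "r \<in> carrier A" "x = \<pi> r" by (rule C_E)
      have "(t \<odot>\<^bsub>D\<^esub> \<beta>) x = t \<otimes> \<beta> x" using x by (simp add: Hom_module_def)
      also have "\<dots> = r \<otimes> (t \<otimes> b)" unfolding r(2) \<beta>(2)[OF r(1)] using t(1) r(1) cb by (simp add: m_lcomm)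
      finally show "\<phi> x = (t \<odot>\<^bsub>D\<^esub> \<beta>) x" unfolding r(2) dual_value(1)[OF \<phi>' r(1)] t(2) ..
    qed
    thus ?thesis using t(1) by blast
  qed
  have inj: "inj_on evaluation (carrier C)"
  proof (rule inj_onI)
    fix x y assume xy: "x \<in> carrier C" "y \<in> carrier C" "evaluation x = evaluation y"
    interpret C: module A C by (rule C_mod)
    have "\<beta> x = \<beta> y" using fun_cong[OF xy(3), of \<beta>] \<beta>D by (simp add: evaluation_def)
    have d: "x \<ominus>\<^bsub>C\<^esub> y \<in> carrier C" by (rule C.M.minus_closed[OF xy(1,2)])
    then obtain r where r: "r \<in> carrier A" "x \<ominus>\<^bsub>C\<^esub> y = \<pi> r" by (rule C_E)
    interpret reg: module A "regular_module A" by (rule module_regular)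
    have "\<beta> (x \<ominus>\<^bsub>C\<^esub> y) = \<beta> x \<ominus>\<^bsub>regular_module A\<^esub> \<beta> y"
      by (rule mod_hom_minus[OF \<beta>(1) C_mod module_regular xy(1,2)])
    also have "\<dots> = \<zero>\<^bsub>regular_module A\<^esub>" unfolding \<open>\<beta> x = \<beta> y\<close> reg.M.minus_eq
      by (rule reg.M.r_neg[OF mod_hom_closed[OF \<beta>(1) xy(2)]])
    finally have "r \<otimes> b = \<zero>" using \<beta>(2)[OF r(1)] r(2) by simp
    hence "r \<in> ann b" using r(1) m_comm[OF r(1) cb] by simp
    hence "\<pi> r = \<zero>\<^bsub>C\<^esub>" unfolding b(4) using \<pi>_ker[OF r(1)] by blast
    hence z: "x \<ominus>\<^bsub>C\<^esub> y = \<zero>\<^bsub>C\<^esub>" using r(2) by simp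
    have "x = (x \<ominus>\<^bsub>C\<^esub> y) \<oplus>\<^bsub>C\<^esub> y"
      using xy(1,2) by (simp add: C.M.minus_eq C.M.a_assoc C.M.l_neg)
    thus "x = y" using z xy(2) by simp
  qed
  have "mod_hom A D (regular_module A) \<subseteq> evaluation ` carrier C"
  proof
    fix \<theta> assume \<theta>: "\<theta> \<in> mod_hom A D (regular_module A)"
    have \<theta>c: "\<theta> \<beta> \<in> carrier A" using mod_hom_closed[OF \<theta> \<beta>D] by simp
    have ab: "a \<otimes> b = \<zero>" using \<open>b \<in> ann a\<close> by simp
    \<comment> \<open>Both sides are the zero homomorphism; written as a multiple by zero, it lets
      linearity of \<open>\<theta>\<close> give a \<theta>(\<beta>) = 0.\<close>
    have "a \<odot>\<^bsub>D\<^esub> \<beta> = \<zero> \<odot>\<^bsub>D\<^esub> \<beta>"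
    proof -
      have "a \<otimes> \<beta> x = \<zero> \<otimes> \<beta> x" if x: "x \<in> carrier C" for x
      proof -
        obtain r where r: "r \<in> carrier A" "x = \<pi> r" using x by (rule C_E)
        have "a \<otimes> (r \<otimes> b) = r \<otimes> (a \<otimes> b)" using r(1) cb a_carr by (simp add: m_lcomm)
        thus ?thesis unfolding r(2) \<beta>(2)[OF r(1)] using r(1) cb ab by simp
      qed
      thus ?thesis by (simp add: Hom_module_def cong: restrict_cong)
    qed
    hence "a \<otimes> \<theta> \<beta> = \<zero> \<otimes> \<theta> \<beta>"
      using mod_hom_smult[OF \<theta> a_carr \<beta>D] mod_hom_smult[OF \<theta> zero_closed \<beta>D] by simp
    hence "\<theta> \<beta> \<in> ann a" using \<theta>c by simp
    hence "\<theta> \<beta> \<in> PIdl b" unfolding b(3,5) .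
    then obtain r where r: "r \<in> carrier A" "\<theta> \<beta> = r \<otimes> b" unfolding cgenideal_def by blast
    have "\<theta> = evaluation (\<pi> r)"
    proof (rule mod_hom_ext[OF \<theta> evaluation_hom[OF \<pi>_closed[OF r(1)]]])
      fix \<phi> assume \<phi>: "\<phi> \<in> carrier D"
      obtain t where t: "t \<in> carrier A" "\<phi> = t \<odot>\<^bsub>D\<^esub> \<beta>" using multiple[OF \<phi>] by blast
      have "\<theta> \<phi> = t \<otimes> \<theta> \<beta>" unfolding t(2) using mod_hom_smult[OF \<theta> t(1) \<beta>D] by simp
      also have "\<dots> = t \<otimes> \<beta> (\<pi> r)" unfolding r(2) \<beta>(2)[OF r(1)] ..
      also have "\<dots> = \<phi> (\<pi> r)" unfolding t(2) using \<pi>_closed[OF r(1)] by (simp add: Hom_module_def)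
      finally show "\<theta> \<phi> = evaluation (\<pi> r) \<phi>" using \<phi> by (simp add: evaluation_def)
    qed
    thus "\<theta> \<in> evaluation ` carrier C" using \<pi>_closed[OF r(1)] by blast
  qed
  moreover have "evaluation ` carrier C \<subseteq> mod_hom A D (regular_module A)" using evaluation_hom by blast
  ultimately show ?thesis unfolding reflexive_iff using inj by blast
qed

text \<open>Under the identification of the dual with ann(a), evaluation at the class of r is
  multiplication by r. Surjectivity of evaluation thus makes each homomorphism from ann(a) to A a
  multiplication; this is applied to the functional x \<mapsto> p that kills \<open>y\<close> and
  \<open>Q\<close>.\<close>

lemma functional_evaluation:
  assumes onto: "evaluation ` carrier C = mod_hom A D (regular_module A)"
    and ann: "ann a = LE x (LE y Q)" and x: "x \<in> J" "x \<notin> LE y Q" and y: "y \<in> J" "y \<notin> Q" and p: "p \<in> Q"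
  obtains r where "r \<in> J" "r \<otimes> x = p" "r \<otimes> y = \<zero>"
proof -
  have cx: "x \<in> carrier A" "y \<in> carrier A" using x y by auto
  have dE: "dimension 3 S (LE y Q)" by (rule dim_LE2(1)[OF y x])
  have sub: "LE y Q \<subseteq> J" by (rule LE_in_J[OF y(1) Q_subset_J])
  have WJ: "LE x (LE y Q) \<subseteq> J" by (rule LE_in_J[OF x(1) sub])
  have JW: "j \<otimes> w \<in> LE y Q" if "j \<in> J" "w \<in> LE x (LE y Q)" for j w
    using J_mult[OF that(1)] that(2) WJ LE_incl[OF y(1) Q_subset_J] by blast
  obtain h where h: "h \<in> mod_hom A ((regular_module A)\<lparr>carrier := LE x (LE y Q)\<rparr>) (regular_module A)"
    "\<And>k v. k \<in> S \<Longrightarrow> v \<in> LE y Q \<Longrightarrow> h (k \<otimes> x \<oplus> v) = k \<otimes> p"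
    using functional_hom[OF dE cx(1) x(2) ideal_LE2[OF y(1) x(1)] WJ JW p] by blast
  \<comment> \<open>Evaluation at the generator is the identification of the dual with ann(a).
    Composed with \<open>h\<close> it is a functional on the dual.\<close>
  let ?e = "evaluation (\<pi> \<one>)"
  have e: "?e \<in> mod_hom A D (regular_module A)" by (rule evaluation_hom[OF \<pi>_closed[OF one_closed]])
  have "?e ` carrier D \<subseteq> ann a"
  proof (rule image_subsetI)
    fix \<phi> assume \<phi>: "\<phi> \<in> carrier D"
    show "?e \<phi> \<in> ann a" using dual_value(2)[of \<phi>] \<phi> unfolding D_carrier evaluation_def by simp
  qed
  hence e': "?e \<in> mod_hom A D ((regular_module A)\<lparr>carrier := LE x (LE y Q)\<rparr>)"
    unfolding ann by (rule mod_hom_codomain[OF e])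
  have "compose (carrier D) h ?e \<in> evaluation ` carrier C"
    unfolding onto by (rule mod_hom_compose[OF e' h(1) D_mod])
  then obtain c where c: "c \<in> carrier C" "compose (carrier D) h ?e = evaluation c" by blast
  obtain r where r: "r \<in> carrier A" "c = \<pi> r" using c(1) by (rule C_E)
  have act: "h u = r \<otimes> u" if u: "u \<in> ann a" for u
  proof -
    obtain \<phi> where \<phi>: "\<phi> \<in> mod_hom A C (regular_module A)" "\<And>r. r \<in> carrier A \<Longrightarrow> \<phi> (\<pi> r) = r \<otimes> u"
      using dual_exists[OF u] by blast
    have \<phi>D: "\<phi> \<in> carrier D" unfolding D_carrier by (rule \<phi>(1))
    have "\<phi> (\<pi> \<one>) = u" using \<phi>(2)[OF one_closed] u by simp
    thus ?thesis using fun_cong[OF c(2), of \<phi>] \<phi>D \<phi>(2)[OF r(1)] by (simp add: compose_def evaluation_def r(2))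
  qed
  have yE: "y \<in> LE y Q" by (rule LE_self[OF y(1) Q_subset_J Q_zero])
  have zE: "\<zero> \<in> LE y Q" using LE_incl[OF y(1) Q_subset_J] Q_zero by blast
  have xa: "x \<in> ann a" unfolding ann by (rule LE_self[OF x(1) sub zE])
  have ya: "y \<in> ann a" unfolding ann using LE_incl[OF x(1) sub] yE by blast
  have "h x = p" using h(2)[of \<one> \<zero>] zE cx p by simp
  hence 1: "r \<otimes> x = p" using act[OF xa] by simp
  have "h y = \<zero>" using h(2)[of \<zero> y] yE cx p by simp
  hence 2: "r \<otimes> y = \<zero>" using act[OF ya] by simp
  have "r \<in> J" using ann_notin_J[OF r(1) cx(2) 2] not_Q_nonzero[OF y(2)] by blast
  thus ?thesis using that 1 2 by blast
qed

text \<open>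
  If \<open>aJ \<noteq> Q\<close>, reflexivity would give \<open>r1\<close>, \<open>r2\<close>, \<open>r3\<close> in \<open>J\<close> which together with \<open>a\<close> are linearly independent
  in the three-dimensional space \<open>J/Q\<close>.
\<close>

lemma linked_not_reflexive: assumes "linked a" shows "\<not> reflexive_module A C"
proof
  assume "reflexive_module A C"
  hence inj: "inj_on evaluation (carrier C)" and onto: "evaluation ` carrier C = mod_hom A D (regular_module A)"
    unfolding reflexive_iff by blast+
  show False
    using a assms
  proof (cases rule: linked_cases)
    case (onto b s d)
    have cd: "d \<in> carrier A" using onto(7) by simp
    \<comment> \<open>\<open>d\<close> kills ann(a) = kb + Q, so every homomorphism from C(a) to A
      vanishes on the class of \<open>d\<close>, although \<open>d\<close> lies outside
      U(a).\<close>
    have zero: "\<phi> (\<pi> d) = \<phi> (\<pi> \<zero>)" if \<phi>: "\<phi> \<in> mod_hom A C (regular_module A)" for \<phi>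
    proof -
      have "\<phi> (\<pi> \<one>) \<in> LE b Q" using dual_value(2)[OF \<phi>] unfolding onto(3) .
      then obtain k q where k: "k \<in> S" "q \<in> Q" "\<phi> (\<pi> \<one>) = k \<otimes> b \<oplus> q" by (rule LE_QE)
      have "d \<otimes> \<phi> (\<pi> \<one>) = k \<otimes> (b \<otimes> d) \<oplus> d \<otimes> q"
        unfolding k(3) using cd S_carr[OF k(1)] Q_carr[OF k(2)] J_carr[OF onto(1)] by algebra
      also have "\<dots> = \<zero>" using onto(9) JQ_zero[OF onto(7) k(2)] k(1) by simp
      finally have "\<phi> (\<pi> d) = \<zero>" unfolding dual_value(1)[OF \<phi> cd] .
      moreover have "\<phi> (\<pi> \<zero>) = \<zero>"
        unfolding dual_value(1)[OF \<phi> zero_closed] using mod_hom_closed[OF \<phi> \<pi>_closed[OF one_closed]] by simp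
      ultimately show ?thesis by simp
    qed
    have "evaluation (\<pi> d) = evaluation (\<pi> \<zero>)"
      unfolding evaluation_def D_carrier by (rule restrict_ext) (rule zero)
    hence "\<pi> d = \<pi> \<zero>" using inj_onD[OF inj] \<pi>_closed cd zero_closed by blast
    moreover have "\<pi> \<zero> = \<zero>\<^bsub>C\<^esub>" using mod_hom_zero[OF \<pi>_hom module_regular C_mod] by simp
    ultimately have "d \<in> U" using \<pi>_ker[OF cd] by simp
    thus False using onto(8) by blast
  next
    case (not_onto s' b c)
    have sub: "LE b Q \<subseteq> J" by (rule LE_in_J[OF not_onto(3) Q_subset_J])
    have cc: "b \<in> carrier A" "c \<in> carrier A" using not_onto by auto
    have cQ: "c \<notin> Q" using not_onto(6) LE_incl[OF not_onto(3) Q_subset_J] by blast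
    have bQ: "b \<notin> LE c Q"
    proof
      assume "b \<in> LE c Q"
      then obtain k q where k: "k \<in> S" "q \<in> Q" "b = k \<otimes> c \<oplus> q" by (rule LE_QE)
      have ck: "k \<in> carrier A" "q \<in> carrier A" using k by auto
      have k0: "k \<noteq> \<zero>" using k(2,3) not_onto(4) ck cc by auto
      have "k \<otimes> c = \<one> \<otimes> b \<oplus> \<ominus> q" unfolding k(3) using ck cc by algebra
      hence "k \<otimes> c \<in> LE b Q" by (intro LE_QI[of \<one> "\<ominus> q"]) (use k(2) in auto)
      hence "c \<in> LE b Q"
        using space_subgroup_props(6)[OF subfield_S dim_LE2(1)[OF not_onto(3-6)], of k c] k(1) k0 cc by blast
      thus False using not_onto(6) by blast
    qed
    \<comment> \<open>\<open>functional_evaluation\<close> singles out the outer generator;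
      exchanging b and c yields a functional that is nonzero on \<open>b\<close> instead.\<close>
    have swap: "LE c (LE b Q) = LE b (LE c Q)"
    proof -
      have 1: "LE c (LE b Q) \<subseteq> LE b (LE c Q)"
      proof
        fix u assume "u \<in> LE c (LE b Q)"
        then obtain k l q where k: "k \<in> S" "l \<in> S" "q \<in> Q" "u = k \<otimes> c \<oplus> l \<otimes> b \<oplus> q"
          using LE2_QE[OF _ not_onto(3,5)] by blast
        have "u = l \<otimes> b \<oplus> k \<otimes> c \<oplus> q" unfolding k(4) using k(1-3) cc by (simp add: a_comm)
        thus "u \<in> LE b (LE c Q)" by (rule LE2_QI[OF k(2,1,3) not_onto(5,3)])
      qed
      show ?thesis
        by (rule dim_eq[OF dim_LE2(2)[OF not_onto(3-6)] dim_LE2(2)[OF not_onto(5) cQ not_onto(3) bQ] 1])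
    qed
    \<comment> \<open>\<open>r1\<close> and \<open>r2\<close> will send \<open>c\<close> to the two
      basis vectors of \<open>Q\<close> and kill \<open>b\<close>, while \<open>r3\<close> sends
      \<open>b\<close> to \<open>s\<close>. The independence of a, r1, r2 modulo \<open>Q\<close> is
      tested against \<open>c\<close>, which \<open>a\<close> kills.\<close>
    obtain s t where st: "s \<in> Q" "s \<noteq> \<zero>" "t \<in> Q" "t \<notin> LE s {\<zero>}" by (rule Q_basis)
    have cst: "s \<in> carrier A" "t \<in> carrier A" using st by auto
    obtain r1 where r1: "r1 \<in> J" "r1 \<otimes> c = s" "r1 \<otimes> b = \<zero>"
      using functional_evaluation[OF onto not_onto(7) not_onto(5,6,3,4) st(1)] .
    obtain r2 where r2: "r2 \<in> J" "r2 \<otimes> c = t" "r2 \<otimes> b = \<zero>"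
      using functional_evaluation[OF onto not_onto(7) not_onto(5,6,3,4) st(3)] .
    obtain r3 where r3: "r3 \<in> J" "r3 \<otimes> b = s" "r3 \<otimes> c = \<zero>"
      using functional_evaluation[OF onto _ not_onto(3) bQ not_onto(5) cQ st(1)] not_onto(7) swap by metis
    have cr: "r1 \<in> carrier A" "r2 \<in> carrier A" "r3 \<in> carrier A" using r1 r2 r3 by auto
    have "b \<in> LE b Q" by (rule LE_self[OF not_onto(3) Q_subset_J Q_zero])
    hence "b \<in> ann a" "c \<in> ann a"
      unfolding not_onto(7) using LE_incl[OF not_onto(5) sub] LE_self[OF not_onto(5) sub]
        LE_incl[OF not_onto(3) Q_subset_J] Q_zero by blast+
    hence ab: "a \<otimes> b = \<zero>" "a \<otimes> c = \<zero>" by auto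
    have r1U: "r1 \<notin> U"
    proof
      assume "r1 \<in> U"
      then obtain k q where k: "k \<in> S" "q \<in> Q" "r1 = k \<otimes> a \<oplus> q" by (rule LE_QE)
      have "r1 \<otimes> c = k \<otimes> (a \<otimes> c) \<oplus> q \<otimes> c"
        unfolding k(3) using S_carr[OF k(1)] Q_carr[OF k(2)] a_carr cc by algebra
      hence "s = \<zero>" using r1(2) ab(2) QJ_zero[OF k(2) not_onto(5)] k(1) by simp
      thus False using st(2) by blast
    qed
    have r2U: "r2 \<notin> LE r1 U"
    proof
      assume "r2 \<in> LE r1 U"
      then obtain k l q where k: "k \<in> S" "l \<in> S" "q \<in> Q" "r2 = k \<otimes> r1 \<oplus> l \<otimes> a \<oplus> q"
        using LE2_QE[OF _ a(1) r1(1)] by blast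
      have "r2 \<otimes> c = k \<otimes> (r1 \<otimes> c) \<oplus> l \<otimes> (a \<otimes> c) \<oplus> q \<otimes> c"
        unfolding k(4) using S_carr[OF k(1)] S_carr[OF k(2)] Q_carr[OF k(3)] a_carr cc cr by algebra
      hence "t = k \<otimes> s" using r2(2) r1(2) ab(2) QJ_zero[OF k(3) not_onto(5)] k(1,2) cst by simp
      thus False using st(4) k(1) LE_zero_iff[OF cst(1)] by blast
    qed
    \<comment> \<open>J/Q has dimension 3, so \<open>r3\<close> is a combination of a, r1, r2 modulo
      \<open>Q\<close>; all of these, and \<open>Q\<close>, kill \<open>b\<close>, but
      \<open>r3\<close> does not.\<close>
    obtain k l m q where k: "k \<in> S" "l \<in> S" "m \<in> S" "q \<in> Q" "r3 = k \<otimes> r2 \<oplus> l \<otimes> r1 \<oplus> m \<otimes> a \<oplus> q"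
      using span_J[OF a r1(1) r1U r2(1) r2U r3(1)] .
    have "r3 \<otimes> b = k \<otimes> (r2 \<otimes> b) \<oplus> l \<otimes> (r1 \<otimes> b) \<oplus> m \<otimes> (a \<otimes> b) \<oplus> q \<otimes> b"
      unfolding k(5)
      using S_carr[OF k(1)] S_carr[OF k(2)] S_carr[OF k(3)] Q_carr[OF k(4)] a_carr cc cr(1,2) by algebra
    hence "s = \<zero>" using r3(2) r2(3) r1(3) ab(1) QJ_zero[OF k(4) not_onto(3)] k(1-3) by simp
    thus False using st(2) by blast
  qed
qed

end

theorem proposition11p2:
  fixes K :: "('k, 'l) ring_scheme" and A :: "('k, 'a, 'm) module_scheme"
    and E :: "'a set" and a :: 'a
  assumes "algebraically_closed K"
    and "special_algebra K A"
    and "complement_in_radical K A E"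
    and "a \<in> E" and "a \<noteq> \<zero>\<^bsub>A\<^esub>"
  shows
    "let C = C_module A a;
         T = (regular_module A)\<lparr>carrier := trace_submodule A C (regular_module A)\<rparr>;
         no_bar = (\<not> (\<exists>N. bar K A N \<and> a \<in> N))
     in atom_module A C \<and>
        (no_bar \<longleftrightarrow> extensionless A C) \<and>
        (no_bar \<longleftrightarrow> atom_module A T) \<and>
        (no_bar \<longleftrightarrow> gorenstein_projective A C) \<and>
        (no_bar \<longleftrightarrow> reflexive_module A C) \<and>
        (atom_module A T \<longrightarrow> torsionless A C) \<and>
        (no_bar \<longrightarrow> Omega_periodic_le2 A C)"
proof -
  have alg: "special_comm_algebra K A" using assms(1,2) by (rule special_comm_algebra.intro)
  interpret special_element K A a
    by (intro special_element.intro special_element_axioms.intro alg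
        special_comm_algebra.complement_not_Q[OF alg assms(3-5)])
  \<comment> \<open>Everything is compared with \<open>linked a\<close>: each of the equivalent
    properties holds when \<open>a\<close> is not linked and fails when it is.
    Gorenstein-projectivity fails by way of \<open>extends\<close>, since it would imply that
    homomorphisms extend from U(a).\<close>
  show ?thesis
    unfolding Let_def trace_eq bar_iff_linked[OF a]
    using atom_C extensionless_C_iff not_linked_extends linked_not_extends
      not_linked_atom_T linked_not_atom_T not_linked_gorenstein gorenstein_projective_imp_extends
      not_linked_reflexive linked_not_reflexive not_linked_torsionless not_linked_periodic
    by blast
qed

end
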